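(* Let $\Sigma$ be a connected oriented minimal surface immersed in $\mathbb{R}^3$, with induced metric $\mathbf{g}_\Sigma$, Gauss curvature $\mathcal{K}=\mathcal{K}_{\mathbf{g}_\Sigma}<0$ everywhere, and unit normal vector field $\mathbf{N}$. Let $\mathbf{V}$ be a constant unit vector field in $\mathbb{R}^3$ such that the angle function $\mathbf{N}_{\mathbf{V}}=\langle \mathbf{N},\mathbf{V}\rangle_{\mathbb{R}^3}$ takes values in $(-1,1)$ on $\Sigma$. Define the second Chern-Ricci function on $\Sigma$ by $$\mathrm{CR}^2_{\mathbf{V}} := \ln\left( (-\mathcal{K})^{-\frac12}\,\left(1-\mathbf{N}_{\mathbf{V}}^{\,2}\right)\right).$$ Then: (1) $\mathrm{CR}^2_{\mathbf{V}}$ is harmonic on $\Sigma$, that is, $$\triangle_{\mathbf{g}_\Sigma}\, \ln\left(\frac{1-\mathbf{N}_{\mathbf{V}}^{\,2}}{(-\mathcal{K})^{\frac12}}\right)=0 .$$ (2) If $\mathrm{CR}^2_{\mathbf{V}}$ is constant on $\Sigma$, then, up to isometries of $\mathbb{R}^3$, $\Sigma$ is a part of the minimal surface given by the Weierstrass data $$\left(\mathbf{g}(\zeta),\ \frac{1}{\mathbf{g}'(\zeta)}\,d\zeta\right)=\left(e^{\alpha(\zeta-\zeta_0)},\ \frac{1}{\alpha}\,e^{-\alpha(\zeta-\zeta_0)}\,d\zeta\right),\qquad \zeta\in\mathbb{C},$$ for some constants $\alpha\in\mathbb{C}\setminus\{0\}$ and $\zeta_0\in\mathbb{C}$. Moreover,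 the moduli space of minimal surfaces of constant second Chern-Ricci function (the class of all connected oriented minimal surfaces immersed in $\mathbb{R}^3$ with $\mathcal{K}<0$ for which there exists a constant unit vector field $\mathbf{V}$ with $-1<\mathbf{N}_{\mathbf{V}}<1$ and $\mathrm{CR}^2_{\mathbf{V}}$ constant) contains catenoids, helicoids, and the members of their associate families.
   Context: $\triangle_{\mathbf{g}_\Sigma}$ denotes the Laplace-Beltrami operator of the induced metric $\mathbf{g}_\Sigma$. The angle function of an oriented surface $\Sigma$ in $\mathbb{R}^3$ with unit normal $\mathbf{N}$, with respect to a constant unit vector field $\mathbf{V}$, is $\mathbf{N}_{\mathbf{V}}(p)=\langle \mathbf{N}(p),\mathbf{V}\rangle_{\mathbb{R}^3}\in[-1,1]$ for $p\in\Sigma$. The minimal surface given by Weierstrass data $(G(\zeta),\Psi(\zeta)\,d\zeta)$ on a simply connected domain in $\mathbb{C}$ is the conformal harmonic map (Enneper-Weierstrass representation, determined up to translation) $$\mathbf{X}(\zeta)=\mathbf{X}(\zeta_0)+\left(\mathrm{Re}\int_{\zeta_0}^{\zeta}\phi_1\,d\zeta,\ \mathrm{Re}\int_{\zeta_0}^{\zeta}\phi_2\,d\zeta,\ \mathrm{Re}\int_{\zeta_0}^{\zeta}\phi_3\,d\zeta\right),$$ $$(\phi_1,\phi_2,\phi_3)=\left(\tfrac12(1-G^2)\Psi,\ \tfrac{i}{2}(1+G^2)\Psi,\ G\Psi\right).$$ The associate family of this surface consists of the minimal surfaces with Weierstrass data $(G,e^{i\theta}\Psi\,d\zeta)$, $\theta\in\mathbb{R}$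 (for a non-simply connected surface such as the catenoid, the associate family is defined on its universal cover). That $\Sigma$, with immersion $\mathbf{X}_\Sigma:\Sigma\to\mathbb{R}^3$, is, up to isometries of $\mathbb{R}^3$, a part of the minimal surface given by a map $\mathbf{X}:\mathbb{C}\to\mathbb{R}^3$ means: there is a single isometry $S$ of $\mathbb{R}^3$ such that every point of $\Sigma$ has an open neighborhood $U$ and a diffeomorphism $\varphi$ from $U$ onto an open subset of $\mathbb{C}$ with $\mathbf{X}_\Sigma|_U=S\circ\mathbf{X}\circ\varphi$. *)

theory Defs
  imports "HOL-Complex_Analysis.Complex_Analysis"
begin

section \<open>Smooth maps on open subsets of normed spaces\<close>

text \<open>Meant for open \<open>S\<close> in a finite-dimensional space, where it is the usual notion of \<open>C\<^sup>k\<close>: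
  all directional derivatives of order at most \<open>k\<close> exist, as values of successive total
  derivatives, and are continuous.\<close>

primrec Ck_on ::
  "nat \<Rightarrow> 'b::real_normed_vector set \<Rightarrow> ('b \<Rightarrow> 'c::real_normed_vector) \<Rightarrow> bool" where
  "Ck_on 0 S f \<longleftrightarrow> continuous_on S f"
| "Ck_on (Suc k) S f \<longleftrightarrow>
     (\<forall>u\<in>S. f differentiable (at u)) \<and>
     (\<forall>v. Ck_on k S (\<lambda>u. frechet_derivative f (at u) v))"

definition smooth_on ::
  "'b::real_normed_vector set \<Rightarrow> ('b \<Rightarrow> 'c::real_normed_vector) \<Rightarrow> bool" where
  "smooth_on S f \<longleftrightarrow> (\<forall>k. Ck_on k S f)"

section \<open>Riemannian geometry in a coordinate domain of the plane\<close>

definition partial :: "2 \<Rightarrow> (real^2 \<Rightarrow> 'b::real_normed_vector) \<Rightarrow> real^2 \<Rightarrow> 'b" where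
  "partial i f u = frechet_derivative f (at u) (axis i 1)"

type_synonym metric = "real^2 \<Rightarrow> real^2^2"

text \<open>The Christoffel symbol of the second kind, with upper index \<open>k\<close> and lower indices
  \<open>i\<close>, \<open>j\<close>.\<close>

definition christoffel :: "metric \<Rightarrow> 2 \<Rightarrow> 2 \<Rightarrow> 2 \<Rightarrow> real^2 \<Rightarrow> real" where
  "christoffel g k i j u =
     (1/2) * (\<Sum>l\<in>UNIV. matrix_inv (g u) $ k $ l *
        (partial i (\<lambda>v. g v $ j $ l) u + partial j (\<lambda>v. g v $ i $ l) u
         - partial l (\<lambda>v. g v $ i $ j) u))"

text \<open>The \<open>l\<close>-th component of \<open>R(\<partial>\<^sub>i,\<partial>\<^sub>j)\<partial>\<^sub>k\<close>, with the convention
  \<open>R(X,Y)Z = \<nabla>\<^sub>X\<nabla>\<^sub>Y Z - \<nabla>\<^sub>Y\<nabla>\<^sub>X Z - \<nabla>\<^bsub>[X,Y]\<^esub> Z\<close>.\<close>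

definition riemann :: "metric \<Rightarrow> 2 \<Rightarrow> 2 \<Rightarrow> 2 \<Rightarrow> 2 \<Rightarrow> real^2 \<Rightarrow> real" where
  "riemann g l i j k u =
     partial i (christoffel g l j k) u - partial j (christoffel g l i k) u
     + (\<Sum>m\<in>UNIV. christoffel g m j k u * christoffel g l i m u
                  - christoffel g m i k u * christoffel g l j m u)"

text \<open>\<open>\<langle>R(\<partial>\<^sub>1,\<partial>\<^sub>2)\<partial>\<^sub>2, \<partial>\<^sub>1\<rangle> / det g\<close>; positive for the round sphere.\<close>

definition metric_curvature :: "metric \<Rightarrow> real^2 \<Rightarrow> real" where
  "metric_curvature g u = (\<Sum>l\<in>UNIV. riemann g l 1 2 2 u * g u $ l $ 1) / det (g u)"

definition metric_laplacian :: "metric \<Rightarrow> (real^2 \<Rightarrow> real) \<Rightarrow> real^2 \<Rightarrow> real" where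
  "metric_laplacian g f u =
     (\<Sum>i\<in>UNIV. partial i
        (\<lambda>v. sqrt (det (g v)) * (\<Sum>j\<in>UNIV. matrix_inv (g v) $ i $ j * partial j f v)) u)
     / sqrt (det (g u))"

definition induced_metric :: "(real^2 \<Rightarrow> real^3) \<Rightarrow> metric" where
  "induced_metric Y u = (\<chi> i j. partial i Y u \<bullet> partial j Y u)"

text \<open>Half the trace, with respect to the first fundamental form of \<open>Y\<close>, of the second fundamental
  form with respect to the unit normal \<open>n\<close>.\<close>

definition mean_curvature :: "(real^2 \<Rightarrow> real^3) \<Rightarrow> (real^2 \<Rightarrow> real^3) \<Rightarrow> real^2 \<Rightarrow> real" where
  "mean_curvature Y n u =
     (1/2) * (\<Sum>i\<in>UNIV. \<Sum>j\<in>UNIV.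
        matrix_inv (induced_metric Y u) $ i $ j * (partial i (partial j Y) u \<bullet> n u))"

section \<open>Surfaces\<close>

text \<open>An atlas is a set of local parametrizations \<open>(D, x)\<close>, that is, inverses of coordinate charts:
  \<open>x\<close> maps the open set \<open>D\<close> of the plane homeomorphically onto an open set of the surface.\<close>

type_synonym 'a parametrization = "(real^2) set \<times> (real^2 \<Rightarrow> 'a)"

definition oriented_surface :: "'a topology \<Rightarrow> 'a parametrization set \<Rightarrow> bool" where
  "oriented_surface M A \<longleftrightarrow>
     Hausdorff_space M \<and> second_countable M \<and>
     topspace M = (\<Union>(D,x)\<in>A. x ` D) \<and>
     (\<forall>(D,x)\<in>A. open D \<and> openin M (x ` D) \<and>
        homeomorphic_map (top_of_set D) (subtopology M (x ` D)) x) \<and>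
     (\<forall>(D,x)\<in>A. \<forall>(E,y)\<in>A.
        let W = {u\<in>D. x u \<in> y ` E}; \<tau> = inv_into E y \<circ> x
        in smooth_on W \<tau> \<and> (\<forall>u\<in>W. det (matrix (frechet_derivative \<tau> (at u))) > 0))"

definition smooth_map ::
  "'a parametrization set \<Rightarrow> ('a \<Rightarrow> 'c::real_normed_vector) \<Rightarrow> bool" where
  "smooth_map A f \<longleftrightarrow> (\<forall>(D,x)\<in>A. smooth_on D (f \<circ> x))"

definition immersion :: "'a parametrization set \<Rightarrow> ('a \<Rightarrow> real^3) \<Rightarrow> bool" where
  "immersion A X \<longleftrightarrow> smooth_map A X \<and>
     (\<forall>(D,x)\<in>A. \<forall>u\<in>D. inj (frechet_derivative (X \<circ> x) (at u)))"

text \<open>Either of the two unit normal fields is allowed, whatever the orientation of the atlas.\<close>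

definition unit_normal ::
  "'a parametrization set \<Rightarrow> ('a \<Rightarrow> real^3) \<Rightarrow> ('a \<Rightarrow> real^3) \<Rightarrow> bool" where
  "unit_normal A X N \<longleftrightarrow> smooth_map A N \<and>
     (\<forall>(D,x)\<in>A. \<forall>u\<in>D. norm (N (x u)) = 1 \<and> (\<forall>i. N (x u) \<bullet> partial i (X \<circ> x) u = 0))"

definition minimal_surface ::
  "'a topology \<Rightarrow> 'a parametrization set \<Rightarrow> ('a \<Rightarrow> real^3) \<Rightarrow> ('a \<Rightarrow> real^3) \<Rightarrow> bool" where
  "minimal_surface M A X N \<longleftrightarrow>
     oriented_surface M A \<and> connected_space M \<and> immersion A X \<and> unit_normal A X N \<and>
     (\<forall>(D,x)\<in>A. \<forall>u\<in>D. mean_curvature (X \<circ> x) (N \<circ> x) u = 0)"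

text \<open>Gauss curvature and Laplacian at a point do not depend on the parametrization used to compute
  them; an arbitrary one covering the point is chosen.\<close>

definition param_at :: "'a parametrization set \<Rightarrow> 'a \<Rightarrow> 'a parametrization" where
  "param_at A p = (SOME (D,x). (D,x) \<in> A \<and> p \<in> x ` D)"

definition gauss_curvature ::
  "'a parametrization set \<Rightarrow> ('a \<Rightarrow> real^3) \<Rightarrow> 'a \<Rightarrow> real" where
  "gauss_curvature A X p =
     (let (D,x) = param_at A p in metric_curvature (induced_metric (X \<circ> x)) (inv_into D x p))"

definition laplace_beltrami ::
  "'a parametrization set \<Rightarrow> ('a \<Rightarrow> real^3) \<Rightarrow> ('a \<Rightarrow> real) \<Rightarrow> 'a \<Rightarrow> real" where
  "laplace_beltrami A X f p =
     (let (D,x) = param_at A p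
      in metric_laplacian (induced_metric (X \<circ> x)) (f \<circ> x) (inv_into D x p))"

text \<open>Smoothness is part of the notion, since \<^const>\<open>frechet_derivative\<close> is unspecified
  at points of non-differentiability.\<close>

definition harmonic ::
  "'a topology \<Rightarrow> 'a parametrization set \<Rightarrow> ('a \<Rightarrow> real^3) \<Rightarrow> ('a \<Rightarrow> real) \<Rightarrow> bool" where
  "harmonic M A X f \<longleftrightarrow>
     smooth_map A f \<and> (\<forall>p\<in>topspace M. laplace_beltrami A X f p = 0)"

definition angle_function :: "('a \<Rightarrow> real^3) \<Rightarrow> real^3 \<Rightarrow> 'a \<Rightarrow> real" where
  "angle_function N V p = N p \<bullet> V"

definition CR2 ::
  "'a parametrization set \<Rightarrow> ('a \<Rightarrow> real^3) \<Rightarrow> ('a \<Rightarrow> real^3) \<Rightarrow> real^3 \<Rightarrow> 'a \<Rightarrow> real" where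
  "CR2 A X N V p =
     ln ((- gauss_curvature A X p) powr (-1/2) * (1 - (angle_function N V p)\<^sup>2))"

definition CR2_admissible ::
  "'a topology \<Rightarrow> 'a parametrization set \<Rightarrow> ('a \<Rightarrow> real^3) \<Rightarrow> ('a \<Rightarrow> real^3) \<Rightarrow> real^3 \<Rightarrow> bool" where
  "CR2_admissible M A X N V \<longleftrightarrow>
     minimal_surface M A X N \<and> (\<forall>p\<in>topspace M. gauss_curvature A X p < 0) \<and>
     norm V = 1 \<and> (\<forall>p\<in>topspace M. -1 < angle_function N V p \<and> angle_function N V p < 1)"

definition const_CR2_surface ::
  "'a topology \<Rightarrow> 'a parametrization set \<Rightarrow> ('a \<Rightarrow> real^3) \<Rightarrow> ('a \<Rightarrow> real^3) \<Rightarrow> bool" where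
  "const_CR2_surface M A X N \<longleftrightarrow>
     (\<exists>V. CR2_admissible M A X N V \<and> CR2 A X N V constant_on topspace M)"

section \<open>Weierstrass data\<close>

text \<open>Distance-preserving self-maps of Euclidean space are automatically surjective.\<close>

definition euclidean_isometry :: "(real^3 \<Rightarrow> real^3) \<Rightarrow> bool" where
  "euclidean_isometry S \<longleftrightarrow> (\<forall>p q. dist (S p) (S q) = dist p q)"

text \<open>The minimal surface with Weierstrass data \<open>(G, \<Psi> d\<zeta>)\<close> defined on the whole plane, where it is
  enough to integrate along segments. Of all its translates, the one sending the base point \<open>b\<close> to the
  origin is taken.\<close>

definition weierstrass_surface ::
  "(complex \<Rightarrow> complex) \<Rightarrow> (complex \<Rightarrow> complex) \<Rightarrow> complex \<Rightarrow> complex \<Rightarrow> real^3" where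
  "weierstrass_surface G \<Psi> b \<zeta> = vector
     [Re (contour_integral (linepath b \<zeta>) (\<lambda>z. 1/2 * (1 - (G z)\<^sup>2) * \<Psi> z)),
      Re (contour_integral (linepath b \<zeta>) (\<lambda>z. \<i>/2 * (1 + (G z)\<^sup>2) * \<Psi> z)),
      Re (contour_integral (linepath b \<zeta>) (\<lambda>z. G z * \<Psi> z))]"

definition diffeo_to_plane ::
  "'a parametrization set \<Rightarrow> 'a set \<Rightarrow> ('a \<Rightarrow> complex) \<Rightarrow> bool" where
  "diffeo_to_plane A U \<phi> \<longleftrightarrow>
     inj_on \<phi> U \<and> open (\<phi> ` U) \<and>
     (\<forall>(D,x)\<in>A. smooth_on {u\<in>D. x u \<in> U} (\<phi> \<circ> x) \<and>
        smooth_on {w \<in> \<phi> ` U. inv_into U \<phi> w \<in> x ` D} (inv_into D x \<circ> inv_into U \<phi>))"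

definition part_of_up_to_isometry ::
  "'a topology \<Rightarrow> 'a parametrization set \<Rightarrow> ('a \<Rightarrow> real^3) \<Rightarrow> (complex \<Rightarrow> real^3) \<Rightarrow> bool" where
  "part_of_up_to_isometry M A X Y \<longleftrightarrow>
     (\<exists>S. euclidean_isometry S \<and>
        (\<forall>p\<in>topspace M. \<exists>U \<phi>. openin M U \<and> p \<in> U \<and> diffeo_to_plane A U \<phi> \<and>
           (\<forall>q\<in>U. X q = S (Y (\<phi> q)))))"

section \<open>Catenoids, helicoids and associate families\<close>

definition is_catenoid :: "(real^3) set \<Rightarrow> bool" where
  "is_catenoid C \<longleftrightarrow>
     (\<exists>a S. a > 0 \<and> euclidean_isometry S \<and>
        C = S ` {p. (p$1)\<^sup>2 + (p$2)\<^sup>2 = (a * cosh (p$3 / a))\<^sup>2})"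

definition is_helicoid :: "(real^3) set \<Rightarrow> bool" where
  "is_helicoid C \<longleftrightarrow>
     (\<exists>a S. a > 0 \<and> euclidean_isometry S \<and>
        C = S ` {vector [s * cos t, s * sin t, a * t] |s t. True})"

text \<open>\<open>C\<close>, with the subspace topology and the inclusion as immersion, belongs to the class. For this
  topology and immersion the smooth structure is unique, so the atlas can be quantified
  existentially.\<close>

definition embedded_const_CR2 :: "(real^3) set \<Rightarrow> bool" where
  "embedded_const_CR2 C \<longleftrightarrow> (\<exists>A N. const_CR2_surface (top_of_set C) A (\<lambda>p. p) N)"

definition plane_atlas :: "complex parametrization set" where
  "plane_atlas = {(UNIV, \<lambda>u. Complex (u$1) (u$2))}"

definition plane_const_CR2 :: "(complex \<Rightarrow> real^3) \<Rightarrow> bool" where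
  "plane_const_CR2 Y \<longleftrightarrow> (\<exists>N. const_CR2_surface euclidean plane_atlas Y N)"

text \<open>\<open>(G, \<Psi> d\<zeta>)\<close> are Weierstrass data of the universal cover of \<open>C\<close>, up to an isometry of space, with
  the simply connected plane as parameter domain. For holomorphic \<open>G\<close>, the
  Weierstrass map is an immersion iff \<open>\<Psi>\<close> has no zeros.\<close>

definition universal_cover_data ::
  "(complex \<Rightarrow> complex) \<Rightarrow> (complex \<Rightarrow> complex) \<Rightarrow> (real^3) set \<Rightarrow> bool" where
  "universal_cover_data G \<Psi> C \<longleftrightarrow>
     G holomorphic_on UNIV \<and> \<Psi> holomorphic_on UNIV \<and> (\<forall>\<zeta>. \<Psi> \<zeta> \<noteq> 0) \<and>
     (\<exists>S b. euclidean_isometry S \<and>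
        covering_space UNIV (\<lambda>\<zeta>. S (weierstrass_surface G \<Psi> b \<zeta>)) C)"

end

theory Submission
  imports Defs
begin

text \<open>In terms of Weierstrass data \<open>(G, \<Psi> d\<zeta>)\<close>, with \<open>G\<close> the stereographic projection of the normal
  from the pole \<open>V\<close>, the second Chern-Ricci function is \<open>ln \<bar>Q\<bar>\<close> for the holomorphic function
  \<open>Q = G\<^sup>2 \<Psi> / G'\<close>. This makes it harmonic. If it is constant, then \<open>Q\<close> is a constant \<open>k\<close>; since the
  curvature does not vanish, \<open>ln G\<close> is a local coordinate, and in the coordinate \<open>\<zeta> = ln G / \<alpha>\<close> with
  \<open>\<alpha>\<^sup>2 = 1 / k\<close> the data are \<open>(e\<^bsup>\<alpha>\<zeta>\<^esup>, e\<^bsup>-\<alpha>\<zeta>\<^esup> / \<alpha>)\<close>.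

  The proof works in arbitrary coordinates, so that isothermal coordinates need not be constructed.
  Let \<open>J\<close> be the rotation \<open>Y\<^sub>*(J v) = n \<times> Y\<^sub>* v\<close> of the tangent planes. The quotient \<open>Q\<close> is formed
  from two complex one-forms given by vector algebra: the Gauss form, which is \<open>dG / G\<close>, and the
  height form, which is \<open>G \<Psi> d\<zeta>\<close>. Both are complex linear with respect to \<open>J\<close> and closed
  (\<open>gauss_form_closed\<close>, \<open>height_form_closed\<close>), the latter because minimality means that \<open>n \<times> dY\<close> is
  closed. Hence their quotient is holomorphic for \<open>J\<close> (\<open>quotient_holomorphic\<close>), and \<open>ln \<bar>Q\<bar>\<close> is
  harmonic because \<open>dQ / Q\<close> is closed (\<open>ln_norm_harmonic\<close>). The identity between \<open>\<bar>Q\<bar>\<close> and the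
  Chern-Ricci function (\<open>quotient_norm\<close>) needs the curvature of the metric in terms of the normal,
  that is, the theorema egregium, in the form \<open>dn \<times> dn = K dY \<times> dY\<close> (\<open>curvature_normal_cross\<close>). If
  \<open>Q\<close> is constant, then \<open>G\<close> and the height form determine \<open>dX\<close> (\<open>weierstrass_representation\<close>), and a
  connectedness argument along branches of the logarithm gives one rigid motion for the whole
  surface (\<open>constant_CR2_representation\<close>).

  For catenoids and helicoids the unit normal extends to an explicit vector field \<open>\<nu>\<close> on space.
  Every immersion \<open>X\<close> into such a surface has the normal \<open>\<nu> \<circ> X\<close>, so that its Chern-Ricci function
  can be read off from \<open>\<nu>\<close> (\<open>const_CR2_of_immersion_into\<close>). This applies to the inclusion, with an
  atlas made from the universal covering, and to the Weierstrass map of arbitrary data of the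
  universal cover. The associates have the same metric and the same normal (\<open>associate_const_CR2\<close>).\<close>

(* the dollar sign denotes components of vectors only, not coefficients of formal power series *)
no_notation fps_nth (infixl "$" 75)

section \<open>Calculus of smooth maps\<close>

lemma frechet_derivative_cong_open:
  assumes "open S" "u \<in> S" "\<And>u. u \<in> S \<Longrightarrow> f u = g u"
  shows "frechet_derivative f (at u) = frechet_derivative g (at u)"
    and "f differentiable (at u) \<longleftrightarrow> g differentiable (at u)"
proof -
  have *: "(f has_derivative D) (at u) \<longleftrightarrow> (g has_derivative D) (at u)" for D
    using assms by (metis has_derivative_transform_within_open)
  show "frechet_derivative f (at u) = frechet_derivative g (at u)"
    unfolding frechet_derivative_def * ..
  show "f differentiable (at u) \<longleftrightarrow> g differentiable (at u)"
    unfolding differentiable_def * ..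
qed

text \<open>The definition of \<^const>\<open>Ck_on\<close> differentiates \<open>f\<close> as a total function, but on an open set a
  derivative depends only on the values there.\<close>

lemma Ck_on_cong:
  assumes "open S" "\<And>u. u \<in> S \<Longrightarrow> f u = g u"
  shows "Ck_on k S f \<longleftrightarrow> Ck_on k S g"
  using assms(2)
proof (induction k arbitrary: f g)
  case 0
  then show ?case by (simp cong: continuous_on_cong)
next
  case (Suc k)
  have "Ck_on k S (\<lambda>u. frechet_derivative f (at u) v) =
        Ck_on k S (\<lambda>u. frechet_derivative g (at u) v)" for v
    by (rule Suc.IH)
       (simp add: frechet_derivative_cong_open(1)[OF \<open>open S\<close> _ Suc.prems])
  then show ?case
    using frechet_derivative_cong_open(2)[OF \<open>open S\<close> _ Suc.prems] by (auto cong: ball_cong)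
qed

lemma Ck_on_subset: "Ck_on k S f \<Longrightarrow> T \<subseteq> S \<Longrightarrow> Ck_on k T f"
  by (induction k arbitrary: f) (auto intro: continuous_on_subset)

lemma Ck_on_local:
  assumes "\<And>u. u \<in> S \<Longrightarrow> \<exists>T. open T \<and> u \<in> T \<and> Ck_on k T f"
  shows "Ck_on k S f"
  using assms
proof (induction k arbitrary: f)
  case 0
  show ?case
    unfolding Ck_on.simps
  proof (rule continuous_at_imp_continuous_on, rule ballI)
    fix u assume "u \<in> S"
    then obtain T where "open T" "u \<in> T" "continuous_on T f"
      using 0 by auto
    then show "continuous (at u) f"
      by (simp add: continuous_on_eq_continuous_at)
  qed
next
  case (Suc k)
  have "Ck_on k S (\<lambda>u. frechet_derivative f (at u) v)" for v
    by (rule Suc.IH) (use Suc.prems in force)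
  then show ?case using Suc.prems by force
qed

text \<open>Lower orders do not occur in the definition; they come back because differentiability implies
  continuity.\<close>

lemma Ck_on_SucD: "Ck_on (Suc k) S f \<Longrightarrow> Ck_on k S f"
proof (induction k arbitrary: f)
  case 0
  then show ?case
    by (auto intro!: continuous_at_imp_continuous_on differentiable_imp_continuous_within)
next
  case (Suc k)
  from Suc.prems have d: "\<forall>u\<in>S. f differentiable (at u)"
    and c: "Ck_on (Suc k) S (\<lambda>u. frechet_derivative f (at u) v)" for v
    unfolding Ck_on.simps(2)[of "Suc k"] by blast+
  from Suc.IH[OF c] d show ?case by simp
qed

lemma Ck_on_SucI:
  assumes "open S" "\<And>u. u \<in> S \<Longrightarrow> (f has_derivative f' u) (at u)"
    and "\<And>v. Ck_on k S (\<lambda>u. f' u v)"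
  shows "Ck_on (Suc k) S f"
proof -
  have "frechet_derivative f (at u) v = f' u v" if "u \<in> S" for u v
    using frechet_derivative_at[OF assms(2)[OF that]] by simp
  then have "Ck_on k S (\<lambda>u. frechet_derivative f (at u) v)" for v
    using Ck_on_cong[OF assms(1), of "\<lambda>u. frechet_derivative f (at u) v" "\<lambda>u. f' u v" k] assms(3)
    by blast
  moreover have "f differentiable (at u)" if "u \<in> S" for u
    using assms(2)[OF that] unfolding differentiable_def by blast
  ultimately show ?thesis by simp
qed

lemma Ck_on_Suc_has_derivative:
  "Ck_on (Suc k) S f \<Longrightarrow> u \<in> S \<Longrightarrow> (f has_derivative frechet_derivative f (at u)) (at u)"
  by (simp add: frechet_derivative_works[symmetric])

lemma Ck_on_const: "Ck_on k S (\<lambda>u. c)"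
  by (induction k arbitrary: c) auto

lemma Ck_on_compose_linear:
  assumes "bounded_linear h" "open S" "Ck_on k S f"
  shows "Ck_on k S (\<lambda>u. h (f u))"
  using assms(3)
proof (induction k arbitrary: f)
  case 0
  then show ?case
    using assms(1) by (simp add: bounded_linear.continuous_on)
next
  case (Suc k)
  show ?case
  proof (rule Ck_on_SucI[OF assms(2)])
    show "((\<lambda>u. h (f u)) has_derivative (\<lambda>v. h (frechet_derivative f (at u) v))) (at u)" if "u \<in> S"
        for u
      using bounded_linear.has_derivative[OF assms(1) Ck_on_Suc_has_derivative[OF Suc.prems that]] .
    show "Ck_on k S (\<lambda>u. h (frechet_derivative f (at u) v))" for v
      using Suc by simp
  qed
qed

lemma Ck_on_linear:
  assumes "bounded_linear h" "open S"
  shows "Ck_on k S h"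
proof (cases k)
  case 0
  then show ?thesis using assms by (simp add: linear_continuous_on)
next
  case (Suc k)
  have "Ck_on (Suc k) S h"
    by (rule Ck_on_SucI[OF assms(2) bounded_linear_imp_has_derivative[OF assms(1)] Ck_on_const])
  with Suc show ?thesis by simp
qed

lemma Ck_on_add:
  assumes "open S" "Ck_on k S f" "Ck_on k S g"
  shows "Ck_on k S (\<lambda>u. f u + g u)"
  using assms(2,3)
proof (induction k arbitrary: f g)
  case 0
  then show ?case by (simp add: continuous_on_add)
next
  case (Suc k)
  show ?case
  proof (rule Ck_on_SucI[OF assms(1)])
    show "((\<lambda>u. f u + g u) has_derivative
        (\<lambda>v. frechet_derivative f (at u) v + frechet_derivative g (at u) v)) (at u)" if "u \<in> S" for u
      by (intro has_derivative_add Ck_on_Suc_has_derivative[OF Suc.prems(1) that]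
          Ck_on_Suc_has_derivative[OF Suc.prems(2) that])
    show "Ck_on k S (\<lambda>u. frechet_derivative f (at u) v + frechet_derivative g (at u) v)" for v
      using Suc by simp
  qed
qed

lemma Ck_on_bilinear:
  assumes "bounded_bilinear b" "open S" "Ck_on k S f" "Ck_on k S g"
  shows "Ck_on k S (\<lambda>u. b (f u) (g u))"
  using assms(3,4)
proof (induction k arbitrary: f g)
  case 0
  then show ?case
    using bounded_bilinear.continuous_on[OF assms(1)] by simp
next
  case (Suc k)
  show ?case
  proof (rule Ck_on_SucI[OF assms(2)])
    show "((\<lambda>u. b (f u) (g u)) has_derivative
        (\<lambda>v. b (f u) (frechet_derivative g (at u) v)
            + b (frechet_derivative f (at u) v) (g u))) (at u)"
      if "u \<in> S" for u
      by (intro bounded_bilinear.FDERIV[OF assms(1)] Ck_on_Suc_has_derivative[OF Suc.prems(1) that]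
          Ck_on_Suc_has_derivative[OF Suc.prems(2) that])
    show "Ck_on k S (\<lambda>u. b (f u) (frechet_derivative g (at u) v)
        + b (frechet_derivative f (at u) v) (g u))" for v
      using Suc.prems Ck_on_SucD[OF Suc.prems(1)] Ck_on_SucD[OF Suc.prems(2)]
      by (intro Ck_on_add[OF assms(2)] Suc.IH) simp_all
  qed
qed

lemma Ck_on_sum:
  assumes "open S" "\<And>i. i \<in> I \<Longrightarrow> Ck_on k S (f i)"
  shows "Ck_on k S (\<lambda>u. \<Sum>i\<in>I. f i u)"
  using assms(2) by (induction I rule: infinite_finite_induct) (auto intro: Ck_on_const Ck_on_add[OF
      assms(1)])

text \<open>The definition of \<^const>\<open>Ck_on\<close> only speaks of derivatives in a fixed direction. In the chain rule
  the derivative of \<open>f\<close> is taken in the moving direction \<open>g'(u) v\<close>, which is therefore expanded in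
  the basis before the induction hypothesis is used.\<close>

lemma Ck_on_compose:
  fixes g :: "'b::real_normed_vector \<Rightarrow> 'c::euclidean_space" and f :: "'c \<Rightarrow> 'd::real_normed_vector"
  assumes "open S" "open T" "g ` S \<subseteq> T" "Ck_on k S g" "Ck_on k T f"
  shows "Ck_on k S (\<lambda>u. f (g u))"
  using assms(4,5)
proof (induction k arbitrary: f)
  case 0
  then show ?case using assms(3) by (auto intro: continuous_on_compose2)
next
  case (Suc k)
  show ?case
  proof (rule Ck_on_SucI[OF assms(1)])
    fix u assume u: "u \<in> S"
    let ?f' = "frechet_derivative f (at (g u))" and ?g' = "frechet_derivative g (at u)"
    have f': "(f has_derivative ?f') (at (g u))"
      using Ck_on_Suc_has_derivative[OF Suc.prems(2)] assms(3) u by blast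
    have g': "(g has_derivative ?g') (at u)"
      using Ck_on_Suc_has_derivative[OF Suc.prems(1)] u by blast
    have lin: "linear ?f'" using f' by (simp add: has_derivative_linear)
    have expand: "?f' w = (\<Sum>b\<in>Basis. (w \<bullet> b) *\<^sub>R ?f' b)" for w
    proof -
      have "?f' w = ?f' (\<Sum>b\<in>Basis. (w \<bullet> b) *\<^sub>R b)"
        by (simp add: euclidean_representation)
      also have "\<dots> = (\<Sum>b\<in>Basis. (w \<bullet> b) *\<^sub>R ?f' b)"
        by (simp add: linear_sum[OF lin] linear_cmul[OF lin])
      finally show ?thesis .
    qed
    have "(\<lambda>v. ?f' (?g' v)) = (\<lambda>v. \<Sum>b\<in>Basis. (?g' v \<bullet> b) *\<^sub>R ?f' b)"
      by (rule ext) (rule expand)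
    moreover have "((\<lambda>u. f (g u)) has_derivative (\<lambda>v. ?f' (?g' v))) (at u)"
      using diff_chain_at[OF g' f'] by (simp add: o_def)
    ultimately show "((\<lambda>u. f (g u)) has_derivative
        (\<lambda>v. \<Sum>b\<in>Basis. (frechet_derivative g (at u) v \<bullet> b) *\<^sub>R frechet_derivative f (at (g u)) b))
            (at u)"
      by (simp only:)
  next
    fix v
    have "Ck_on k S (\<lambda>u. frechet_derivative f (at (g u)) b)" for b
      using Suc.IH[OF Ck_on_SucD[OF Suc.prems(1)], of "\<lambda>y. frechet_derivative f (at y) b"] Suc.prems
        by simp
    moreover have "Ck_on k S (\<lambda>u. frechet_derivative g (at u) v \<bullet> b)" for b
      by (rule Ck_on_compose_linear[OF bounded_linear_inner_left \<open>open S\<close>]) (use Suc.prems in simp)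
    ultimately show "Ck_on k S (\<lambda>u. \<Sum>b\<in>Basis.
        (frechet_derivative g (at u) v \<bullet> b) *\<^sub>R frechet_derivative f (at (g u)) b)"
      by (intro Ck_on_sum Ck_on_bilinear[OF bounded_bilinear_scaleR] assms(1))
  qed
qed

lemma smooth_on_cong: "open S \<Longrightarrow> (\<And>u. u \<in> S \<Longrightarrow> f u = g u) \<Longrightarrow> smooth_on S f \<longleftrightarrow> smooth_on S g"
  unfolding smooth_on_def by (simp add: Ck_on_cong[of S f g])

lemma smooth_on_subset: "smooth_on S f \<Longrightarrow> T \<subseteq> S \<Longrightarrow> smooth_on T f"
  unfolding smooth_on_def by (blast intro: Ck_on_subset)

lemma smooth_on_local:
  assumes "\<And>u. u \<in> S \<Longrightarrow> \<exists>T. open T \<and> u \<in> T \<and> smooth_on T f"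
  shows "smooth_on S f"
  unfolding smooth_on_def
proof
  fix k show "Ck_on k S f"
    by (rule Ck_on_local) (use assms in \<open>unfold smooth_on_def, blast\<close>)
qed

lemma smooth_on_has_derivative:
  "smooth_on S f \<Longrightarrow> u \<in> S \<Longrightarrow> (f has_derivative frechet_derivative f (at u)) (at u)"
  unfolding smooth_on_def by (blast intro: Ck_on_Suc_has_derivative)

lemma smooth_on_differentiable: "smooth_on S f \<Longrightarrow> u \<in> S \<Longrightarrow> f differentiable (at u)"
  using smooth_on_has_derivative unfolding differentiable_def by blast

lemma smooth_on_continuous: "smooth_on S f \<Longrightarrow> continuous_on S f"
  unfolding smooth_on_def using Ck_on.simps(1) by blast

lemma smooth_on_frechet: "smooth_on S f \<Longrightarrow> smooth_on S (\<lambda>u. frechet_derivative f (at u) v)"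
  unfolding smooth_on_def by (metis Ck_on.simps(2))

lemma smooth_on_partial: "smooth_on S f \<Longrightarrow> smooth_on S (partial i f)"
  using smooth_on_frechet[of S f "axis i 1"] unfolding partial_def[abs_def] .

lemma smooth_on_const: "smooth_on S (\<lambda>u. c)"
  unfolding smooth_on_def by (simp add: Ck_on_const)

lemma smooth_on_linear: "bounded_linear h \<Longrightarrow> open S \<Longrightarrow> smooth_on S h"
  unfolding smooth_on_def by (simp add: Ck_on_linear)

lemma smooth_on_ident: "open S \<Longrightarrow> smooth_on S (\<lambda>u. u)"
  by (rule smooth_on_linear[OF bounded_linear_ident])

lemma smooth_on_compose_linear:
  "bounded_linear h \<Longrightarrow> open S \<Longrightarrow> smooth_on S f \<Longrightarrow> smooth_on S (\<lambda>u. h (f u))"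
  unfolding smooth_on_def by (simp add: Ck_on_compose_linear)

lemma smooth_on_bilinear:
  "bounded_bilinear b \<Longrightarrow> open S \<Longrightarrow> smooth_on S f \<Longrightarrow> smooth_on S g \<Longrightarrow> smooth_on S (\<lambda>u. b (f u) (g u))"
  unfolding smooth_on_def by (simp add: Ck_on_bilinear)

lemma smooth_on_add:
  "open S \<Longrightarrow> smooth_on S f \<Longrightarrow> smooth_on S g \<Longrightarrow> smooth_on S (\<lambda>u. f u + g u)"
  unfolding smooth_on_def by (simp add: Ck_on_add)

lemma smooth_on_minus: "open S \<Longrightarrow> smooth_on S f \<Longrightarrow> smooth_on S (\<lambda>u. - f u)"
  by (rule smooth_on_compose_linear[OF bounded_linear_minus[OF bounded_linear_ident]])

lemma smooth_on_diff:
  "open S \<Longrightarrow> smooth_on S f \<Longrightarrow> smooth_on S g \<Longrightarrow> smooth_on S (\<lambda>u. f u - g u)"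
  using smooth_on_add[OF _ _ smooth_on_minus, of S f g] by simp

lemma smooth_on_sum:
  "open S \<Longrightarrow> (\<And>i. i \<in> I \<Longrightarrow> smooth_on S (f i)) \<Longrightarrow> smooth_on S (\<lambda>u. \<Sum>i\<in>I. f i u)"
  unfolding smooth_on_def by (simp add: Ck_on_sum)

lemma smooth_on_compose:
  fixes g :: "'b::real_normed_vector \<Rightarrow> 'c::euclidean_space" and f :: "'c \<Rightarrow> 'd::real_normed_vector"
  shows "open S \<Longrightarrow> open T \<Longrightarrow> g ` S \<subseteq> T \<Longrightarrow> smooth_on S g \<Longrightarrow> smooth_on T f \<Longrightarrow> smooth_on S (\<lambda>u. f (g u))"
  unfolding smooth_on_def by (simp add: Ck_on_compose)

lemmas smooth_on_inner = smooth_on_bilinear[OF bounded_bilinear_inner]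
lemmas smooth_on_scaleR = smooth_on_bilinear[OF bounded_bilinear_scaleR]
lemmas smooth_on_mult = smooth_on_bilinear[OF bounded_bilinear_mult]
lemmas smooth_on_nth = smooth_on_compose_linear[OF bounded_linear_vec_nth]
lemmas smooth_on_of_real = smooth_on_compose_linear[OF bounded_linear_of_real]
lemmas smooth_on_Re = smooth_on_compose_linear[OF bounded_linear_Re]
lemmas smooth_on_Im = smooth_on_compose_linear[OF bounded_linear_Im]

lemma bounded_bilinear_cross3: "bounded_bilinear cross3"
  using bilinear_cross bilinear_conv_bounded_bilinear by blast

lemmas smooth_on_cross3 = smooth_on_bilinear[OF bounded_bilinear_cross3]

lemma smooth_on_power: "open S \<Longrightarrow> smooth_on S f \<Longrightarrow>
    smooth_on S (\<lambda>u. (f u :: 'a::real_normed_algebra_1) ^ n)"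
  by (induction n) (auto intro: smooth_on_const smooth_on_mult)

lemma smooth_on_vec_lambda:
  fixes f :: "'b::real_normed_vector \<Rightarrow> real ^ 'n"
  assumes "open S" "\<And>i. smooth_on S (\<lambda>u. f u $ i)"
  shows "smooth_on S f"
proof -
  have "(\<lambda>u. \<Sum>i\<in>UNIV. (f u $ i) *\<^sub>R axis i 1) = f"
    by (simp add: fun_eq_iff vec_eq_iff axis_def if_distrib cong: if_cong)
  moreover have "smooth_on S (\<lambda>u. \<Sum>i\<in>UNIV. (f u $ i) *\<^sub>R (axis i 1 :: real^'n))"
    by (intro assms smooth_on_sum smooth_on_scaleR smooth_on_const)
  ultimately show ?thesis by (simp only:)
qed

text \<open>The derivative in the direction \<open>v\<close> is \<open>f'(z) v\<close>, and \<open>f'\<close> is again holomorphic.\<close>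

lemma holomorphic_imp_smooth_on:
  assumes "open S" "f holomorphic_on S"
  shows "smooth_on S f"
  unfolding smooth_on_def
proof
  fix k show "Ck_on k S f"
    using assms(2)
  proof (induction k arbitrary: f)
    case 0
    then show ?case by (simp add: holomorphic_on_imp_continuous_on)
  next
    case (Suc k)
    show ?case
    proof (rule Ck_on_SucI[OF assms(1)])
      show "(f has_derivative (\<lambda>v. deriv f u * v)) (at u)" if "u \<in> S" for u
        using holomorphic_derivI[OF Suc.prems assms(1) that] unfolding has_field_derivative_def .
      show "Ck_on k S (\<lambda>u. deriv f u * v)" for v
        by (intro Ck_on_bilinear[OF bounded_bilinear_mult] assms(1) Ck_on_const Suc.IH
            holomorphic_deriv Suc.prems)
    qed
  qed
qed

text \<open>The real elementary functions are restrictions of holomorphic ones, so a single induction on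
  the order of differentiability serves for all of them.\<close>

lemma smooth_on_real_part_holomorphic:
  fixes f :: "'b::real_normed_vector \<Rightarrow> real"
  assumes "open S" "open T" "h holomorphic_on T" "smooth_on S f" "\<And>u. u \<in> S \<Longrightarrow>
      complex_of_real (f u) \<in> T"
    and "\<And>u. u \<in> S \<Longrightarrow> g u = Re (h (of_real (f u)))"
  shows "smooth_on S g"
proof -
  have "smooth_on S (\<lambda>u. Re (h (of_real (f u))))"
    by (rule smooth_on_Re[OF assms(1)], rule smooth_on_compose[OF assms(1,2)])
       (use assms in \<open>auto intro: smooth_on_of_real holomorphic_imp_smooth_on\<close>)
  then show ?thesis
    using smooth_on_cong[OF assms(1), of g "\<lambda>u. Re (h (of_real (f u)))"] assms(6) by blast
qed

lemma smooth_on_exp_real: "open S \<Longrightarrow> smooth_on S f \<Longrightarrow> smooth_on S (\<lambda>u. exp (f u :: real))"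
  by (rule smooth_on_real_part_holomorphic[of S UNIV exp]) (auto simp: Re_exp intro:
      holomorphic_intros)

lemma smooth_on_sin: "open S \<Longrightarrow> smooth_on S f \<Longrightarrow> smooth_on S (\<lambda>u. sin (f u :: real))"
  by (rule smooth_on_real_part_holomorphic[of S UNIV sin]) (auto simp: Re_sin intro:
      holomorphic_intros)

lemma smooth_on_cos: "open S \<Longrightarrow> smooth_on S f \<Longrightarrow> smooth_on S (\<lambda>u. cos (f u :: real))"
  by (rule smooth_on_real_part_holomorphic[of S UNIV cos]) (auto simp: Re_cos intro:
      holomorphic_intros)

lemma smooth_on_ln:
  "open S \<Longrightarrow> smooth_on S f \<Longrightarrow> (\<And>u. u \<in> S \<Longrightarrow> f u > 0) \<Longrightarrow> smooth_on S (\<lambda>u. ln (f u :: real))"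
  by (rule smooth_on_real_part_holomorphic[of S "- \<real>\<^sub>\<le>\<^sub>0" Ln f])
     (force simp: Ln_of_real complex_nonpos_Reals_iff closed_nonpos_Reals_complex intro:
         holomorphic_intros)+

lemma smooth_on_inverse_real:
  "open S \<Longrightarrow> smooth_on S f \<Longrightarrow> (\<And>u. u \<in> S \<Longrightarrow> f u \<noteq> 0) \<Longrightarrow> smooth_on S (\<lambda>u. inverse (f u :: real))"
  by (rule smooth_on_real_part_holomorphic[of S "- {0}" inverse f])
     (auto intro: holomorphic_intros simp flip: of_real_inverse)

lemma smooth_on_divide_real:
  "open S \<Longrightarrow> smooth_on S f \<Longrightarrow> smooth_on S g \<Longrightarrow> (\<And>u. u \<in> S \<Longrightarrow> g u \<noteq> 0) \<Longrightarrow>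
      smooth_on S (\<lambda>u. f u / (g u :: real))"
  unfolding divide_inverse by (intro smooth_on_mult smooth_on_inverse_real)

lemma smooth_on_sqrt:
  "open S \<Longrightarrow> smooth_on S f \<Longrightarrow> (\<And>u. u \<in> S \<Longrightarrow> f u > 0) \<Longrightarrow> smooth_on S (\<lambda>u. sqrt (f u))"
  by (rule smooth_on_real_part_holomorphic[of S "- \<real>\<^sub>\<le>\<^sub>0" csqrt f])
     (force simp: complex_nonpos_Reals_iff closed_nonpos_Reals_complex less_imp_le intro:
         holomorphic_intros)+

lemma smooth_on_holomorphic_compose:
  assumes "open S" "open T" "h holomorphic_on T" "smooth_on S f" "\<And>u. u \<in> S \<Longrightarrow> f u \<in> T"
  shows "smooth_on S (\<lambda>u. h (f u))"
  by (rule smooth_on_compose[OF assms(1,2)]) (use assms in \<open>auto intro: holomorphic_imp_smooth_on\<close>)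

lemma smooth_on_divide_complex:
  assumes "open S" "smooth_on S f" "smooth_on S g" "\<And>u. u \<in> S \<Longrightarrow> g u \<noteq> 0"
  shows "smooth_on S (\<lambda>u. f u / (g u :: complex))"
  unfolding divide_inverse
  by (intro smooth_on_mult assms smooth_on_holomorphic_compose[OF assms(1), of "-{0}" inverse])
     (use assms in \<open>auto intro: holomorphic_intros\<close>)

lemmas smooth_intros = smooth_on_const smooth_on_add smooth_on_minus smooth_on_diff smooth_on_sum
  smooth_on_inner smooth_on_scaleR smooth_on_mult smooth_on_nth smooth_on_of_real smooth_on_Re
      smooth_on_Im
  smooth_on_cross3 smooth_on_power smooth_on_partial smooth_on_ident

section \<open>Partial derivatives\<close>

lemma partial_eqI: "(f has_derivative f') (at u) \<Longrightarrow> partial i f u = f' (axis i 1)"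
  unfolding partial_def using frechet_derivative_at by metis

lemma partial_cong_open:
  "open S \<Longrightarrow> u \<in> S \<Longrightarrow> (\<And>u. u \<in> S \<Longrightarrow> f u = g u) \<Longrightarrow> partial i f u = partial i g u"
  unfolding partial_def using frechet_derivative_cong_open(1)[of S u f g] by simp

lemma plane_vector_expand: "v = v$1 *\<^sub>R axis 1 1 + v$2 *\<^sub>R axis 2 1" for v :: "real^2"
  by (simp add: vec_eq_iff forall_2 axis_def)

lemma has_derivative_partial:
  fixes f :: "real^2 \<Rightarrow> 'b::real_normed_vector"
  assumes "f differentiable (at u)"
  shows "(f has_derivative (\<lambda>v. v$1 *\<^sub>R partial 1 f u + v$2 *\<^sub>R partial 2 f u)) (at u)"
proof -
  let ?D = "frechet_derivative f (at u)"
  have D: "(f has_derivative ?D) (at u)"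
    using assms by (simp add: frechet_derivative_works[symmetric])
  have "?D = (\<lambda>v. v$1 *\<^sub>R partial 1 f u + v$2 *\<^sub>R partial 2 f u)"
  proof
    fix v
    have "?D v = ?D (v$1 *\<^sub>R axis 1 1 + v$2 *\<^sub>R axis 2 1)"
      by (rule arg_cong, rule plane_vector_expand)
    then show "?D v = v$1 *\<^sub>R partial 1 f u + v$2 *\<^sub>R partial 2 f u"
      unfolding partial_def
      by (simp only: linear_add[OF has_derivative_linear[OF D]] linear_cmul[OF
          has_derivative_linear[OF D]])
  qed
  with D show ?thesis by (simp only:)
qed

lemma frechet_derivative_partial:
  fixes f :: "real^2 \<Rightarrow> 'b::real_normed_vector"
  assumes "f differentiable (at u)"
  shows "frechet_derivative f (at u) v = v$1 *\<^sub>R partial 1 f u + v$2 *\<^sub>R partial 2 f u"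
  using frechet_derivative_at[OF has_derivative_partial[OF assms]] by metis

lemma partial_const: "partial i (\<lambda>u. c) u = 0"
  by (rule partial_eqI[OF has_derivative_const, THEN trans]) simp

lemma partial_add:
  "f differentiable (at u) \<Longrightarrow> g differentiable (at u) \<Longrightarrow> partial i (\<lambda>u. f u + g u) u
      = partial i f u + partial i g u"
  by (subst partial_eqI[OF has_derivative_add]) (auto simp: partial_def frechet_derivative_works)

lemma partial_linear:
  "bounded_linear h \<Longrightarrow> f differentiable (at u) \<Longrightarrow> partial i (\<lambda>u. h (f u)) u = h (partial i f u)"
  by (subst partial_eqI[OF bounded_linear.has_derivative])
     (auto simp: partial_def frechet_derivative_works)

lemma partial_diff:
  "f differentiable (at u) \<Longrightarrow> g differentiable (at u) \<Longrightarrow> partial i (\<lambda>u. f u - g u) u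
      = partial i f u - partial i g u"
  by (subst partial_eqI[OF has_derivative_diff]) (auto simp: partial_def frechet_derivative_works)

lemma partial_bilinear:
  "bounded_bilinear b \<Longrightarrow> f differentiable (at u) \<Longrightarrow> g differentiable (at u) \<Longrightarrow>
   partial i (\<lambda>u. b (f u) (g u)) u = b (partial i f u) (g u) + b (f u) (partial i g u)"
  by (subst partial_eqI[OF bounded_bilinear.FDERIV]) (auto simp: partial_def frechet_derivative_works)

lemmas partial_inner = partial_bilinear[OF bounded_bilinear_inner]
lemmas partial_mult = partial_bilinear[OF bounded_bilinear_mult]
lemmas partial_cross3 = partial_bilinear[OF bounded_bilinear_cross3]
lemmas partial_nth = partial_linear[OF bounded_linear_vec_nth]

lemma partial_compose:
  fixes f :: "'c::real_normed_vector \<Rightarrow> 'd::real_normed_vector"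
  shows "(f has_derivative f') (at (g u)) \<Longrightarrow> g differentiable (at u) \<Longrightarrow>
   partial i (\<lambda>u. f (g u)) u = f' (partial i g u)"
  by (subst partial_eqI[OF diff_chain_at[unfolded o_def]])
     (auto simp: partial_def frechet_derivative_works)

lemma partial_compose_plane:
  fixes f :: "real^2 \<Rightarrow> 'd::real_normed_vector"
  shows "f differentiable (at (g u)) \<Longrightarrow> g differentiable (at u) \<Longrightarrow>
   partial i (\<lambda>u. f (g u)) u = (partial i g u $ 1) *\<^sub>R partial 1 f (g u)
       + (partial i g u $ 2) *\<^sub>R partial 2 f (g u)"
  by (rule partial_compose[OF has_derivative_partial])

lemma partial_field_compose:
  assumes "(h has_field_derivative h') (at (f u))" "f differentiable (at u)"
  shows "partial i (\<lambda>u. h (f u)) u = h' * partial i f u"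
  using partial_compose[OF assms(1)[unfolded has_field_derivative_def] assms(2)] .

subsection \<open>Symmetry of mixed partial derivatives\<close>

lemma DERIV_along_axis:
  fixes f :: "real^2 \<Rightarrow> real"
  assumes "f differentiable (at (w + s *\<^sub>R axis i 1))"
  shows "((\<lambda>s. f (w + s *\<^sub>R axis i 1)) has_real_derivative partial i f (w + s *\<^sub>R axis i 1)) (at s)"
proof -
  have f': "(f has_derivative frechet_derivative f (at (w + s *\<^sub>R axis i 1))) (at (w
      + s *\<^sub>R axis i 1))"
    using assms by (simp add: frechet_derivative_works[symmetric])
  have "((\<lambda>s. w + s *\<^sub>R axis i (1::real)) has_derivative (\<lambda>h. h *\<^sub>R axis i 1)) (at s)"
    by (auto intro!: derivative_eq_intros)
  from diff_chain_at[OF this f']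
  have "((\<lambda>s. f (w + s *\<^sub>R axis i 1)) has_derivative
      (\<lambda>h. frechet_derivative f (at (w + s *\<^sub>R axis i 1)) (h *\<^sub>R axis i 1))) (at s)"
    by (simp add: o_def)
  then show ?thesis
    unfolding has_field_derivative_def partial_def
    using linear_cmul[OF has_derivative_linear[OF f']]
      by (simp add: mult.commute[of _ "frechet_derivative _ _ _"])
qed

text \<open>The mean value theorem in direction \<open>i\<close>, then in direction \<open>j\<close>. The second difference on the
  left is symmetric in \<open>i\<close> and \<open>j\<close>, so the two mixed partial derivatives agree at nearby points, and
  by continuity at \<open>u\<close>.\<close>

lemma second_difference_mean_value:
  fixes f :: "real^2 \<Rightarrow> real"
  assumes f: "smooth_on (ball u d) f" and h: "0 < h" "2 * h < d"
  shows "\<exists>s t. 0 < s \<and> s < h \<and> 0 < t \<and> t < h \<and>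
    f (u + h *\<^sub>R axis i 1 + h *\<^sub>R axis j 1) - f (u + h *\<^sub>R axis i 1) - f (u + h *\<^sub>R axis j 1) + f u
     = h * (h * partial j (partial i f) (u + s *\<^sub>R axis i 1 + t *\<^sub>R axis j 1))"
proof -
  have inb: "u + s *\<^sub>R axis i 1 + t *\<^sub>R axis j 1 \<in> ball u d"
    if "0 \<le> s" "s \<le> h" "0 \<le> t" "t \<le> h" for s t
  proof -
    have "norm (s *\<^sub>R axis i 1 + t *\<^sub>R axis j (1::real) :: real^2) \<le> s + t"
      using that norm_triangle_ineq[of "s *\<^sub>R axis i 1 :: real^2" "t *\<^sub>R axis j 1"] by simp
    moreover have "dist u (u + s *\<^sub>R axis i 1 + t *\<^sub>R axis j 1)
        = norm (s *\<^sub>R axis i 1 + t *\<^sub>R axis j (1::real) :: real^2)"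
      by (metis add.assoc add_diff_cancel_left' dist_commute dist_norm)
    ultimately show ?thesis using that h by (simp add: dist_norm)
  qed
  define F where "F s = f (u + h *\<^sub>R axis j 1 + s *\<^sub>R axis i 1) - f (u + s *\<^sub>R axis i 1)" for s
  define F' where "F' s = partial i f (u + h *\<^sub>R axis j 1 + s *\<^sub>R axis i 1) - partial i f (u
      + s *\<^sub>R axis i 1)" for s
  have "(F has_real_derivative F' s) (at s)" if "0 \<le> s" "s \<le> h" for s
    unfolding F_def F'_def using inb[of s h] inb[of s 0] that h(1)
    by (intro DERIV_diff DERIV_along_axis smooth_on_differentiable[OF f]) (auto simp: add_ac)
  from MVT2[OF h(1) this] obtain s where s: "0 < s" "s < h" "F h - F 0 = h * F' s"
    by auto
  have "((\<lambda>t. partial i f (u + s *\<^sub>R axis i 1 + t *\<^sub>R axis j 1)) has_real_derivative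
        partial j (partial i f) (u + s *\<^sub>R axis i 1 + t *\<^sub>R axis j 1)) (at t)" if "0 \<le> t" "t \<le> h"
            for t
    using inb[of s t] that s
    by (intro DERIV_along_axis smooth_on_differentiable[OF smooth_on_partial[OF f]]) auto
  from MVT2[OF h(1) this] obtain t where t: "0 < t" "t < h"
    "F' s = h * partial j (partial i f) (u + s *\<^sub>R axis i 1 + t *\<^sub>R axis j 1)"
    unfolding F'_def by (auto simp: add_ac)
  show ?thesis
    using s t unfolding F_def by (intro exI[of _ s] exI[of _ t]) (auto simp: add_ac)
qed

lemma partial_commute_real:
  fixes f :: "real^2 \<Rightarrow> real"
  assumes "open D" "u \<in> D" "smooth_on D f"
  shows "partial i (partial j f) u = partial j (partial i f) u"
proof (rule ccontr)
  assume ne: "\<not> ?thesis"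
  define e where "e = \<bar>partial i (partial j f) u - partial j (partial i f) u\<bar> / 2"
  have e: "e > 0" using ne by (simp add: e_def)
  have cont: "isCont (partial k (partial l f)) u" for k l
    using smooth_on_continuous[OF smooth_on_partial[OF smooth_on_partial[OF assms(3)]]] assms(1,2)
    by (simp add: continuous_on_eq_continuous_at)
  obtain d0 where d0: "d0 > 0" "ball u d0 \<subseteq> D" using assms by (meson openE)
  obtain d1 where d1: "d1 > 0" "\<And>w. dist w u < d1 \<Longrightarrow>
      dist (partial i (partial j f) w) (partial i (partial j f) u) < e"
    using cont e unfolding continuous_at_eps_delta by meson
  obtain d2 where d2: "d2 > 0" "\<And>w. dist w u < d2 \<Longrightarrow>
      dist (partial j (partial i f) w) (partial j (partial i f) u) < e"
    using cont e unfolding continuous_at_eps_delta by meson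
  define d where "d = min d0 (min d1 d2)"
  define h where "h = d / 3"
  have h: "0 < h" "2 * h < d" using d0 d1 d2 by (auto simp: h_def d_def)
  have sm: "smooth_on (ball u d) f"
    using assms(3) d0 by (rule_tac smooth_on_subset) (auto simp: d_def)
  have near: "dist (u + s *\<^sub>R axis k 1 + t *\<^sub>R axis l 1) u < d"
    if "0 < s" "s < h" "0 < t" "t < h" for s t k l
  proof -
    have "norm (s *\<^sub>R axis k 1 + t *\<^sub>R axis l (1::real) :: real^2) \<le> s + t"
      using that norm_triangle_ineq[of "s *\<^sub>R axis k 1 :: real^2" "t *\<^sub>R axis l 1"] by simp
    then show ?thesis using that h by (simp add: dist_norm)
  qed
  obtain s t where st: "0 < s" "s < h" "0 < t" "t < h"
    "f (u + h *\<^sub>R axis i 1 + h *\<^sub>R axis j 1) - f (u + h *\<^sub>R axis i 1) - f (u + h *\<^sub>R axis j 1) + f u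
     = h * (h * partial j (partial i f) (u + s *\<^sub>R axis i 1 + t *\<^sub>R axis j 1))"
    using second_difference_mean_value[OF sm h] by blast
  obtain s' t' where st': "0 < s'" "s' < h" "0 < t'" "t' < h"
    "f (u + h *\<^sub>R axis j 1 + h *\<^sub>R axis i 1) - f (u + h *\<^sub>R axis j 1) - f (u + h *\<^sub>R axis i 1) + f u
     = h * (h * partial i (partial j f) (u + s' *\<^sub>R axis j 1 + t' *\<^sub>R axis i 1))"
    using second_difference_mean_value[OF sm h] by blast
  have "h * (h * partial j (partial i f) (u + s *\<^sub>R axis i 1 + t *\<^sub>R axis j 1)) =
        h * (h * partial i (partial j f) (u + s' *\<^sub>R axis j 1 + t' *\<^sub>R axis i 1))"
    unfolding st(5)[symmetric] st'(5)[symmetric]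
      by (simp add: add.assoc add.commute[of "h *\<^sub>R axis i 1"])
  then have "partial j (partial i f) (u + s *\<^sub>R axis i 1 + t *\<^sub>R axis j 1) =
        partial i (partial j f) (u + s' *\<^sub>R axis j 1 + t' *\<^sub>R axis i 1)"
    using h by simp
  moreover have "dist (partial j (partial i f) (u + s *\<^sub>R axis i 1
      + t *\<^sub>R axis j 1)) (partial j (partial i f) u) < e"
    using near[OF st(1-4)] by (intro d2(2)) (auto simp: d_def)
  moreover have "dist (partial i (partial j f) (u + s' *\<^sub>R axis j 1
      + t' *\<^sub>R axis i 1)) (partial i (partial j f) u) < e"
    using near[OF st'(1-4)] by (intro d1(2)) (auto simp: d_def)
  ultimately show False
    unfolding e_def dist_real_def by (simp add: field_simps abs_if split: if_splits)
qed

lemma partial_commute: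
  fixes f :: "real^2 \<Rightarrow> 'b::euclidean_space"
  assumes "open D" "u \<in> D" "smooth_on D f"
  shows "partial i (partial j f) u = partial j (partial i f) u"
proof (rule euclidean_eqI)
  fix b :: 'b assume "b \<in> Basis"
  have bl: "bounded_linear (\<lambda>x::'b. x \<bullet> b)" by (rule bounded_linear_inner_left)
  have *: "partial k (partial l (\<lambda>u. f u \<bullet> b)) u = partial k (partial l f) u \<bullet> b" for k l
  proof -
    have "partial k (partial l (\<lambda>u. f u \<bullet> b)) u = partial k (\<lambda>u. partial l f u \<bullet> b) u"
      by (rule partial_cong_open[OF assms(1,2)])
         (simp add: partial_linear[OF bl] smooth_on_differentiable[OF assms(3)])
    also have "\<dots> = partial k (partial l f) u \<bullet> b"
      by (rule partial_linear[OF bl smooth_on_differentiable[OF smooth_on_partial[OF assms(3)]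
          assms(2)]])
    finally show ?thesis .
  qed
  show "partial i (partial j f) u \<bullet> b = partial j (partial i f) u \<bullet> b"
    using partial_commute_real[OF assms(1,2) smooth_on_compose_linear[OF bl assms(1,3)], of i j]
    unfolding * .
qed

subsection \<open>The inverse function theorem for smooth maps of the plane\<close>

text \<open>Cramer's rule: the inverse matrix depends smoothly on the entries.\<close>

lemma plane_linear_inverse:
  fixes L :: "real^2 \<Rightarrow> real^2"
  assumes "linear L" "inj L"
  defines "d \<equiv> L (axis 1 1) $ 1 * L (axis 2 1) $ 2 - L (axis 2 1) $ 1 * L (axis 1 1) $ 2"
  shows "d \<noteq> 0"
    and "inv L v = vector [(L (axis 2 1) $ 2 * v$1 - L (axis 2 1) $ 1 * v$2) / d,
                           (L (axis 1 1) $ 1 * v$2 - L (axis 1 1) $ 2 * v$1) / d]"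
proof -
  have L: "L w = w$1 *\<^sub>R L (axis 1 1) + w$2 *\<^sub>R L (axis 2 1)" for w
  proof -
    have "L w = L (w$1 *\<^sub>R axis 1 1 + w$2 *\<^sub>R axis 2 1)"
      by (rule arg_cong, rule plane_vector_expand)
    then show ?thesis by (simp only: linear_add[OF assms(1)] linear_cmul[OF assms(1)])
  qed
  show d: "d \<noteq> 0"
  proof
    assume "d = 0"
    then have "L (vector [L (axis 2 1) $ 2, - L (axis 1 1) $ 2]) = 0"
      "L (vector [- L (axis 2 1) $ 1, L (axis 1 1) $ 1]) = 0"
      unfolding L[of "vector _"] by (simp_all add: vec_eq_iff forall_2 vector_2 d_def algebra_simps)
    then have "vector [L (axis 2 1) $ 2, - L (axis 1 1) $ 2] = (0::real^2)"
      "vector [- L (axis 2 1) $ 1, L (axis 1 1) $ 1] = (0::real^2)"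
      using linear_injective_0[OF assms(1)] assms(2) by blast+
    then have "L (axis 1 1) = 0"
      by (simp add: vec_eq_iff forall_2 vector_2)
    then have "axis 1 1 = (0::real^2)"
      using linear_injective_0[OF assms(1)] assms(2) by blast
    then show False by (simp add: axis_eq_0_iff)
  qed
  let ?w = "vector [(L (axis 2 1) $ 2 * v$1 - L (axis 2 1) $ 1 * v$2) / d,
                    (L (axis 1 1) $ 1 * v$2 - L (axis 1 1) $ 2 * v$1) / d] :: real^2"
  have cramer: "p / d * a + q / d * b = x" if "p * a + q * b = x * d" for p q a b x
    using that d by (simp add: add_divide_distrib[symmetric])
  have "L ?w $ 1 = v $ 1" "L ?w $ 2 = v $ 2"
    unfolding L[of ?w] vector_2 vector_add_component vector_scaleR_component real_scaleR_def
    by (rule cramer, simp add: d_def algebra_simps)+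
  then have "L ?w = v" by (simp add: vec_eq_iff forall_2)
  then show "inv L v = ?w" using assms(2) by (metis inv_f_f)
qed

text \<open>The inverse is as smooth as \<open>f\<close>: its derivative is a rational expression in the first
  derivatives of \<open>f\<close>, evaluated along the inverse itself, so that each order of smoothness gives the
  next.\<close>

lemma plane_inverse_function:
  fixes f :: "real^2 \<Rightarrow> real^2"
  assumes "open U" "u0 \<in> U" "smooth_on U f" "inj (frechet_derivative f (at u0))"
  obtains U' V g where "open U'" "U' \<subseteq> U" "u0 \<in> U'" "open V" "homeomorphism U' V f g" "smooth_on V g"
proof -
  define f' where "f' u = Blinfun (frechet_derivative f (at u))" for u
  have fd: "(f has_derivative frechet_derivative f (at u)) (at u)" if "u \<in> U" for u
    using smooth_on_has_derivative[OF assms(3) that] .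
  have f'a: "blinfun_apply (f' u) = frechet_derivative f (at u)" if "u \<in> U" for u
    unfolding f'_def using has_derivative_bounded_linear[OF fd[OF that]]
      by (rule bounded_linear_Blinfun_apply)
  have cont: "continuous_on U f'"
  proof (rule continuous_on_blinfun_componentwise)
    fix i :: "real^2"
    have "continuous_on U (\<lambda>u. frechet_derivative f (at u) i)"
      by (rule smooth_on_continuous[OF smooth_on_frechet[OF assms(3)]])
    then show "continuous_on U (\<lambda>x. blinfun_apply (f' x) i)"
      by (simp add: f'a cong: continuous_on_cong)
  qed
  obtain h where h: "linear h" "h \<circ> frechet_derivative f (at u0) = id"
    using linear_injective_left_inverse[OF has_derivative_linear[OF fd[OF assms(2)]] assms(4)]
      by blast
  have inv: "Blinfun h o\<^sub>L f' u0 = id_blinfun"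
    using h by (intro blinfun_eqI)
      (simp add: f'a assms bounded_linear_Blinfun_apply linear_conv_bounded_linear[symmetric]
          pointfree_idE)
  obtain U' V g g' where g: "open U'" "U' \<subseteq> U" "u0 \<in> U'" "open V" "homeomorphism U' V f g"
    "\<And>y. y \<in> V \<Longrightarrow> (g has_derivative (g' y)) (at y)"
    "\<And>y. y \<in> V \<Longrightarrow> g' y = inv (blinfun_apply (f' (g y)))"
    "\<And>y. y \<in> V \<Longrightarrow> bij (blinfun_apply (f' (g y)))"
    by (rule inverse_function_theorem[OF assms(1) _ cont assms(2) inv, of f]) (use fd f'a in auto)
  have gV: "g y \<in> U" if "y \<in> V" for y
    using g(2,5) that unfolding homeomorphism_def by blast
  have "Ck_on k V g" for k
  proof (induction k)
    case 0
    then show ?case using g(5) by (simp add: homeomorphism_def)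
  next
    case (Suc k)
    let ?a = "\<lambda>i j y. frechet_derivative f (at (g y)) (axis i 1) $ j"
    let ?d = "\<lambda>y. ?a 1 1 y * ?a 2 2 y - ?a 2 1 y * ?a 1 2 y"
    have lin: "linear (frechet_derivative f (at (g y)))" "inj (frechet_derivative f (at (g y)))"
        if "y \<in> V" for y
      using has_derivative_linear[OF fd[OF gV[OF that]]] g(8)[OF that] f'a[OF gV[OF that]]
        by (auto simp: bij_def)
    have a: "Ck_on k V (\<lambda>y. ?a i j y)" for i j
    proof (rule Ck_on_compose[OF g(4) assms(1) _ Suc, of "\<lambda>u. frechet_derivative f (at u) (axis i 1)
        $ j"])
      show "g ` V \<subseteq> U" using gV by blast
      show "Ck_on k U (\<lambda>u. frechet_derivative f (at u) (axis i 1) $ j)"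
        using smooth_on_nth[OF assms(1) smooth_on_frechet[OF assms(3)]] unfolding smooth_on_def
          by blast
    qed
    have mult: "Ck_on k V (\<lambda>y. p y * q y)" if "Ck_on k V p" "Ck_on k V q" for p q :: "real^2 \<Rightarrow> real"
      using that by (rule Ck_on_bilinear[OF bounded_bilinear_mult g(4)])
    have diff: "Ck_on k V (\<lambda>y. p y - q y)" if "Ck_on k V p" "Ck_on k V q" for p q :: "real^2 \<Rightarrow> real"
      using Ck_on_add[OF g(4) that(1) Ck_on_compose_linear[OF bounded_linear_minus[OF
          bounded_linear_ident] g(4) that(2)]]
      by simp
    have dnz: "?d y \<noteq> 0" if "y \<in> V" for y
      using plane_linear_inverse(1)[OF lin[OF that]] .
    have "smooth_on (- {0}) (\<lambda>x::real. inverse x)"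
      by (rule smooth_on_inverse_real) (auto intro: smooth_on_ident)
    then have i: "Ck_on k (- {0}) (\<lambda>x::real. inverse x)"
      by (simp add: smooth_on_def)
    have d0: "Ck_on k V ?d"
      by (rule diff[OF mult[OF a a] mult[OF a a]])
    have d: "Ck_on k V (\<lambda>y. inverse (?d y))"
      by (rule Ck_on_compose[OF g(4) _ _ d0 i]) (use dnz in auto)
    have cv: "Ck_on k V (\<lambda>y. ?a i j y * c)" for i j c
      by (rule mult[OF a Ck_on_const])
    show ?case
    proof (rule Ck_on_SucI[OF g(4) g(6)])
      fix v
      have *: "g' y v = ((?a 2 2 y * v$1 - ?a 2 1 y * v$2) * inverse (?d y)) *\<^sub>R axis 1 1 +
             ((?a 1 1 y * v$2 - ?a 1 2 y * v$1) * inverse (?d y)) *\<^sub>R axis 2 1" if "y \<in> V" for y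
        unfolding g(7)[OF that] f'a[OF gV[OF that]] plane_linear_inverse(2)[OF lin[OF that]]
        by (simp add: vec_eq_iff forall_2 vector_2 axis_def divide_inverse)
      have "Ck_on k V (\<lambda>y. ((?a 2 2 y * v$1 - ?a 2 1 y * v$2) * inverse (?d y)) *\<^sub>R axis 1 1 +
             ((?a 1 1 y * v$2 - ?a 1 2 y * v$1) * inverse (?d y)) *\<^sub>R axis 2 1 :: real^2)"
        by (rule Ck_on_add[OF g(4) Ck_on_bilinear[OF bounded_bilinear_scaleR g(4) mult[OF diff[OF cv
            cv] d] Ck_on_const]
              Ck_on_bilinear[OF bounded_bilinear_scaleR g(4) mult[OF diff[OF cv cv] d] Ck_on_const]])
      then show "Ck_on k V (\<lambda>y. g' y v)"
        by (subst Ck_on_cong[OF g(4) *])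
    qed
  qed
  then have "smooth_on V g" by (simp add: smooth_on_def)
  with g that show thesis by blast
qed

unbundle cross3_syntax

section \<open>Local theory of surfaces in space\<close>

subsection \<open>Vector algebra\<close>

lemma cross_cross_left: "a \<times> (b \<times> c) = (a \<bullet> c) *\<^sub>R b - (a \<bullet> b) *\<^sub>R c" for a :: "real^3"
  by (simp add: cross3_simps forall_3)

lemma dot_cross_cross: "(a \<times> b) \<bullet> (c \<times> d) = (a \<bullet> c) * (b \<bullet> d) - (a \<bullet> d) * (b \<bullet> c)" for a :: "real^3"
  by (simp add: cross3_simps forall_3)

lemma cross_parallel_normal:
  assumes "norm n = 1" "n \<bullet> a = 0" "n \<bullet> b = 0"
  shows "a \<times> b = ((a \<times> b) \<bullet> n) *\<^sub>R n"
proof -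
  have "n \<times> (a \<times> b) = 0" using assms by (simp add: cross_cross_left)
  moreover have "n \<bullet> n = 1" using assms by (simp add: norm_eq_1)
  ultimately show ?thesis
    using cross_cross_left[of n n "a \<times> b"] by (simp add: inner_commute)
qed

lemma cross_eq_scaleR_iff:
  assumes n: "norm n = 1" "n \<bullet> a = 0" "n \<bullet> b = 0" and m: "n \<bullet> p = 0" "n \<bullet> q = 0" "p \<times> q \<noteq> 0"
  shows "a \<times> b = k *\<^sub>R (p \<times> q) \<longleftrightarrow> (a \<times> b) \<bullet> (p \<times> q) = k * ((p \<times> q) \<bullet> (p \<times> q))"
proof
  assume e: "(a \<times> b) \<bullet> (p \<times> q) = k * ((p \<times> q) \<bullet> (p \<times> q))"
  obtain s t where st: "a \<times> b = s *\<^sub>R n" "p \<times> q = t *\<^sub>R n"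
    using cross_parallel_normal[OF n] cross_parallel_normal[OF n(1) m(1,2)] by metis
  have "n \<bullet> n = 1" "t \<noteq> 0" using n m st by (auto simp: norm_eq_1)
  with e show "a \<times> b = k *\<^sub>R (p \<times> q)" unfolding st by simp
qed simp

text \<open>From \<open>m \<times> (w \<times> m) = |m|\<^sup>2 w\<close> for \<open>m = p \<times> q\<close> and \<open>w\<close> orthogonal to \<open>m\<close>, with both products
  expanded.\<close>

lemma tangent_vector_expand:
  assumes "norm n = 1" "n \<bullet> p = 0" "n \<bullet> q = 0" "p \<times> q \<noteq> 0" "n \<bullet> w = 0"
  obtains a b where "w = a *\<^sub>R p + b *\<^sub>R q"
proof -
  let ?m = "p \<times> q"
  obtain t where t: "?m = t *\<^sub>R n" using cross_parallel_normal[OF assms(1-3)] by metis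
  have "w \<bullet> ?m = 0" using assms(5) by (simp add: t inner_commute)
  then have "(?m \<bullet> ?m) *\<^sub>R w = ?m \<times> (w \<times> ?m)"
    using cross_cross_left[of ?m w ?m] by (simp add: inner_commute[of ?m w])
  also have "w \<times> ?m = (w \<bullet> q) *\<^sub>R p - (w \<bullet> p) *\<^sub>R q"
    by (rule cross_cross_left)
  also have "?m \<times> \<dots> = (w \<bullet> q) *\<^sub>R (?m \<times> p) - (w \<bullet> p) *\<^sub>R (?m \<times> q)"
    by (simp only: Cross3.right_diff_distrib cross_mult_right)
  also have "?m \<times> p = (p \<bullet> p) *\<^sub>R q - (p \<bullet> q) *\<^sub>R p"
    using cross_cross_left[of p p q] cross_skew[of ?m p] by simp
  also have "?m \<times> q = (q \<bullet> p) *\<^sub>R q - (q \<bullet> q) *\<^sub>R p"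
    using cross_cross_left[of q p q] cross_skew[of ?m q] by simp
  finally have "(?m \<bullet> ?m) *\<^sub>R w = ((w \<bullet> p) * (q \<bullet> q) - (w \<bullet> q) * (p \<bullet> q)) *\<^sub>R p
      + ((w \<bullet> q) * (p \<bullet> p) - (w \<bullet> p) * (q \<bullet> p)) *\<^sub>R q"
    by (simp add: algebra_simps)
  then obtain a b where ab: "(?m \<bullet> ?m) *\<^sub>R w = a *\<^sub>R p + b *\<^sub>R q" by blast
  have "w = inverse (?m \<bullet> ?m) *\<^sub>R ((?m \<bullet> ?m) *\<^sub>R w)"
    using assms(4) by simp
  then show thesis unfolding ab by (metis that scaleR_add_right scaleR_scaleR)
qed

lemma inj_plane_iff_cross:
  fixes L :: "real^2 \<Rightarrow> real^3"
  assumes "linear L"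
  shows "inj L \<longleftrightarrow> L (axis 1 1) \<times> L (axis 2 1) \<noteq> 0"
proof -
  let ?a = "L (axis 1 1)" and ?b = "L (axis 2 1)"
  have L: "L w = w$1 *\<^sub>R ?a + w$2 *\<^sub>R ?b" for w
  proof -
    have "L w = L (w$1 *\<^sub>R axis 1 1 + w$2 *\<^sub>R axis 2 1)"
      by (rule arg_cong, rule plane_vector_expand)
    then show ?thesis by (simp only: linear_add[OF assms] linear_cmul[OF assms])
  qed
  show ?thesis
  proof
    assume inj: "inj L"
    show "?a \<times> ?b \<noteq> 0"
    proof
      assume "?a \<times> ?b = 0"
      then have "?b \<times> (?a \<times> ?b) = 0" by simp
      then have "L (vector [?b \<bullet> ?b, - (?b \<bullet> ?a)]) = 0"
        unfolding L[of "vector _"] vector_2 cross_cross_left by simp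
      then have "vector [?b \<bullet> ?b, - (?b \<bullet> ?a)] = (0::real^2)"
        using linear_injective_0[OF assms] inj by blast
      then have "?b = 0"
        by (simp add: vec_eq_iff[of "vector _"] forall_2 vector_2)
      then have "axis 2 1 = (0::real^2)"
        using linear_injective_0[OF assms] inj by blast
      then show False by (simp add: axis_eq_0_iff)
    qed
  next
    assume ab: "?a \<times> ?b \<noteq> 0"
    show "inj L"
      unfolding linear_injective_0[OF assms]
    proof (intro allI impI)
      fix w assume "L w = 0"
      then have "L w \<times> ?b = 0" "?a \<times> L w = 0" by simp_all
      then have "w$1 *\<^sub>R (?a \<times> ?b) = 0" "w$2 *\<^sub>R (?a \<times> ?b) = 0"
        unfolding L[of w] by (simp_all add: cross_add_left cross_add_right cross_mult_left
            cross_mult_right)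
      then have "w$1 = 0" "w$2 = 0" using ab by (simp_all only: scaleR_eq_0_iff simp_thms)
      then show "w = 0" by (simp add: vec_eq_iff forall_2)
    qed
  qed
qed

lemma matrix_inv_2:
  fixes A :: "real^2^2"
  assumes "det A \<noteq> 0"
  shows "matrix_inv A $ 1 $ 1 = A$2$2 / det A" "matrix_inv A $ 1 $ 2 = - A$1$2 / det A"
    "matrix_inv A $ 2 $ 1 = - A$2$1 / det A" "matrix_inv A $ 2 $ 2 = A$1$1 / det A"
proof -
  let ?B = "(\<chi> i j. (if i = j then A$(if i = 1 then 2 else 1)$(if i
      = 1 then 2 else 1) else - A$i$j) / det A) :: real^2^2"
  have "A$1$1 * A$2$2 / det A - A$1$2 * A$2$1 / det A = 1"
    unfolding diff_divide_distrib[symmetric] det_2[symmetric] using assms by simp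
  then have B: "A ** ?B = mat 1" "?B ** A = mat 1"
    by (simp_all add: vec_eq_iff forall_2 matrix_matrix_mult_def sum_2 mat_def mult.commute)
  have "A ** matrix_inv A = mat 1"
    unfolding matrix_inv_def by (rule someI2[where a = "?B"]) (use B in auto)
  moreover have "matrix_inv A = (?B ** A) ** matrix_inv A"
    unfolding B(2) by simp
  ultimately have "matrix_inv A = ?B"
    unfolding matrix_mul_assoc[symmetric] by (simp only: matrix_mul_rid)
  then show "matrix_inv A $ 1 $ 1 = A$2$2 / det A" "matrix_inv A $ 1 $ 2 = - A$1$2 / det A"
    "matrix_inv A $ 2 $ 1 = - A$2$1 / det A" "matrix_inv A $ 2 $ 2 = A$1$1 / det A"
    by simp_all
qed

subsection \<open>Fundamental equations\<close>

locale surface_patch =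
  fixes D :: "(real^2) set" and Y n :: "real^2 \<Rightarrow> real^3"
  assumes open_D: "open D"
    and smooth_Y: "smooth_on D Y" and smooth_n: "smooth_on D n"
    and immersed: "\<And>u. u \<in> D \<Longrightarrow> inj (frechet_derivative Y (at u))"
    and unit: "\<And>u. u \<in> D \<Longrightarrow> norm (n u) = 1"
    and normal: "\<And>u i. u \<in> D \<Longrightarrow> n u \<bullet> partial i Y u = 0"
begin

abbreviation "g \<equiv> induced_metric Y"

lemma metric_component: "g u $ i $ j = partial i Y u \<bullet> partial j Y u"
  by (simp add: induced_metric_def)

lemma smooth_metric: "smooth_on D (\<lambda>u. g u $ i $ j)"
  unfolding metric_component by (intro smooth_intros open_D smooth_Y)

lemma normal_cross_nonzero: "u \<in> D \<Longrightarrow> partial 1 Y u \<times> partial 2 Y u \<noteq> 0"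
  using inj_plane_iff_cross[OF has_derivative_linear[OF smooth_on_has_derivative[OF smooth_Y]]]
      immersed
  unfolding partial_def by blast

lemma det_metric: "det (g u) = (partial 1 Y u \<times> partial 2 Y u) \<bullet> (partial 1 Y u \<times> partial 2 Y u)"
  by (simp add: det_2 metric_component dot_cross_cross inner_commute)

lemma det_metric_pos: "u \<in> D \<Longrightarrow> det (g u) > 0"
  unfolding det_metric using normal_cross_nonzero by simp

lemma smooth_det_metric: "smooth_on D (\<lambda>u. det (g u))"
  unfolding det_metric by (intro smooth_intros open_D smooth_Y)

lemma partial_differentiable: "u \<in> D \<Longrightarrow> partial i Y differentiable (at u)"
  by (rule smooth_on_differentiable[OF smooth_on_partial[OF smooth_Y]])

lemma second_differentiable: "u \<in> D \<Longrightarrow> partial i (partial j Y) differentiable (at u)"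
  by (rule smooth_on_differentiable[OF smooth_on_partial[OF smooth_on_partial[OF smooth_Y]]])

lemma normal_differentiable: "u \<in> D \<Longrightarrow> n differentiable (at u)"
  by (rule smooth_on_differentiable[OF smooth_n])

lemma second_commute: "u \<in> D \<Longrightarrow> partial i (partial j Y) u = partial j (partial i Y) u"
  by (rule partial_commute[OF open_D _ smooth_Y])

lemma partial_metric:
  assumes "u \<in> D"
  shows "partial k (\<lambda>v. g v $ i $ j) u
    = partial k (partial i Y) u \<bullet> partial j Y u + partial i Y u \<bullet> partial k (partial j Y) u"
  unfolding metric_component by (rule partial_inner; rule partial_differentiable[OF assms])

text \<open>By symmetry of the second derivatives, the combination of derivatives of the metric leaves a
  single inner product.\<close>

lemma christoffel_first_kind:
  assumes "u \<in> D"
  shows "partial i (\<lambda>v. g v $ j $ l) u + partial j (\<lambda>v. g v $ i $ l) u - partial l (\<lambda>v. g v $ i $ j) u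
    = 2 * (partial i (partial j Y) u \<bullet> partial l Y u)"
  unfolding partial_metric[OF assms]
  using second_commute[OF assms, of j i] second_commute[OF assms, of l i] second_commute[OF assms,
      of l j]
  by (simp add: inner_commute)

lemma christoffel_eq:
  assumes "u \<in> D"
  shows "christoffel g k i j u = (\<Sum>l\<in>UNIV. matrix_inv (g u) $ k $ l * (partial i (partial j Y) u \<bullet>
      partial l Y u))"
  unfolding christoffel_def christoffel_first_kind[OF assms] by (simp add: sum_2)

lemma christoffel_components:
  assumes "u \<in> D"
  shows "christoffel g 1 i j u = (g u $ 2 $ 2 * (partial i (partial j Y) u \<bullet> partial 1 Y u)
            - g u $ 1 $ 2 * (partial i (partial j Y) u \<bullet> partial 2 Y u)) / det (g u)"
    and "christoffel g 2 i j u = (g u $ 1 $ 1 * (partial i (partial j Y) u \<bullet> partial 2 Y u)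
            - g u $ 2 $ 1 * (partial i (partial j Y) u \<bullet> partial 1 Y u)) / det (g u)"
  using det_metric_pos[OF assms]
  by (simp_all add: christoffel_eq[OF assms] sum_2 matrix_inv_2 field_simps)

lemma smooth_christoffel: "smooth_on D (christoffel g k i j)"
proof -
  have "smooth_on D (christoffel g 1 i j)"
  proof (rule iffD2[OF smooth_on_cong[OF open_D christoffel_components(1)]])
    show "smooth_on D (\<lambda>u. (g u $ 2 $ 2 * (partial i (partial j Y) u \<bullet> partial 1 Y u)
        - g u $ 1 $ 2 * (partial i (partial j Y) u \<bullet> partial 2 Y u)) / det (g u))"
      using det_metric_pos
      by (intro smooth_on_divide_real smooth_on_diff smooth_on_mult smooth_on_inner smooth_on_partial
          smooth_metric smooth_det_metric open_D smooth_Y) fastforce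
  qed
  moreover have "smooth_on D (christoffel g 2 i j)"
  proof (rule iffD2[OF smooth_on_cong[OF open_D christoffel_components(2)]])
    show "smooth_on D (\<lambda>u. (g u $ 1 $ 1 * (partial i (partial j Y) u \<bullet> partial 2 Y u)
        - g u $ 2 $ 1 * (partial i (partial j Y) u \<bullet> partial 1 Y u)) / det (g u))"
      using det_metric_pos
      by (intro smooth_on_divide_real smooth_on_diff smooth_on_mult smooth_on_inner smooth_on_partial
          smooth_metric smooth_det_metric open_D smooth_Y) fastforce
  qed
  ultimately show ?thesis by (metis exhaust_2)
qed

text \<open>A tangent vector is determined by its inner products with the coordinate vectors, and for the
  tangential part of a second derivative these are the Christoffel symbols of the first kind.\<close>

lemma gauss_formula:
  assumes "u \<in> D"
  shows "partial i (partial j Y) u = christoffel g 1 i j u *\<^sub>R partial 1 Y u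
    + christoffel g 2 i j u *\<^sub>R partial 2 Y u + (partial i (partial j Y) u \<bullet> n u) *\<^sub>R n u"
proof -
  let ?w = "partial i (partial j Y) u" and ?p = "partial 1 Y u" and ?q = "partial 2 Y u"
  let ?d = "det (g u)"
  have nn: "n u \<bullet> n u = 1" using unit[OF assms] by (simp add: norm_eq_1)
  have "n u \<bullet> (?w - (?w \<bullet> n u) *\<^sub>R n u) = 0"
    by (simp add: inner_diff_right nn inner_commute)
  then obtain a b where ab: "?w - (?w \<bullet> n u) *\<^sub>R n u = a *\<^sub>R ?p + b *\<^sub>R ?q"
    using tangent_vector_expand[OF unit normal normal normal_cross_nonzero] assms by metis
  then have w: "?w = a *\<^sub>R ?p + b *\<^sub>R ?q + (?w \<bullet> n u) *\<^sub>R n u" by (simp add: algebra_simps)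
  have d: "?d = (?p \<bullet> ?p) * (?q \<bullet> ?q) - (?p \<bullet> ?q) * (?p \<bullet> ?q)"
    by (simp add: det_metric dot_cross_cross inner_commute)
  have dots: "?w \<bullet> ?p = a * (?p \<bullet> ?p) + b * (?p \<bullet> ?q)" "?w \<bullet> ?q = a * (?p \<bullet> ?q) + b * (?q \<bullet> ?q)"
    using arg_cong[OF w, of "\<lambda>x. x \<bullet> ?p"] arg_cong[OF w, of "\<lambda>x. x \<bullet> ?q"]
    by (simp_all add: inner_add_left normal[OF assms] inner_commute[of ?q ?p])
  have c: "christoffel g 1 i j u = a" "christoffel g 2 i j u = b"
    using det_metric_pos[OF assms]
    unfolding christoffel_components[OF assms] metric_component dots
    by (simp_all add: divide_eq_eq inner_commute[of ?q ?p]) (simp_all add: d algebra_simps)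
  show ?thesis unfolding c by (rule w)
qed

lemma christoffel_lower:
  assumes "u \<in> D"
  shows "christoffel g 1 i j u * g u $ 1 $ m + christoffel g 2 i j u * g u $ 2 $ m
    = partial i (partial j Y) u \<bullet> partial m Y u"
  using arg_cong[OF gauss_formula[OF assms, of i j], of "\<lambda>w. w \<bullet> partial m Y u"]
  by (simp del: vec_eq_iff add: inner_add_left normal[OF assms] metric_component)

text \<open>Differentiating the previous equation gives the derivatives of the Christoffel symbols without
  differentiating the inverse of the metric.\<close>

lemma partial_christoffel_lower:
  assumes "u \<in> D"
  shows "partial k (christoffel g 1 i j) u * g u $ 1 $ m
      + partial k (christoffel g 2 i j) u * g u $ 2 $ m
    = partial k (partial i (partial j Y)) u \<bullet> partial m Y u
        + partial i (partial j Y) u \<bullet> partial k (partial m Y) u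
      - christoffel g 1 i j u * (partial k (partial 1 Y) u \<bullet> partial m Y u
          + partial 1 Y u \<bullet> partial k (partial m Y) u)
      - christoffel g 2 i j u * (partial k (partial 2 Y) u \<bullet> partial m Y u
          + partial 2 Y u \<bullet> partial k (partial m Y) u)"
proof -
  have c: "christoffel g l i j differentiable (at u)" for l
    by (rule smooth_on_differentiable[OF smooth_christoffel assms])
  have gd: "(\<lambda>v. g v $ l $ m) differentiable (at u)" for l
    by (rule smooth_on_differentiable[OF smooth_metric assms])
  have cg: "(\<lambda>v. christoffel g l i j v * g v $ l $ m) differentiable (at u)" for l
    by (intro smooth_on_differentiable[OF _ assms] smooth_on_mult open_D smooth_christoffel
        smooth_metric)
  have "partial k (\<lambda>v. christoffel g 1 i j v * g v $ 1 $ m + christoffel g 2 i j v * g v $ 2 $ m) u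
      = partial k (\<lambda>v. partial i (partial j Y) v \<bullet> partial m Y v) u"
    by (rule partial_cong_open[OF open_D assms christoffel_lower])
  then show ?thesis
    by (simp add: partial_add[OF cg cg] partial_mult[OF c gd] partial_metric[OF assms]
        partial_inner[OF second_differentiable[OF assms] partial_differentiable[OF assms]])
qed

end

context surface_patch
begin

text \<open>The third derivatives of \<open>Y\<close> cancel because partial derivatives commute; the products of
  Christoffel symbols subtract the tangential parts of the second derivatives and leave the normal
  ones.\<close>

lemma theorema_egregium:
  assumes u: "u \<in> D"
  shows "metric_curvature g u * det (g u) =
    (partial 1 (partial 1 Y) u \<bullet> n u) * (partial 2 (partial 2 Y) u \<bullet> n u)
        - (partial 1 (partial 2 Y) u \<bullet> n u)\<^sup>2"
proof -
  let ?p = "partial 1 Y u" and ?q = "partial 2 Y u"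
  let ?Y = "\<lambda>i j. partial i (partial j Y) u" and ?G = "\<lambda>k i j. christoffel g k i j u"
  have third: "partial 1 (partial 2 (partial 2 Y)) u = partial 2 (partial 1 (partial 2 Y)) u"
    by (rule partial_commute[OF open_D u smooth_on_partial[OF smooth_Y]])
  have "metric_curvature g u * det (g u) = riemann g 1 1 2 2 u * g u $ 1 $ 1
      + riemann g 2 1 2 2 u * g u $ 2 $ 1"
    using det_metric_pos[OF u] by (simp add: metric_curvature_def sum_2)
  also have "\<dots> = (partial 1 (christoffel g 1 2 2) u * g u $ 1 $ 1
      + partial 1 (christoffel g 2 2 2) u * g u $ 2 $ 1)
      - (partial 2 (christoffel g 1 1 2) u * g u $ 1 $ 1
          + partial 2 (christoffel g 2 1 2) u * g u $ 2 $ 1)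
      + ?G 1 2 2 * (?G 1 1 1 * g u $ 1 $ 1 + ?G 2 1 1 * g u $ 2 $ 1)
      + ?G 2 2 2 * (?G 1 1 2 * g u $ 1 $ 1 + ?G 2 1 2 * g u $ 2 $ 1)
      - ?G 1 1 2 * (?G 1 2 1 * g u $ 1 $ 1 + ?G 2 2 1 * g u $ 2 $ 1)
      - ?G 2 1 2 * (?G 1 2 2 * g u $ 1 $ 1 + ?G 2 2 2 * g u $ 2 $ 1)"
    unfolding riemann_def sum_2 by (simp only: algebra_simps)
  also have "\<dots> = ?Y 2 2 \<bullet> ?Y 1 1 - ?Y 1 2 \<bullet> ?Y 2 1
      - (?G 1 2 2 * (?p \<bullet> ?Y 1 1) + ?G 2 2 2 * (?q \<bullet> ?Y 1 1))
      + (?G 1 1 2 * (?p \<bullet> ?Y 2 1) + ?G 2 1 2 * (?q \<bullet> ?Y 2 1))"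
    unfolding partial_christoffel_lower[OF u] christoffel_lower[OF u] third by algebra
  also have "\<dots> = (?Y 2 2 \<bullet> n u) * (n u \<bullet> ?Y 1 1) - (?Y 1 2 \<bullet> n u) * (n u \<bullet> ?Y 2 1)"
    using arg_cong[OF gauss_formula[OF u, of 2 2], of "\<lambda>w. w \<bullet> ?Y 1 1"]
      arg_cong[OF gauss_formula[OF u, of 1 2], of "\<lambda>w. w \<bullet> ?Y 2 1"]
    by (simp add: inner_add_left)
  finally show ?thesis
    by (simp add: second_commute[OF u, of 2 1] power2_eq_square inner_commute mult.commute)
qed

text \<open>Differentiate \<open>n \<bullet> \<partial>\<^sub>j Y = 0\<close>.\<close>

lemma weingarten:
  assumes "u \<in> D"
  shows "partial i n u \<bullet> partial j Y u = - (partial i (partial j Y) u \<bullet> n u)"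
proof -
  have "partial i (\<lambda>v. n v \<bullet> partial j Y v) u = partial i (\<lambda>v. 0) u"
    by (rule partial_cong_open[OF open_D assms normal])
  then show ?thesis
    by (simp add: partial_inner[OF normal_differentiable[OF assms] partial_differentiable[OF assms]]
        partial_const inner_commute)
qed

lemma normal_derivative_tangent:
  assumes "u \<in> D"
  shows "n u \<bullet> partial i n u = 0"
proof -
  have "partial i (\<lambda>v. n v \<bullet> n v) u = partial i (\<lambda>v. 1) u"
    by (rule partial_cong_open[OF open_D assms]) (use unit in \<open>simp add: norm_eq_1\<close>)
  then show ?thesis
    by (simp add: partial_inner[OF normal_differentiable[OF assms] normal_differentiable[OF assms]]
        partial_const inner_commute)
qed

text \<open>The Gauss map multiplies oriented area by the curvature. Both sides scale by the Jacobian
  under a change of coordinates, which makes the curvature independent of the parametrization.\<close>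

lemma curvature_normal_cross:
  assumes "u \<in> D"
  shows "metric_curvature g u = k \<longleftrightarrow> partial 1 n u \<times> partial 2 n u
      = k *\<^sub>R (partial 1 Y u \<times> partial 2 Y u)"
proof -
  have "(partial 1 n u \<times> partial 2 n u) \<bullet> (partial 1 Y u \<times> partial 2 Y u)
      = metric_curvature g u * det (g u)"
    by (simp add: theorema_egregium[OF assms] dot_cross_cross weingarten[OF assms] second_commute[OF
        assms, of 2 1]
        power2_eq_square)
  then show ?thesis
    using cross_eq_scaleR_iff[OF unit normal_derivative_tangent normal_derivative_tangent normal
        normal
        normal_cross_nonzero, where k = k] assms det_metric_pos[OF assms]
    by (auto simp: det_metric[symmetric])
qed

text \<open>The vector on the right is a multiple of \<open>n\<close>, and its inner product with \<open>\<partial>\<^sub>1 Y \<times> \<partial>\<^sub>2 Y\<close> is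
  \<open>-2 H det g\<close>. It is also, up to sign, the exterior derivative of the vector-valued one-form
  \<open>n \<times> dY\<close>, which is therefore closed exactly on minimal surfaces.\<close>

lemma mean_curvature_zero_iff:
  assumes "u \<in> D"
  shows "mean_curvature Y n u = 0 \<longleftrightarrow> partial 1 n u \<times> partial 2 Y u + partial 1 Y u \<times> partial 2 n u = 0"
    (is "_ \<longleftrightarrow> ?c = 0")
proof -
  let ?p = "partial 1 Y u" and ?q = "partial 2 Y u"
  let ?L = "\<lambda>i j. partial i (partial j Y) u \<bullet> n u"
  have d: "det (g u) \<noteq> 0" using det_metric_pos[OF assms] by simp
  have "2 * mean_curvature Y n u * det (g u)
      = (?q \<bullet> ?q) * ?L 1 1 - 2 * (?p \<bullet> ?q) * ?L 1 2 + (?p \<bullet> ?p) * ?L 2 2"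
    using d by (simp add: mean_curvature_def sum_2 matrix_inv_2 second_commute[OF assms, of 2 1]
        metric_component inner_commute[of ?q ?p] distrib_right left_diff_distrib)
  moreover have "?c \<bullet> (?p \<times> ?q)
      = - ((?q \<bullet> ?q) * ?L 1 1 - 2 * (?p \<bullet> ?q) * ?L 1 2 + (?p \<bullet> ?p) * ?L 2 2)"
    unfolding inner_add_left dot_cross_cross weingarten[OF assms] second_commute[OF assms, of 2 1]
      inner_commute[of ?q ?p]
    by (simp add: algebra_simps)
  ultimately have cm: "?c \<bullet> (?p \<times> ?q) = - (2 * mean_curvature Y n u) * det (g u)"
    by simp
  have c: "?c = (?c \<bullet> n u) *\<^sub>R n u"
    unfolding inner_add_left scaleR_add_left
    by (intro arg_cong2[where f = "(+)"] cross_parallel_normal unit[OF assms] normal[OF assms]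
        normal_derivative_tangent[OF assms])
  obtain t where t: "?p \<times> ?q = t *\<^sub>R n u"
    using cross_parallel_normal[OF unit[OF assms] normal[OF assms] normal[OF assms]] by blast
  show ?thesis
  proof
    assume "mean_curvature Y n u = 0"
    with cm have "t * (?c \<bullet> n u) = 0" unfolding t by simp
    moreover have "t \<noteq> 0" using normal_cross_nonzero[OF assms] unfolding t by auto
    ultimately have "?c \<bullet> n u = 0" by simp
    then show "?c = 0" by (subst c) (simp only: scaleR_zero_left)
  next
    assume "?c = 0"
    then have "?c \<bullet> (?p \<times> ?q) = 0" by (simp only: inner_zero_left)
    with cm d show "mean_curvature Y n u = 0" by simp
  qed
qed

end

lemma partial_Complex:
  assumes "f differentiable (at u)" "h differentiable (at u)"
  shows "partial i (\<lambda>u. Complex (f u) (h u)) u = Complex (partial i f u) (partial i h u)"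
proof -
  have "((\<lambda>u. f u *\<^sub>R 1 + h u *\<^sub>R \<i>) has_derivative
      (\<lambda>v. frechet_derivative f (at u) v *\<^sub>R 1 + frechet_derivative h (at u) v *\<^sub>R \<i>)) (at u)"
    using assms unfolding frechet_derivative_works
    by (intro has_derivative_add bounded_linear.has_derivative[OF bounded_linear_scaleR_left])
  moreover have "(\<lambda>u. f u *\<^sub>R 1 + h u *\<^sub>R \<i>) = (\<lambda>u. Complex (f u) (h u))"
    by (simp add: fun_eq_iff complex_eq_iff)
  ultimately have "((\<lambda>u. Complex (f u) (h u)) has_derivative
      (\<lambda>v. frechet_derivative f (at u) v *\<^sub>R 1 + frechet_derivative h (at u) v *\<^sub>R \<i>)) (at u)"
    by simp
  from partial_eqI[OF this, of i] show ?thesis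
    by (simp add: partial_def complex_eq_iff)
qed

lemma smooth_on_Complex:
  assumes "open S" "smooth_on S f" "smooth_on S h"
  shows "smooth_on S (\<lambda>u. Complex (f u) (h u))"
proof -
  have "smooth_on S (\<lambda>u. f u *\<^sub>R 1 + h u *\<^sub>R \<i>)"
    by (intro smooth_intros assms)
  moreover have "(\<lambda>u. f u *\<^sub>R 1 + h u *\<^sub>R \<i>) = (\<lambda>u. Complex (f u) (h u))"
    by (simp add: fun_eq_iff complex_eq_iff)
  ultimately show ?thesis by simp
qed

text \<open>For a unit tangent vector \<open>w\<close>, the vectors \<open>w\<close> and \<open>n \<times> w\<close> are an orthonormal basis of the
  tangent plane, and the tangential part of \<open>V\<close> has square length \<open>1 - (n \<bullet> V)\<^sup>2\<close>.\<close>

lemma tangent_components_norm: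
  fixes n w V :: "real^3"
  assumes "norm n = 1" "norm V = 1" "n \<bullet> w = 0"
  shows "(w \<bullet> V)\<^sup>2 + ((n \<times> w) \<bullet> V)\<^sup>2 = (w \<bullet> w) * (1 - (n \<bullet> V)\<^sup>2)"
proof -
  have nn: "n \<bullet> n = 1" "V \<bullet> V = 1" using assms by (simp_all add: norm_eq_1)
  have "((n \<times> w) \<times> V) \<bullet> ((n \<times> w) \<times> V) = ((n \<times> w) \<bullet> (n \<times> w)) - ((n \<times> w) \<bullet> V)\<^sup>2"
    by (simp add: dot_cross_cross[of "n \<times> w"] nn power2_eq_square inner_commute)
  moreover have "(n \<times> w) \<bullet> (n \<times> w) = w \<bullet> w"
    by (simp add: dot_cross_cross nn assms inner_commute)
  moreover have "(n \<times> w) \<times> V = (V \<bullet> n) *\<^sub>R w - (V \<bullet> w) *\<^sub>R n"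
    using cross_cross_left[of V n w] cross_skew[of "n \<times> w" V] by simp
  ultimately show ?thesis
    by (simp add: inner_diff_left inner_diff_right nn assms(3) inner_commute power2_eq_square
        algebra_simps)
qed

text \<open>The vector identity behind the closedness of the Gauss form below, where \<open>a\<close> and \<open>b\<close> are the
  partial derivatives of the normal.\<close>

lemma gauss_form_closed_algebra:
  fixes n a b V :: "real^3"
  assumes "norm n = 1" "norm V = 1" "n \<bullet> a = 0" "n \<bullet> b = 0"
  shows "(1 - (n \<bullet> V)\<^sup>2) * ((a \<times> b) \<bullet> V)
    + (n \<bullet> V) * ((a \<bullet> V) * ((n \<times> b) \<bullet> V) - (b \<bullet> V) * ((n \<times> a) \<bullet> V)) = 0"
proof -
  have nn: "n \<bullet> n = 1" "V \<bullet> V = 1" using assms by (simp_all add: norm_eq_1)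
  obtain k where k: "a \<times> b = k *\<^sub>R n"
    using cross_parallel_normal[OF assms(1,3,4)] by blast
  have "(a \<bullet> V) * ((n \<times> b) \<bullet> V) - (b \<bullet> V) * ((n \<times> a) \<bullet> V)
      = (n \<times> ((V \<bullet> a) *\<^sub>R b - (V \<bullet> b) *\<^sub>R a)) \<bullet> V"
    by (simp add: Cross3.right_diff_distrib cross_mult_right inner_diff_left inner_diff_right
        inner_commute)
  also have "(V \<bullet> a) *\<^sub>R b - (V \<bullet> b) *\<^sub>R a = V \<times> (b \<times> a)"
    by (rule cross_cross_left[symmetric])
  also have "b \<times> a = - k *\<^sub>R n"
    using cross_skew[of b a] k by simp
  also have "V \<times> (- k *\<^sub>R n) = - k *\<^sub>R (V \<times> n)"
    by (rule cross_mult_right)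
  also have "n \<times> (- k *\<^sub>R (V \<times> n)) = - k *\<^sub>R (V - (n \<bullet> V) *\<^sub>R n)"
    by (simp add: cross_mult_right cross_cross_left nn)
  finally have X: "(a \<bullet> V) * ((n \<times> b) \<bullet> V) - (b \<bullet> V) * ((n \<times> a) \<bullet> V) = - k * (1 - (n \<bullet> V)\<^sup>2)"
    by (simp add: inner_diff_left nn power2_eq_square)
  show ?thesis unfolding X k by simp
qed

section \<open>Functions holomorphic for the induced conformal structure\<close>

context surface_patch
begin

text \<open>The area element, with the sign that compares the coordinate orientation with the one given by
  the normal.\<close>

definition signed_area :: "real^2 \<Rightarrow> real" where
  "signed_area u = (partial 1 Y u \<times> partial 2 Y u) \<bullet> n u"

lemma normal_cross: "u \<in> D \<Longrightarrow> partial 1 Y u \<times> partial 2 Y u = signed_area u *\<^sub>R n u"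
  unfolding signed_area_def by (rule cross_parallel_normal[OF unit normal normal])

lemma signed_area_square: "u \<in> D \<Longrightarrow> (signed_area u)\<^sup>2 = det (g u)"
  unfolding det_metric by (simp add: normal_cross power2_eq_square unit norm_eq_1[THEN iffD1])

lemma signed_area_nonzero: "u \<in> D \<Longrightarrow> signed_area u \<noteq> 0"
  using signed_area_square[of u] det_metric_pos[of u] by auto

lemma signed_area_gram:
  "u \<in> D \<Longrightarrow> (signed_area u)\<^sup>2 = g u $ 1 $ 1 * g u $ 2 $ 2 - (g u $ 1 $ 2)\<^sup>2"
  using signed_area_square[of u] by (simp add: det_2 metric_component inner_commute power2_eq_square)

lemma metric_11_pos: "u \<in> D \<Longrightarrow> g u $ 1 $ 1 > 0"
  using normal_cross_nonzero[of u] unfolding metric_component by auto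

lemma rotation_1:
  assumes "u \<in> D"
  shows "signed_area u *\<^sub>R (n u \<times> partial 1 Y u)
      = g u $ 1 $ 1 *\<^sub>R partial 2 Y u - g u $ 1 $ 2 *\<^sub>R partial 1 Y u"
proof -
  have "signed_area u *\<^sub>R (n u \<times> partial 1 Y u) = (partial 1 Y u \<times> partial 2 Y u) \<times> partial 1 Y u"
    by (simp add: normal_cross[OF assms] cross_mult_left)
  also have "\<dots> = - (partial 1 Y u \<times> (partial 1 Y u \<times> partial 2 Y u))"
    by (rule cross_skew)
  finally show ?thesis by (simp add: cross_cross_left metric_component)
qed

text \<open>Let \<open>J\<close> be the rotation by a right angle in the tangent planes, \<open>Y\<^sub>*(J v) = n \<times> Y\<^sub>* v\<close>. In
  coordinates \<open>s J \<partial>\<^sub>1 = E \<partial>\<^sub>2 - F \<partial>\<^sub>1\<close> with the signed area \<open>s\<close>, so the following says that the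
  complex one-form with components \<open>w\<^sub>1\<close>, \<open>w\<^sub>2\<close> is complex linear with respect to \<open>J\<close>.\<close>

definition complex_linear :: "real^2 \<Rightarrow> (2 \<Rightarrow> complex) \<Rightarrow> bool" where
  "complex_linear u w \<longleftrightarrow>
     of_real (g u $ 1 $ 1) * w 2 = (of_real (g u $ 1 $ 2) + \<i> * of_real (signed_area u)) * w 1"

text \<open>Multiply by \<open>E\<close> and use \<open>s\<^sup>2 = E G - F\<^sup>2\<close>.\<close>

lemma complex_linear_second:
  assumes "u \<in> D" "complex_linear u w"
  shows "(of_real (g u $ 1 $ 2) - \<i> * of_real (signed_area u)) * w 2 = of_real (g u $ 2 $ 2) * w 1"
proof -
  let ?E = "complex_of_real (g u $ 1 $ 1)" and ?F = "complex_of_real (g u $ 1 $ 2)"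
  and ?G = "complex_of_real (g u $ 2 $ 2)" and ?s = "complex_of_real (signed_area u)"
  have gram: "?s\<^sup>2 = ?E * ?G - ?F\<^sup>2"
    using signed_area_gram[OF assms(1)] by (metis of_real_diff of_real_mult of_real_power)
  have "?E * ((?F - \<i> * ?s) * w 2) = (?F - \<i> * ?s) * (?E * w 2)" by simp
  also have "\<dots> = (?F - \<i> * ?s) * ((?F + \<i> * ?s) * w 1)"
    using assms(2) by (simp add: complex_linear_def)
  also have "\<dots> = (?F\<^sup>2 + ?s\<^sup>2) * w 1" by (simp add: algebra_simps power2_eq_square)
  also have "\<dots> = ?E * (?G * w 1)" unfolding gram by simp
  finally show ?thesis using metric_11_pos[OF assms(1)] by simp
qed

lemma complex_linear_proportional:
  assumes "u \<in> D" "complex_linear u w" "complex_linear u w'"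
  shows "w 1 * w' 2 = w 2 * w' 1"
proof -
  let ?E = "complex_of_real (g u $ 1 $ 1)"
  have "?E * (w 1 * w' 2) = w 1 * (?E * w' 2)" by (rule mult.left_commute)
  also have "\<dots> = (?E * w 2) * w' 1"
    using assms(2,3) unfolding complex_linear_def by (simp only: mult.left_commute mult.assoc)
  also have "\<dots> = ?E * (w 2 * w' 1)" by (rule mult.assoc)
  finally have "?E * (w 1 * w' 2) = ?E * (w 2 * w' 1)" .
  then show ?thesis using metric_11_pos[OF assms(1)] by simp
qed

lemma complex_linear_of_proportional:
  assumes "complex_linear u w" "w 1 \<noteq> 0" "w 1 * w' 2 = w 2 * w' 1"
  shows "complex_linear u w'"
proof -
  have "w 1 * (of_real (g u $ 1 $ 1) * w' 2) = of_real (g u $ 1 $ 1) * (w 1 * w' 2)"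
    by (rule mult.left_commute)
  also have "\<dots> = of_real (g u $ 1 $ 1) * w 2 * w' 1"
    unfolding assms(3) by (rule mult.assoc[symmetric])
  also have "\<dots> = w 1 * ((of_real (g u $ 1 $ 2) + \<i> * of_real (signed_area u)) * w' 1)"
    using assms(1) by (simp add: complex_linear_def)
  finally show ?thesis using assms(2) by (simp add: complex_linear_def)
qed

lemma partial_ln_norm:
  fixes f :: "real^2 \<Rightarrow> complex"
  assumes "f differentiable (at u)" "f u \<noteq> 0"
  shows "partial i (\<lambda>v. ln (norm (f v))) u = Re (partial i f u / f u)"
proof -
  have D: "(f has_derivative frechet_derivative f (at u)) (at u)"
    using assms(1) by (simp add: frechet_derivative_works)
  have "((\<lambda>v. ln (norm (f v))) has_derivative
      (\<lambda>h. (frechet_derivative f (at u) h \<bullet> sgn (f u)) / norm (f u))) (at u)"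
    using assms(2)
    by (auto intro!: derivative_eq_intros D has_derivative_norm[THEN has_derivative_compose[OF D]]
        simp: divide_inverse mult.commute)
  from partial_eqI[OF this, of i]
  have "partial i (\<lambda>v. ln (norm (f v))) u = (partial i f u \<bullet> f u) / (norm (f u))\<^sup>2"
    by (simp add: partial_def[symmetric] sgn_div_norm divide_inverse power2_eq_square)
  also have "\<dots> = Re (partial i f u / f u)"
    by (simp add: Re_divide inner_complex_def cmod_power2)
  finally show ?thesis .
qed

text \<open>The left-hand sides are the components of \<open>det g\<close> times the gradient of \<open>ln \<bar>f\<bar>\<close>: up to a
  factor, the rotation by \<open>J\<close> turns the real part of \<open>df / f\<close> into its imaginary part.\<close>

lemma flux_of_ln_norm:
  fixes f :: "real^2 \<Rightarrow> complex"
  assumes u: "u \<in> D" and f: "f differentiable (at u)" "f u \<noteq> 0"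
    and lin: "complex_linear u (\<lambda>i. partial i f u)"
  shows "g u $ 2 $ 2 * partial 1 (\<lambda>v. ln (norm (f v))) u
      - g u $ 1 $ 2 * partial 2 (\<lambda>v. ln (norm (f v))) u
      = signed_area u * Im (partial 2 f u / f u)"
    and "g u $ 1 $ 1 * partial 2 (\<lambda>v. ln (norm (f v))) u
        - g u $ 1 $ 2 * partial 1 (\<lambda>v. ln (norm (f v))) u
      = - signed_area u * Im (partial 1 f u / f u)"
proof -
  let ?r = "\<lambda>i. partial i f u / f u"
  have 1: "G * Re p - F * Re q = s * Im q"
    if "(of_real F - \<i> * of_real s) * q = of_real G * p" for p q F G s
    using arg_cong[OF that, of Re] by (simp add: algebra_simps)
  have 2: "E * Re q - F * Re p = - s * Im p"
    if "of_real E * q = (of_real F + \<i> * of_real s) * p" for p q E F s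
    using arg_cong[OF that, of Re] by (simp add: algebra_simps)
  have "(of_real (g u $ 1 $ 2) - \<i> * of_real (signed_area u)) * ?r 2 = of_real (g u $ 2 $ 2) * ?r 1"
    using complex_linear_second[OF u lin] by simp
  from 1[OF this] show "g u $ 2 $ 2 * partial 1 (\<lambda>v. ln (norm (f v))) u
      - g u $ 1 $ 2 * partial 2 (\<lambda>v. ln (norm (f v))) u = signed_area u * Im (?r 2)"
    unfolding partial_ln_norm[OF f] .
  have "of_real (g u $ 1 $ 1) * ?r 2 = (of_real (g u $ 1 $ 2) + \<i> * of_real (signed_area u)) * ?r 1"
    using lin by (simp add: complex_linear_def)
  from 2[OF this] show "g u $ 1 $ 1 * partial 2 (\<lambda>v. ln (norm (f v))) u
      - g u $ 1 $ 2 * partial 1 (\<lambda>v. ln (norm (f v))) u = - signed_area u * Im (?r 1)"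
    unfolding partial_ln_norm[OF f] .
qed

text \<open>If \<open>f\<close> is holomorphic for the conformal structure, then the conjugate differential of \<open>ln \<bar>f\<bar>\<close>
  is the imaginary part of the closed form \<open>df / f\<close>.\<close>

lemma ln_norm_harmonic:
  fixes f :: "real^2 \<Rightarrow> complex"
  assumes u: "u \<in> D" and f: "smooth_on D f" "\<And>v. v \<in> D \<Longrightarrow> f v \<noteq> 0"
    and lin: "\<And>v. v \<in> D \<Longrightarrow> complex_linear v (\<lambda>i. partial i f v)"
  shows "metric_laplacian g (\<lambda>v. ln (norm (f v))) u = 0"
proof -
  let ?h = "\<lambda>v. ln (norm (f v))"
  define r where "r i v = partial i f v / f v" for i v
  have fd: "f differentiable (at v)" if "v \<in> D" for v
    by (rule smooth_on_differentiable[OF f(1) that])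
  have r: "smooth_on D (r i)" for i
    unfolding r_def[abs_def] by (intro smooth_on_divide_complex open_D smooth_on_partial f)
  then have rd: "r i differentiable (at u)" for i
    by (rule smooth_on_differentiable[OF _ u])
  have "partial i (r j) u * f u = partial i (partial j f) u - r j u * partial i f u" for i j
  proof -
    have "partial i (\<lambda>v. r j v * f v) u = partial i (partial j f) u"
      by (rule partial_cong_open[OF open_D u]) (simp add: r_def f)
    then show ?thesis unfolding partial_mult[OF rd fd[OF u]] by (simp add: eq_diff_eq)
  qed
  then have "partial 1 (r 2) u * f u = partial 2 (r 1) u * f u"
    using partial_commute[OF open_D u f(1), of 1 2] by (simp add: r_def)
  then have closed: "partial 1 (r 2) u = partial 2 (r 1) u" using f(2)[OF u] by simp

  \<comment> \<open>near \<open>u\<close> the two orientations either agree everywhere or nowhere\<close>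
  define T where "T = {v \<in> D. signed_area v * signed_area u > 0}"
  have "continuous_on D signed_area"
    unfolding signed_area_def[abs_def]
    by (intro smooth_on_continuous smooth_intros open_D smooth_Y smooth_n)
  then have "open (D \<inter> (\<lambda>v. signed_area v * signed_area u) -` {0<..})"
    by (intro continuous_open_preimage open_D continuous_intros) auto
  moreover have "T = D \<inter> (\<lambda>v. signed_area v * signed_area u) -` {0<..}"
    by (auto simp: T_def)
  ultimately have "open T" by simp
  have uT: "u \<in> T" using u signed_area_nonzero[OF u]
    by (auto simp: T_def zero_less_mult_iff linorder_neq_iff)
  have "T \<subseteq> D" by (auto simp: T_def)
  define e where "e = sgn (signed_area u)"
  have area: "sqrt (det (g v)) = e * signed_area v" if "v \<in> T" for v
    using that signed_area_square[of v]
    by (auto simp: T_def e_def sgn_if zero_less_mult_iff real_sqrt_abs[symmetric] simp del: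
        real_sqrt_abs)
       (smt (verit, best) real_sqrt_abs)+
  have sq: "sqrt (det (g v)) * (x / det (g v)) = e * (x / signed_area v)" if "v \<in> T" for v x
  proof -
    have "det (g v) = (signed_area v)\<^sup>2" "signed_area v \<noteq> 0"
      using that signed_area_square signed_area_nonzero by (auto simp: T_def)
    then show ?thesis unfolding area[OF that] by (simp add: power2_eq_square)
  qed
  have flux: "sqrt (det (g v)) * (\<Sum>j\<in>UNIV. matrix_inv (g v) $ 1 $ j * partial j ?h v)
      = e * Im (r 2 v)"
    "sqrt (det (g v)) * (\<Sum>j\<in>UNIV. matrix_inv (g v) $ 2 $ j * partial j ?h v) = - (e * Im (r 1 v))"
    if "v \<in> T" for v
  proof -
    have v: "v \<in> D" using that by (simp add: T_def)
    have d: "det (g v) \<noteq> 0" "g v $ 2 $ 1 = g v $ 1 $ 2"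
      using det_metric_pos[OF v] by (simp_all add: metric_component inner_commute)
    have "(\<Sum>j\<in>UNIV. matrix_inv (g v) $ 1 $ j * partial j ?h v)
        = signed_area v * Im (r 2 v) / det (g v)"
      using flux_of_ln_norm(1)[OF v fd[OF v] f(2)[OF v] lin[OF v]] d
      by (simp add: sum_2 matrix_inv_2 r_def diff_divide_distrib[symmetric])
    then show "sqrt (det (g v)) * (\<Sum>j\<in>UNIV. matrix_inv (g v) $ 1 $ j * partial j ?h v)
        = e * Im (r 2 v)"
      using signed_area_nonzero[OF v] by (simp only: sq[OF that]) simp
    have "(\<Sum>j\<in>UNIV. matrix_inv (g v) $ 2 $ j * partial j ?h v)
        = - signed_area v * Im (r 1 v) / det (g v)"
      using flux_of_ln_norm(2)[OF v fd[OF v] f(2)[OF v] lin[OF v]] d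
      by (simp add: sum_2 matrix_inv_2 r_def diff_divide_distrib[symmetric])
    then show "sqrt (det (g v)) * (\<Sum>j\<in>UNIV. matrix_inv (g v) $ 2 $ j * partial j ?h v)
        = - (e * Im (r 1 v))"
      using signed_area_nonzero[OF v] by (simp only: sq[OF that]) simp
  qed
  have "partial 1 (\<lambda>v. sqrt (det (g v)) * (\<Sum>j\<in>UNIV. matrix_inv (g v) $ 1 $ j * partial j ?h v)) u
      = partial 1 (\<lambda>v. e * Im (r 2 v)) u"
    by (rule partial_cong_open[OF \<open>open T\<close> uT flux(1)])
  also have "\<dots> = e * Im (partial 1 (r 2) u)"
    by (rule partial_linear[OF bounded_linear_compose[OF bounded_linear_mult_right
        bounded_linear_Im] rd])
  finally have 1: "partial 1 (\<lambda>v. sqrt (det (g v)) * (\<Sum>j\<in>UNIV. matrix_inv (g v) $ 1 $ j * partial j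
      ?h v)) u
      = e * Im (partial 1 (r 2) u)" .
  have "partial 2 (\<lambda>v. sqrt (det (g v)) * (\<Sum>j\<in>UNIV. matrix_inv (g v) $ 2 $ j * partial j ?h v)) u
      = partial 2 (\<lambda>v. - (e * Im (r 1 v))) u"
    by (rule partial_cong_open[OF \<open>open T\<close> uT flux(2)])
  also have "\<dots> = - (e * Im (partial 2 (r 1) u))"
    by (rule partial_linear[OF bounded_linear_minus[OF bounded_linear_compose[OF
        bounded_linear_mult_right bounded_linear_Im]] rd])
  finally have 2: "partial 2 (\<lambda>v. sqrt (det (g v)) * (\<Sum>j\<in>UNIV. matrix_inv (g v) $ 2 $ j * partial j
      ?h v)) u
      = - (e * Im (partial 2 (r 1) u))" .
  show ?thesis
    unfolding metric_laplacian_def by (subst sum_2) (simp only: 1 2 closed, simp)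
qed

text \<open>If \<open>\<bar>f\<bar>\<close> is constant, so that the real part of the complex linear form \<open>df / f\<close> vanishes, then
  its imaginary part vanishes, too.\<close>

lemma partials_vanish_if_norm_constant:
  fixes f :: "real^2 \<Rightarrow> complex"
  assumes u: "u \<in> D" and f: "f differentiable (at u)" "f u \<noteq> 0"
    and lin: "complex_linear u (\<lambda>i. partial i f u)"
    and const: "\<And>v. v \<in> D \<Longrightarrow> norm (f v) = c"
  shows "partial i f u = 0"
proof -
  have h: "partial j (\<lambda>v. ln (norm (f v))) u = 0" for j
  proof -
    have "partial j (\<lambda>v. ln (norm (f v))) u = partial j (\<lambda>v. ln c) u"
      by (rule partial_cong_open[OF open_D u]) (simp add: const)
    then show ?thesis by (simp add: partial_const)
  qed
  have "Im (partial 2 f u / f u) = 0" "Im (partial 1 f u / f u) = 0"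
    using flux_of_ln_norm[OF u f lin] signed_area_nonzero[OF u] unfolding h
      by (simp_all del: Im_divide)
  then have "Im (partial j f u / f u) = 0" for j
    using exhaust_2[of j] by metis
  moreover have "Re (partial j f u / f u) = 0" for j
    using h unfolding partial_ln_norm[OF f] .
  ultimately have "partial i f u / f u = 0" by (intro complex_eqI) (simp_all only: zero_complex.sel)
  with f(2) show ?thesis by simp
qed

end

section \<open>Minimal patches and their Weierstrass data\<close>

text \<open>This is \<open>dG / G\<close> for the stereographic projection \<open>G\<close> of the normal from the pole \<open>V\<close> (see
  \<open>partial_stereographic\<close>), written without a choice of axes orthogonal to \<open>V\<close>.\<close>

definition gauss_form :: "(real^2 \<Rightarrow> real^3) \<Rightarrow> real^3 \<Rightarrow> 2 \<Rightarrow> real^2 \<Rightarrow> complex" where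
  "gauss_form n V i u =
     Complex (partial i n u \<bullet> V) ((n u \<times> partial i n u) \<bullet> V) / of_real (1 - (n u \<bullet> V)\<^sup>2)"

text \<open>In Weierstrass data this is \<open>G \<Psi> d\<zeta>\<close>: the differential of the height \<open>Y \<bullet> V\<close>, completed to a
  complex linear form with respect to \<open>J\<close>.\<close>

definition height_form :: "(real^2 \<Rightarrow> real^3) \<Rightarrow> (real^2 \<Rightarrow> real^3) \<Rightarrow> real^3 \<Rightarrow> 2 \<Rightarrow> real^2 \<Rightarrow> complex"
    where
  "height_form Y n V i u = Complex (partial i Y u \<bullet> V) (- ((n u \<times> partial i Y u) \<bullet> V))"

text \<open>In Weierstrass data this is the function \<open>G\<^sup>2 \<Psi> / G'\<close>.\<close>

definition form_quotient :: "(real^2 \<Rightarrow> real^3) \<Rightarrow> (real^2 \<Rightarrow> real^3) \<Rightarrow> real^3 \<Rightarrow> real^2 \<Rightarrow> complex" where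
  "form_quotient Y n V u = height_form Y n V 1 u / gauss_form n V 1 u"

locale minimal_patch = surface_patch +
  fixes V :: "real^3"
  assumes minimal: "\<And>u. u \<in> D \<Longrightarrow> mean_curvature Y n u = 0"
    and negative: "\<And>u. u \<in> D \<Longrightarrow> metric_curvature g u < 0"
    and unit_V: "norm V = 1"
    and angle: "\<And>u. u \<in> D \<Longrightarrow> -1 < n u \<bullet> V \<and> n u \<bullet> V < 1"
begin

lemma angle_square: "u \<in> D \<Longrightarrow> 1 - (n u \<bullet> V)\<^sup>2 > 0"
  using angle[of u] by (simp add: abs_square_less_1 abs_less_iff)

lemma normal_dot_normal: "u \<in> D \<Longrightarrow> n u \<bullet> n u = 1"
  using unit by (simp add: norm_eq_1)

lemma smooth_gauss_form: "smooth_on D (gauss_form n V i)"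
  unfolding gauss_form_def[abs_def]
  by (intro smooth_on_divide_complex smooth_on_Complex smooth_intros open_D smooth_n)
     (use angle_square in \<open>fastforce simp del: of_real_diff\<close>)

lemma smooth_height_form: "smooth_on D (height_form Y n V i)"
  unfolding height_form_def[abs_def]
  by (intro smooth_on_Complex smooth_intros open_D smooth_n smooth_Y)

text \<open>For a minimal surface the differential of the Gauss map anticommutes with \<open>J\<close>.\<close>

lemma rotation_normal:
  assumes "u \<in> D"
  shows "signed_area u *\<^sub>R (n u \<times> partial 1 n u)
      = g u $ 1 $ 2 *\<^sub>R partial 1 n u - g u $ 1 $ 1 *\<^sub>R partial 2 n u"
proof -
  let ?p = "partial 1 Y u" and ?q = "partial 2 Y u" and ?a = "partial 1 n u" and ?b = "partial 2 n u"
  define w where "w = signed_area u *\<^sub>R (n u \<times> ?a) - (g u $ 1 $ 2 *\<^sub>R ?a - g u $ 1 $ 1 *\<^sub>R ?b)"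
  have "signed_area u *\<^sub>R (n u \<times> ?a) = - (?a \<times> (?p \<times> ?q))"
    using cross_skew[of "?p \<times> ?q" ?a] by (simp add: normal_cross[OF assms] cross_mult_left)
  then have rot: "signed_area u *\<^sub>R (n u \<times> ?a) = (?a \<bullet> ?p) *\<^sub>R ?q - (?a \<bullet> ?q) *\<^sub>R ?p"
    by (simp add: cross_cross_left)
  have sym: "?b \<bullet> ?p = ?a \<bullet> ?q"
    by (simp add: weingarten[OF assms] second_commute[OF assms, of 2 1])
  have "(?a \<times> ?q + ?p \<times> ?b) \<bullet> (?p \<times> ?q) = 0"
    using mean_curvature_zero_iff[OF assms] minimal[OF assms] by simp
  then have tr: "(?a \<bullet> ?p) * (?q \<bullet> ?q) - (?a \<bullet> ?q) * (?q \<bullet> ?p) + ((?p \<bullet> ?p) * (?b \<bullet> ?q)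
      - (?p \<bullet> ?q) * (?b \<bullet> ?p)) = 0"
    unfolding inner_add_left dot_cross_cross .
  have "n u \<bullet> w = 0"
    unfolding w_def rot
    by (simp add: inner_diff_right normal[OF assms] normal_derivative_tangent[OF assms])
  then obtain x y where xy: "w = x *\<^sub>R ?p + y *\<^sub>R ?q"
    using tangent_vector_expand[OF unit normal normal normal_cross_nonzero] assms by metis
  have "w \<bullet> ?p = 0"
    unfolding w_def rot metric_component inner_diff_left inner_scaleR_left sym
    by (simp add: inner_commute[of ?q ?p])
  moreover have "w \<bullet> ?q = 0"
    using tr unfolding w_def rot metric_component inner_diff_left inner_scaleR_left sym
    by (simp add: inner_commute[of ?q ?p] algebra_simps)
  ultimately have "w \<bullet> w = 0"
    by (subst (2) xy) (simp add: inner_add_right)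
  then show ?thesis by (simp add: w_def)
qed

lemma height_form_complex_linear:
  assumes "u \<in> D"
  shows "complex_linear u (\<lambda>i. height_form Y n V i u)"
proof -
  let ?p = "partial 1 Y u" and ?q = "partial 2 Y u"
  have r: "g u $ 1 $ 1 *\<^sub>R ?q = g u $ 1 $ 2 *\<^sub>R ?p + signed_area u *\<^sub>R (n u \<times> ?p)"
    using rotation_1[OF assms] by simp
  have "g u $ 1 $ 1 * (?q \<bullet> V) = g u $ 1 $ 2 * (?p \<bullet> V) + signed_area u * ((n u \<times> ?p) \<bullet> V)"
    using arg_cong[OF r, of "\<lambda>w. w \<bullet> V"] by (simp add: inner_add_left)
  moreover have "g u $ 1 $ 1 * ((n u \<times> ?q) \<bullet> V)
      = g u $ 1 $ 2 * ((n u \<times> ?p) \<bullet> V) - signed_area u * (?p \<bullet> V)"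
    using arg_cong[OF r, of "\<lambda>w. (n u \<times> w) \<bullet> V"]
    by (simp add: inner_add_left inner_diff_left cross_add_right cross_mult_right cross_cross_left
        normal[OF assms] normal_dot_normal[OF assms])
  ultimately show ?thesis
    by (simp add: complex_linear_def height_form_def complex_eq_iff algebra_simps)
qed

lemma gauss_form_complex_linear:
  assumes "u \<in> D"
  shows "complex_linear u (\<lambda>i. gauss_form n V i u)"
proof -
  let ?p = "partial 1 n u" and ?q = "partial 2 n u"
  have r: "g u $ 1 $ 1 *\<^sub>R ?q = g u $ 1 $ 2 *\<^sub>R ?p - signed_area u *\<^sub>R (n u \<times> ?p)"
    using rotation_normal[OF assms] by simp
  have "g u $ 1 $ 1 * (?q \<bullet> V) = g u $ 1 $ 2 * (?p \<bullet> V) - signed_area u * ((n u \<times> ?p) \<bullet> V)"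
    using arg_cong[OF r, of "\<lambda>w. w \<bullet> V"] by (simp add: inner_diff_left)
  moreover have "g u $ 1 $ 1 * ((n u \<times> ?q) \<bullet> V)
      = g u $ 1 $ 2 * ((n u \<times> ?p) \<bullet> V) + signed_area u * (?p \<bullet> V)"
    using arg_cong[OF r, of "\<lambda>w. (n u \<times> w) \<bullet> V"]
    by (simp add: Cross3.right_diff_distrib cross_mult_right inner_diff_left inner_add_left
        cross_cross_left
        normal_derivative_tangent[OF assms] normal_dot_normal[OF assms])
  ultimately have "of_real (g u $ 1 $ 1) * Complex (?q \<bullet> V) ((n u \<times> ?q) \<bullet> V)
      = (of_real (g u $ 1 $ 2) + \<i> * of_real (signed_area u)) * Complex (?p \<bullet> V) ((n u \<times> ?p) \<bullet> V)"
    by (simp add: complex_eq_iff algebra_simps)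
  then show ?thesis
    unfolding complex_linear_def gauss_form_def times_divide_eq_right by (rule arg_cong)
qed

text \<open>Minimality is the closedness of \<open>n \<times> dY\<close>.\<close>

lemma height_form_closed:
  assumes "u \<in> D"
  shows "partial 1 (height_form Y n V 2) u = partial 2 (height_form Y n V 1) u"
proof -
  note d = normal_differentiable[OF assms] partial_differentiable[OF assms]
  have cd: "(\<lambda>v. (n v \<times> partial j Y v)) differentiable (at u)" for j
    by (intro smooth_on_differentiable[OF _ assms] smooth_intros open_D smooth_n smooth_Y)
  have p: "partial i (height_form Y n V j) u = Complex (partial i (partial j Y) u \<bullet> V)
      (- ((partial i n u \<times> partial j Y u + n u \<times> partial i (partial j Y) u) \<bullet> V))" for i j
  proof -
    have 1: "(\<lambda>v. partial j Y v \<bullet> V) differentiable (at u)" "(\<lambda>v.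
        - ((n v \<times> partial j Y v) \<bullet> V)) differentiable (at u)"
      by (intro smooth_on_differentiable[OF _ assms] smooth_intros open_D smooth_n smooth_Y)+
    show ?thesis
      unfolding height_form_def[abs_def] partial_Complex[OF 1]
        partial_linear[OF bounded_linear_inner_left d(2)]
        partial_linear[OF bounded_linear_minus[OF bounded_linear_inner_left] cd]
        partial_cross3[OF d] ..
  qed
  have "partial 1 n u \<times> partial 2 Y u = partial 2 n u \<times> partial 1 Y u"
    using mean_curvature_zero_iff[OF assms] minimal[OF assms] cross_skew[of "partial 1 Y u" "partial
        2 n u"] by simp
  then show ?thesis
    unfolding p second_commute[OF assms, of 2 1] by simp
qed

text \<open>After multiplication by \<open>(1 - (n \<bullet> V)\<^sup>2)\<^sup>2\<close> this becomes polynomial in the normal and its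
  derivatives.\<close>

lemma gauss_form_closed:
  assumes "u \<in> D"
  shows "partial 1 (gauss_form n V 2) u = partial 2 (gauss_form n V 1) u"
proof -
  let ?q = "\<lambda>v. complex_of_real (1 - (n v \<bullet> V)\<^sup>2)"
  let ?N = "\<lambda>i v. Complex (partial i n v \<bullet> V) ((n v \<times> partial i n v) \<bullet> V)"
  note nd = normal_differentiable[OF assms]
  have nd': "partial j n differentiable (at u)" for j
    by (rule smooth_on_differentiable[OF smooth_on_partial[OF smooth_n] assms])
  have cd: "(\<lambda>v. (n v \<times> partial j n v)) differentiable (at u)" for j
    by (intro smooth_on_differentiable[OF _ assms] smooth_intros open_D smooth_n)
  have N: "partial i (?N j) u = Complex (partial i (partial j n) u \<bullet> V)
      ((partial i n u \<times> partial j n u + n u \<times> partial i (partial j n) u) \<bullet> V)" for i j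
  proof -
    have 1: "(\<lambda>v. partial j n v \<bullet> V) differentiable (at u)" "(\<lambda>v. (n v \<times> partial j n v) \<bullet> V)
        differentiable (at u)"
      by (intro smooth_on_differentiable[OF _ assms] smooth_intros open_D smooth_n)+
    show ?thesis
      unfolding partial_Complex[OF 1] partial_linear[OF bounded_linear_inner_left nd']
        partial_linear[OF bounded_linear_inner_left cd] partial_cross3[OF nd nd'] ..
  qed
  have q: "partial i ?q u = of_real (- 2 * (n u \<bullet> V) * (partial i n u \<bullet> V))" for i
  proof -
    have 1: "(\<lambda>v. n v \<bullet> V) differentiable (at u)"
      by (intro smooth_on_differentiable[OF _ assms] smooth_intros open_D smooth_n)
    have 2: "(\<lambda>v. (n v \<bullet> V) * (n v \<bullet> V)) differentiable (at u)"
      by (intro smooth_on_differentiable[OF _ assms] smooth_intros open_D smooth_n)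
    have 3: "(\<lambda>v. 1 - (n v \<bullet> V) * (n v \<bullet> V)) differentiable (at u)"
      by (intro smooth_on_differentiable[OF _ assms] smooth_intros open_D smooth_n)
    show ?thesis
      unfolding power2_eq_square partial_linear[OF bounded_linear_of_real 3]
        partial_diff[OF differentiable_const 2] partial_const partial_mult[OF 1 1]
        partial_linear[OF bounded_linear_inner_left nd] by simp
  qed
  have qd: "?q differentiable (at u)"
    by (intro smooth_on_differentiable[OF _ assms] smooth_intros open_D smooth_n)
  have gd: "gauss_form n V j differentiable (at u)" for j
    by (rule smooth_on_differentiable[OF smooth_gauss_form assms])
  have qg: "?q v * gauss_form n V j v = ?N j v" if "v \<in> D" for v j
    using angle_square[OF that] unfolding gauss_form_def
    by (simp del: of_real_diff)
  have *: "partial i ?q u * gauss_form n V j u + ?q u * partial i (gauss_form n V j) u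
      = partial i (?N j) u" for i j
    unfolding partial_mult[OF qd gd, symmetric] by (rule partial_cong_open[OF open_D assms qg])
  let ?a = "partial 1 n u" and ?b = "partial 2 n u"
  have "?q u * (?q u * (partial 1 (gauss_form n V 2) u - partial 2 (gauss_form n V 1) u))
      = ?q u * (partial 1 (?N 2) u - partial 2 (?N 1) u)
        - (partial 1 ?q u * (?q u * gauss_form n V 2 u)
            - partial 2 ?q u * (?q u * gauss_form n V 1 u))"
    unfolding *[symmetric] by (simp add: algebra_simps)
  also have "\<dots> = ?q u * (partial 1 (?N 2) u - partial 2 (?N 1) u)
        - (partial 1 ?q u * ?N 2 u - partial 2 ?q u * ?N 1 u)"
    unfolding qg[OF assms] ..
  also have "\<dots> = 0"
  proof -
    have s: "partial 2 (partial 1 n) u = partial 1 (partial 2 n) u"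
      by (rule partial_commute[OF open_D assms smooth_n])
    have "2 * ((1 - (n u \<bullet> V)\<^sup>2) * ((?a \<times> ?b) \<bullet> V)
       + (n u \<bullet> V) * ((?a \<bullet> V) * ((n u \<times> ?b) \<bullet> V) - (?b \<bullet> V) * ((n u \<times> ?a) \<bullet> V))) = 0"
      unfolding gauss_form_closed_algebra[OF unit[OF assms] unit_V normal_derivative_tangent[OF assms]
        normal_derivative_tangent[OF assms]] by simp
    then show ?thesis
      unfolding N q s cross_skew[of ?b ?a]
      by (simp add: complex_eq_iff inner_add_left algebra_simps)
  qed
  finally show ?thesis using angle_square[OF assms] by (simp del: of_real_diff)
qed

lemma height_form_norm: "u \<in> D \<Longrightarrow> (norm (height_form Y n V 1 u))\<^sup>2 = g u $ 1 $ 1 * (1 - (n u \<bullet> V)\<^sup>2)"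
  using tangent_components_norm[OF unit[of u] unit_V normal[of u 1]]
  by (simp add: height_form_def cmod_power2 metric_component)

text \<open>The Gauss map of a minimal surface is conformal with factor \<open>-K\<close>.\<close>

lemma normal_derivative_norm:
  assumes "u \<in> D"
  shows "partial 1 n u \<bullet> partial 1 n u = - metric_curvature g u * g u $ 1 $ 1"
proof -
  let ?a = "partial 1 n u" and ?b = "partial 2 n u" and ?s = "signed_area u"
  have "?s *\<^sub>R (?a \<times> (n u \<times> ?a)) = ?a \<times> (g u $ 1 $ 2 *\<^sub>R ?a - g u $ 1 $ 1 *\<^sub>R ?b)"
    unfolding rotation_normal[OF assms, symmetric] by (simp add: cross_mult_right)
  also have "\<dots> = - g u $ 1 $ 1 *\<^sub>R (?a \<times> ?b)"
    by (simp add: Cross3.right_diff_distrib cross_mult_right)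
  also have "?a \<times> ?b = metric_curvature g u *\<^sub>R (partial 1 Y u \<times> partial 2 Y u)"
    using curvature_normal_cross[OF assms] by blast
  finally have "?s *\<^sub>R ((?a \<bullet> ?a) *\<^sub>R n u) = ?s *\<^sub>R ((- metric_curvature g u * g u $ 1 $ 1) *\<^sub>R n u)"
    using normal_derivative_tangent[OF assms, of 1]
    by (simp add: cross_cross_left normal_cross[OF assms] inner_commute mult_ac)
  from arg_cong[OF this, of "\<lambda>w. w \<bullet> n u"]
  have "?s * (?a \<bullet> ?a) = ?s * (- metric_curvature g u * g u $ 1 $ 1)"
    by (simp add: normal_dot_normal[OF assms])
  then show ?thesis
    using signed_area_nonzero[OF assms] mult_left_cancel by blast
qed

lemma gauss_form_norm:
  assumes "u \<in> D"
  shows "(norm (gauss_form n V 1 u))\<^sup>2 = - metric_curvature g u * g u $ 1 $ 1 / (1 - (n u \<bullet> V)\<^sup>2)"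
proof -
  let ?q = "1 - (n u \<bullet> V)\<^sup>2"
  have "(norm (gauss_form n V 1 u))\<^sup>2
      = ((partial 1 n u \<bullet> V)\<^sup>2 + ((n u \<times> partial 1 n u) \<bullet> V)\<^sup>2) / ?q\<^sup>2"
    unfolding gauss_form_def norm_divide norm_of_real power_divide power2_abs cmod_power2
        complex.sel ..
  also have "\<dots> = - metric_curvature g u * g u $ 1 $ 1 * ?q / ?q\<^sup>2"
    unfolding tangent_components_norm[OF unit[OF assms] unit_V normal_derivative_tangent[OF assms]]
      normal_derivative_norm[OF assms] ..
  finally show ?thesis by (simp add: power2_eq_square)
qed

lemma gauss_form_nonzero: "u \<in> D \<Longrightarrow> gauss_form n V 1 u \<noteq> 0"
  using gauss_form_norm[of u] negative[of u] metric_11_pos[of u] angle_square[of u]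
  by (auto simp: divide_less_0_iff mult_less_0_iff)

lemma height_form_nonzero: "u \<in> D \<Longrightarrow> height_form Y n V 1 u \<noteq> 0"
  using height_form_norm[of u] metric_11_pos[of u] angle_square[of u] by auto

abbreviation "Q \<equiv> form_quotient Y n V"

lemma smooth_quotient: "smooth_on D Q"
  unfolding form_quotient_def[abs_def]
  by (intro smooth_on_divide_complex open_D smooth_height_form smooth_gauss_form gauss_form_nonzero)

lemma quotient_nonzero: "u \<in> D \<Longrightarrow> Q u \<noteq> 0"
  by (simp add: form_quotient_def gauss_form_nonzero height_form_nonzero)

lemma height_form_eq:
  assumes "u \<in> D"
  shows "height_form Y n V i u = Q u * gauss_form n V i u"
proof -
  have "height_form Y n V 1 u = Q u * gauss_form n V 1 u"
    by (simp add: form_quotient_def gauss_form_nonzero[OF assms])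
  moreover have "height_form Y n V 2 u = Q u * gauss_form n V 2 u"
    using complex_linear_proportional[OF assms height_form_complex_linear[OF assms]
        gauss_form_complex_linear[OF assms]]
      gauss_form_nonzero[OF assms] by (simp add: form_quotient_def field_simps)
  ultimately show ?thesis using exhaust_2[of i] by metis
qed

text \<open>The quotient of two closed forms that are complex linear for \<open>J\<close> is holomorphic for \<open>J\<close>:
  \<open>0 = d(Q \<theta>) = dQ \<and> \<theta>\<close>.\<close>

lemma quotient_holomorphic:
  assumes "u \<in> D"
  shows "complex_linear u (\<lambda>i. partial i Q u)"
proof (rule complex_linear_of_proportional[OF gauss_form_complex_linear[OF assms]
    gauss_form_nonzero[OF assms]])
  have Qd: "Q differentiable (at u)" and gd: "gauss_form n V j differentiable (at u)" for j
    by (rule smooth_on_differentiable[OF smooth_quotient assms] smooth_on_differentiable[OF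
        smooth_gauss_form assms])+
  have "partial i (height_form Y n V j) u
      = partial i Q u * gauss_form n V j u + Q u * partial i (gauss_form n V j) u"
    for i j
    unfolding partial_mult[OF Qd gd, symmetric]
      by (rule partial_cong_open[OF open_D assms height_form_eq])
  from this[of 1 2] this[of 2 1] show "gauss_form n V 1 u * partial 2 Q u
      = gauss_form n V 2 u * partial 1 Q u"
    unfolding height_form_closed[OF assms] gauss_form_closed[OF assms] by (simp add: mult.commute)
qed

text \<open>Both forms are complex linear for \<open>J\<close>, so one direction suffices to compare their lengths: the
  tangential part of \<open>V\<close> contributes \<open>1 - (n \<bullet> V)\<^sup>2\<close> and the Gauss map stretches by \<open>(-K)\<^sup>1\<^sup>/\<^sup>2\<close>.
  The logarithm of the left-hand side is thus the second Chern-Ricci function.\<close>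

lemma quotient_norm:
  assumes "u \<in> D"
  shows "norm (Q u) = (- metric_curvature g u) powr (-1/2) * (1 - (n u \<bullet> V)\<^sup>2)"
proof -
  let ?q = "1 - (n u \<bullet> V)\<^sup>2" and ?k = "- metric_curvature g u"
  have pos: "?q > 0" "?k > 0" "g u $ 1 $ 1 > 0"
    using angle_square[OF assms] negative[OF assms] metric_11_pos[OF assms] by auto
  have 1: "E * q / (k * E / q) = q\<^sup>2 / k" if "q > 0" "E > 0" for E q k :: real
    using that by (simp add: power2_eq_square)
  have 2: "q\<^sup>2 / k = (k powr (-1/2) * q)\<^sup>2" if "k > 0" for q k :: real
  proof -
    have "k powr (-1/2) = inverse (sqrt k)"
      using powr_minus[of k "1/2"] that by (simp add: powr_half_sqrt)
    then have "k powr (-1/2) * q = q / sqrt k" by (simp only: divide_inverse mult.commute)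
    then show ?thesis using that by (simp only: power_divide) simp
  qed
  have "(norm (Q u))\<^sup>2 = ?q\<^sup>2 / ?k"
    unfolding form_quotient_def norm_divide power_divide height_form_norm[OF assms]
        gauss_form_norm[OF assms]
    by (rule 1[OF pos(1,3)])
  also have "\<dots> = (?k powr (-1/2) * ?q)\<^sup>2"
    by (rule 2[OF pos(2)])
  finally show ?thesis
    by (rule power2_eq_imp_eq) (use pos in auto)
qed

lemma quotient_partials_vanish:
  assumes "u \<in> D" "\<And>v. v \<in> D \<Longrightarrow> norm (Q v) = c"
  shows "partial i Q u = 0"
  by (rule partials_vanish_if_norm_constant[OF assms(1) smooth_on_differentiable[OF smooth_quotient
      assms(1)]
        quotient_nonzero[OF assms(1)] quotient_holomorphic[OF assms(1)] assms(2)])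

end

subsection \<open>Stereographic projection of the Gauss map\<close>

definition stereographic :: "real^3 \<Rightarrow> real^3 \<Rightarrow> real^3 \<Rightarrow> complex" where
  "stereographic e1 e2 p = Complex (p \<bullet> e1) (p \<bullet> e2) / of_real (1 - p \<bullet> (e1 \<times> e2))"

locale positive_frame =
  fixes e1 e2 V :: "real^3"
  assumes unit_e1: "e1 \<bullet> e1 = 1" and unit_e2: "e2 \<bullet> e2 = 1" and orth: "e1 \<bullet> e2 = 0"
    and cross: "e1 \<times> e2 = V"
begin

lemma unit_V: "V \<bullet> V = 1"
  unfolding cross[symmetric] dot_cross_cross by (simp add: unit_e1 unit_e2 orth)

lemma cross_V: "V \<times> e1 = e2" "V \<times> e2 = - e1"
proof -
  have "V \<times> e1 = - (e1 \<times> (e1 \<times> e2))" "V \<times> e2 = - (e2 \<times> (e1 \<times> e2))"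
    unfolding cross by (rule cross_skew)+
  then show "V \<times> e1 = e2" "V \<times> e2 = - e1"
    by (simp_all add: cross_cross_left unit_e1 unit_e2 orth inner_commute[of e2 e1])
qed

lemma expand: "w = (w \<bullet> e1) *\<^sub>R e1 + (w \<bullet> e2) *\<^sub>R e2 + (w \<bullet> V) *\<^sub>R V"
proof -
  have "w - (V \<bullet> w) *\<^sub>R V = V \<times> (w \<times> V)"
    by (simp add: cross_cross_left[of V w V] unit_V)
  also have "w \<times> V = (w \<bullet> e2) *\<^sub>R e1 - (w \<bullet> e1) *\<^sub>R e2"
    unfolding cross[symmetric] by (rule cross_cross_left)
  also have "V \<times> \<dots> = (w \<bullet> e2) *\<^sub>R e2 + (w \<bullet> e1) *\<^sub>R e1"
    by (simp add: Cross3.right_diff_distrib cross_mult_right cross_V)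
  finally show ?thesis by (simp add: algebra_simps inner_commute)
qed

lemma inner_expand: "v \<bullet> w = (v \<bullet> e1) * (w \<bullet> e1) + (v \<bullet> e2) * (w \<bullet> e2) + (v \<bullet> V) * (w \<bullet> V)"
  using arg_cong[OF expand[of w], of "\<lambda>w. v \<bullet> w"] by (simp add: inner_add_right mult.commute)

lemma cross_dot_V: "(v \<times> w) \<bullet> V = (v \<bullet> e1) * (w \<bullet> e2) - (v \<bullet> e2) * (w \<bullet> e1)"
  unfolding cross[symmetric] by (rule dot_cross_cross)

end

lemma positive_frame_exists:
  fixes V :: "real^3"
  assumes "norm V = 1"
  obtains e1 e2 where "positive_frame e1 e2 V"
proof -
  obtain x where x: "x \<noteq> 0" "orthogonal V x"
    using orthogonal_to_vector_exists[of V] by auto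
  define e where "e = sgn x"
  have e: "e \<bullet> e = 1" "e \<bullet> V = 0"
    using x by (simp_all add: e_def sgn_div_norm orthogonal_def inner_commute
        power2_norm_eq_inner[symmetric] power2_eq_square)
  have V: "V \<bullet> V = 1" using assms by (simp add: norm_eq_1)
  have "positive_frame e (V \<times> e) V"
    by unfold_locales (simp_all add: e V dot_cross_cross cross_cross_left dot_cross_self
        inner_commute[of V e])
  then show thesis by (rule that)
qed

locale framed_minimal_patch = minimal_patch + positive_frame e1 e2 V for e1 e2
begin

abbreviation "G \<equiv> \<lambda>u. stereographic e1 e2 (n u)"

lemma normal_components:
  assumes "u \<in> D"
  shows "(n u \<bullet> e1)\<^sup>2 + (n u \<bullet> e2)\<^sup>2 = 1 - (n u \<bullet> V)\<^sup>2"
  using inner_expand[of "n u" "n u"] normal_dot_normal[OF assms] by (simp add: power2_eq_square)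

lemma stereographic_eq: "u \<in> D \<Longrightarrow> of_real (1 - n u \<bullet> V) * G u = Complex (n u \<bullet> e1) (n u \<bullet> e2)"
  using angle[of u] by (simp add: stereographic_def cross del: of_real_diff)

lemma stereographic_nonzero:
  assumes "u \<in> D"
  shows "G u \<noteq> 0"
proof
  assume "G u = 0"
  then have "Complex (n u \<bullet> e1) (n u \<bullet> e2) = 0"
    using stereographic_eq[OF assms] by simp
  then show False using normal_components[OF assms] angle_square[OF assms]
    by (simp add: complex_eq_iff)
qed

text \<open>\<open>1 / G\<close> is the conjugate of the stereographic projection from the opposite pole.\<close>

lemma inverse_stereographic_eq:
  assumes "u \<in> D"
  shows "of_real (1 + n u \<bullet> V) * inverse (G u) = Complex (n u \<bullet> e1) (- (n u \<bullet> e2))"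
proof -
  let ?m = "Complex (n u \<bullet> e1) (n u \<bullet> e2)"
  have "cnj ?m * ?m = of_real (1 - (n u \<bullet> V)\<^sup>2)"
    using normal_components[OF assms] by (simp add: complex_eq_iff power2_eq_square)
  also have "\<dots> = of_real (1 - n u \<bullet> V) * of_real (1 + n u \<bullet> V)"
    by (simp add: power2_eq_square algebra_simps)
  finally have "of_real (1 - n u \<bullet> V) * (cnj ?m * G u)
      = of_real (1 - n u \<bullet> V) * of_real (1 + n u \<bullet> V)"
    unfolding stereographic_eq[OF assms, symmetric] by (simp only: mult_ac)
  then have "cnj ?m * G u = of_real (1 + n u \<bullet> V)"
    using angle[OF assms] by (simp del: of_real_diff of_real_add)
  then show ?thesis
    using stereographic_nonzero[OF assms] by (simp add: field_simps complex_cnj)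
qed

lemma smooth_stereographic: "smooth_on D G"
  unfolding stereographic_def cross
  by (intro smooth_on_divide_complex smooth_on_Complex smooth_intros open_D smooth_n)
     (use angle in \<open>fastforce simp del: of_real_diff\<close>)

text \<open>In terms of the stereographic projection \<open>G\<close> of the normal, the Gauss form is \<open>dG / G\<close>.\<close>

lemma partial_stereographic:
  assumes "u \<in> D"
  shows "partial i G u = G u * gauss_form n V i u"
proof -
  note nd = normal_differentiable[OF assms]
  let ?c = "n u \<bullet> V" and ?ci = "partial i n u \<bullet> V"
  let ?m = "Complex (n u \<bullet> e1) (n u \<bullet> e2)"
      and ?mi = "Complex (partial i n u \<bullet> e1) (partial i n u \<bullet> e2)"
  have 1: "(\<lambda>v. n v \<bullet> w) differentiable (at u)" "(\<lambda>v. 1 - n v \<bullet> w) differentiable (at u)"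
    "(\<lambda>v. complex_of_real (1 - n v \<bullet> w)) differentiable (at u)" for w
    by (intro smooth_on_differentiable[OF _ assms] smooth_intros open_D smooth_n)+
  have "partial i (\<lambda>v. of_real (1 - n v \<bullet> V) * G v) u
      = partial i (\<lambda>v. Complex (n v \<bullet> e1) (n v \<bullet> e2)) u"
    by (rule partial_cong_open[OF open_D assms stereographic_eq])
  then have "of_real (1 - ?c) * partial i G u - of_real ?ci * G u = ?mi"
    unfolding partial_mult[OF 1(3) smooth_on_differentiable[OF smooth_stereographic assms]]
      partial_linear[OF bounded_linear_of_real 1(2)] partial_diff[OF differentiable_const 1(1)]
          partial_const
      partial_linear[OF bounded_linear_inner_left nd] partial_Complex[OF 1(1) 1(1)]
    by simp
  then have "of_real (1 - ?c) * partial i G u = ?mi + of_real ?ci * G u" by (simp add: algebra_simps)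
  moreover have "of_real (1 - ?c\<^sup>2) * (?mi + of_real ?ci * G u)
      = of_real (1 - ?c\<^sup>2) * (of_real (1 - ?c) * G u * gauss_form n V i u)"
  proof -
    have q: "of_real (1 - ?c\<^sup>2) * gauss_form n V i u = Complex ?ci ((n u \<times> partial i n u) \<bullet> V)"
      using angle_square[OF assms] by (simp add: gauss_form_def del: of_real_diff)
    have nn: "(n u \<bullet> e1) * (partial i n u \<bullet> e1) + (n u \<bullet> e2) * (partial i n u \<bullet> e2) + ?c * ?ci = 0"
      using inner_expand[of "n u" "partial i n u"] normal_derivative_tangent[OF assms] by simp
    have mm: "cnj ?m * ?m = of_real (1 - ?c\<^sup>2)"
      using normal_components[OF assms] by (simp add: complex_eq_iff power2_eq_square)
    have c: "of_real (1 - ?c\<^sup>2) = complex_of_real (1 + ?c) * of_real (1 - ?c)"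
      by (simp add: power2_eq_square algebra_simps)
    have key: "cnj ?m * ?mi + of_real (1 + ?c) * of_real ?ci
        = Complex ?ci ((n u \<times> partial i n u) \<bullet> V)"
      using nn unfolding cross_dot_V by (simp add: complex_eq_iff algebra_simps)
    have "of_real (1 - ?c\<^sup>2) * (?mi + of_real ?ci * G u)
        = ?m * (cnj ?m * ?mi + of_real (1 + ?c) * of_real ?ci)"
      unfolding distrib_left mm[symmetric] stereographic_eq[OF assms, symmetric]
      by (subst (2) c[folded mm, unfolded stereographic_eq[OF assms, symmetric]]) (simp only: mult_ac)
    also have "\<dots> = ?m * (of_real (1 - ?c\<^sup>2) * gauss_form n V i u)"
      unfolding key q ..
    finally show ?thesis unfolding stereographic_eq[OF assms] by (simp only: mult_ac)
  qed
  ultimately have "of_real (1 - ?c) * partial i G u = of_real (1 - ?c) * (G u * gauss_form n V i u)"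
    using angle_square[OF assms] by (simp del: of_real_diff add: mult.assoc)
  then show ?thesis using angle[OF assms] by (simp del: of_real_diff)
qed

text \<open>At each point the differential of \<open>Y\<close> is determined by \<open>G\<close> and the height form, because a
  tangent vector is determined by its inner products with \<open>V\<close> and \<open>n \<times> V\<close>.\<close>

lemma weierstrass_representation:
  assumes "u \<in> D"
  shows "Re (1/2 * (inverse (G u) - G u) * height_form Y n V i u) = partial i Y u \<bullet> e1"
    and "Re (\<i>/2 * (inverse (G u) + G u) * height_form Y n V i u) = partial i Y u \<bullet> e2"
    and "Re (height_form Y n V i u) = partial i Y u \<bullet> V"
proof -
  let ?a = "n u \<bullet> e1" and ?b = "n u \<bullet> e2" and ?c = "n u \<bullet> V" and ?w = "partial i Y u"
  let ?q = "complex_of_real (1 - ?c\<^sup>2)" and ?h = "height_form Y n V i u"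
  have q0: "1 - ?c\<^sup>2 \<noteq> 0" using angle_square[OF assms] by simp
  have q: "?q = of_real (1 - ?c) * of_real (1 + ?c)" by (simp add: power2_eq_square algebra_simps)
  have "?q * G u = of_real (1 + ?c) * (of_real (1 - ?c) * G u)" unfolding q by (simp only: mult_ac)
  then have qG: "?q * G u = of_real (1 + ?c) * Complex ?a ?b" unfolding stereographic_eq[OF assms] .
  have "?q * inverse (G u) = of_real (1 - ?c) * (of_real (1 + ?c) * inverse (G u))" unfolding q
    by (simp only: mult_ac)
  then have qG': "?q * inverse (G u) = of_real (1 - ?c) * Complex ?a (- ?b)"
    unfolding inverse_stereographic_eq[OF assms] .
  have tang: "?a * (?w \<bullet> e1) + ?b * (?w \<bullet> e2) + ?c * (?w \<bullet> V) = 0"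
    using inner_expand[of "n u" ?w] normal[OF assms] by simp
  have sq: "1 - ?c\<^sup>2 = ?a * ?a + ?b * ?b" using normal_components[OF assms]
    by (simp add: power2_eq_square)
  have scale: "r * Re (k * (x - y) * z) = Re (k * (of_real r * x - of_real r * y) * z)"
    "r * Re (k * (x + y) * z) = Re (k * (of_real r * x + of_real r * y) * z)" for r k x y z
    by (simp_all add: algebra_simps)
  have m: "1/2 * (of_real (1 - c) * Complex a (- b) - of_real (1 + c) * Complex a b)
      = Complex (- (c * a)) (- b)"
    "\<i>/2 * (of_real (1 - c) * Complex a (- b) + of_real (1 + c) * Complex a b)
        = Complex (- (c * b)) a" for a b c
    by (simp_all add: complex_eq_iff field_simps)
  have "(1 - ?c\<^sup>2) * Re (1/2 * (inverse (G u) - G u) * ?h)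
      = Re (1/2 * (?q * inverse (G u) - ?q * G u) * ?h)"
    by (rule scale)
  also have "\<dots> = - ?c * ?a * (?w \<bullet> V) - ?b * (?a * (?w \<bullet> e2) - ?b * (?w \<bullet> e1))"
    unfolding qG qG' m height_form_def cross_dot_V by (simp add: right_diff_distrib)
  also have "\<dots> = (1 - ?c\<^sup>2) * (?w \<bullet> e1)"
    unfolding sq using tang by algebra
  finally show "Re (1/2 * (inverse (G u) - G u) * ?h) = ?w \<bullet> e1" using q0 by simp
  have "(1 - ?c\<^sup>2) * Re (\<i>/2 * (inverse (G u) + G u) * ?h)
      = Re (\<i>/2 * (?q * inverse (G u) + ?q * G u) * ?h)"
    by (rule scale)
  also have "\<dots> = - ?c * ?b * (?w \<bullet> V) + ?a * (?a * (?w \<bullet> e2) - ?b * (?w \<bullet> e1))"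
    unfolding qG qG' m height_form_def cross_dot_V by (simp add: right_diff_distrib)
  also have "\<dots> = (1 - ?c\<^sup>2) * (?w \<bullet> e2)"
    unfolding sq using tang by algebra
  finally show "Re (\<i>/2 * (inverse (G u) + G u) * ?h) = ?w \<bullet> e2" using q0 by simp
  show "Re ?h = ?w \<bullet> V" by (simp add: height_form_def)
qed

end

section \<open>Charts\<close>

lemma chart_open:
  assumes "oriented_surface M A" "(D, x) \<in> A"
  shows "open D" "inj_on x D" "openin M (x ` D)" "continuous_map (top_of_set D) M x"
    and "\<And>B. open B \<Longrightarrow> B \<subseteq> D \<Longrightarrow> openin M (x ` B)"
proof -
  have *: "open D" "openin M (x ` D)" "homeomorphic_map (top_of_set D) (subtopology M (x ` D)) x"
    using assms unfolding oriented_surface_def by auto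
  show "open D" "openin M (x ` D)" by fact+
  show "inj_on x D"
    using homeomorphic_imp_injective_map[OF *(3)] by simp
  show "continuous_map (top_of_set D) M x"
    by (rule continuous_map_into_fulltopology[OF homeomorphic_imp_continuous_map[OF *(3)]])
  fix B assume B: "open B" "B \<subseteq> D"
  have "openin (subtopology M (x ` D)) (x ` B)"
    using homeomorphic_imp_open_map[OF *(3)] open_subset[OF B(2,1)] unfolding open_map_def by blast
  then show "openin M (x ` B)"
    using *(2) by (simp add: openin_open_subtopology)
qed

lemma chart_transition:
  assumes "oriented_surface M A" "(D, x) \<in> A" "(E, y) \<in> A"
  defines "W \<equiv> {u \<in> D. x u \<in> y ` E}" and "\<tau> \<equiv> inv_into E y \<circ> x"
  shows "open W" "smooth_on W \<tau>" "\<And>u. u \<in> W \<Longrightarrow> \<tau> u \<in> E" "\<And>u. u \<in> W \<Longrightarrow> y (\<tau> u) = x u"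
proof -
  have "openin (top_of_set D) {u \<in> topspace (top_of_set D). x u \<in> y ` E}"
    using chart_open(4)[OF assms(1,2)] chart_open(3)[OF assms(1,3)]
      by (rule openin_continuous_map_preimage)
  then have "openin (top_of_set D) W" unfolding W_def by simp
  then show "open W"
    using chart_open(1)[OF assms(1,2)] openin_open_trans by blast
  show "smooth_on W \<tau>"
    using assms(1-3) unfolding oriented_surface_def W_def \<tau>_def Let_def by auto
  show "\<tau> u \<in> E" "y (\<tau> u) = x u" if "u \<in> W" for u
    using that by (auto simp: W_def \<tau>_def inv_into_into f_inv_into_f)
qed

lemma chart_covers:
  assumes "oriented_surface M A" "p \<in> topspace M"
  obtains D x u where "(D, x) \<in> A" "u \<in> D" "x u = p"
proof -
  from assms have "p \<in> (\<Union>(D,x)\<in>A. x ` D)"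
    unfolding oriented_surface_def by blast
  then show thesis using that by blast
qed

lemma chart_in_topspace: "oriented_surface M A \<Longrightarrow> (D, x) \<in> A \<Longrightarrow> u \<in> D \<Longrightarrow> x u \<in> topspace M"
  unfolding oriented_surface_def by auto

lemma param_at_covers:
  assumes "oriented_surface M A" "p \<in> topspace M" "param_at A p = (D, x)"
  shows "(D, x) \<in> A" "inv_into D x p \<in> D" "x (inv_into D x p) = p"
proof -
  obtain D' x' u where "(D', x') \<in> A" "u \<in> D'" "x' u = p"
    by (rule chart_covers[OF assms(1,2)])
  then have "case (D', x') of (D, x) \<Rightarrow> (D, x) \<in> A \<and> p \<in> x ` D" by auto
  then have "case param_at A p of (D, x) \<Rightarrow> (D, x) \<in> A \<and> p \<in> x ` D"
    unfolding param_at_def by (rule someI)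
  then have "(D, x) \<in> A" "p \<in> x ` D" using assms(3) by auto
  then show "(D, x) \<in> A" "inv_into D x p \<in> D" "x (inv_into D x p) = p"
    by (auto simp: inv_into_into f_inv_into_f)
qed

lemma connected_space_propagate:
  assumes "connected_space M"
    and loc: "\<And>p. p \<in> topspace M \<Longrightarrow> \<exists>U. openin M U \<and> p \<in> U \<and> (\<forall>q\<in>U. \<forall>q'\<in>U. R q \<longrightarrow> R q')"
    and "p0 \<in> topspace M" "R p0" "p \<in> topspace M"
  shows "R p"
proof -
  let ?T = "{p \<in> topspace M. R p}"
  have "openin M ?T"
  proof (subst openin_subopen, intro ballI)
    fix q assume q: "q \<in> ?T"
    then obtain U where "openin M U" "q \<in> U" "\<forall>q\<in>U. \<forall>q'\<in>U. R q \<longrightarrow> R q'"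
      using loc[of q] by auto
    then show "\<exists>U. openin M U \<and> q \<in> U \<and> U \<subseteq> ?T"
      using q openin_subset by (intro exI[of _ U]) blast
  qed
  moreover have "openin M (topspace M - ?T)"
  proof (subst openin_subopen, intro ballI)
    fix q assume q: "q \<in> topspace M - ?T"
    then obtain U where "openin M U" "q \<in> U" "\<forall>q\<in>U. \<forall>q'\<in>U. R q \<longrightarrow> R q'"
      using loc[of q] by auto
    then show "\<exists>U. openin M U \<and> q \<in> U \<and> U \<subseteq> topspace M - ?T"
      using q openin_subset by (intro exI[of _ U]) blast
  qed
  then have "closedin M ?T" by (auto simp: closedin_def)
  ultimately have "?T = {} \<or> ?T = topspace M"
    using assms(1) unfolding connected_space_clopen_in by blast
  then show ?thesis using assms(3-5) by blast
qed

subsection \<open>Invariance under change of coordinates\<close>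

locale patch_change =
  source: surface_patch D Y n + target: surface_patch E Y' n'
  for D Y n E Y' n' +
  fixes W :: "(real^2) set" and \<tau> :: "real^2 \<Rightarrow> real^2"
  assumes open_W: "open W" and W_sub: "W \<subseteq> D" and smooth_change: "smooth_on W \<tau>"
    and maps: "\<And>u. u \<in> W \<Longrightarrow> \<tau> u \<in> E"
    and Y_change: "\<And>u. u \<in> W \<Longrightarrow> Y u = Y' (\<tau> u)" and n_change: "\<And>u. u \<in> W \<Longrightarrow> n u = n' (\<tau> u)"
begin

lemma partial_change:
  assumes "u \<in> W"
  shows "partial i Y u = (partial i \<tau> u $ 1) *\<^sub>R partial 1 Y' (\<tau> u)
      + (partial i \<tau> u $ 2) *\<^sub>R partial 2 Y' (\<tau> u)"
    and "partial i n u = (partial i \<tau> u $ 1) *\<^sub>R partial 1 n' (\<tau> u)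
        + (partial i \<tau> u $ 2) *\<^sub>R partial 2 n' (\<tau> u)"
proof -
  have t: "\<tau> differentiable (at u)"
    by (rule smooth_on_differentiable[OF smooth_change assms])
  have "partial i Y u = partial i (\<lambda>u. Y' (\<tau> u)) u"
    by (rule partial_cong_open[OF open_W assms Y_change])
  also have "\<dots> = (partial i \<tau> u $ 1) *\<^sub>R partial 1 Y' (\<tau> u)
      + (partial i \<tau> u $ 2) *\<^sub>R partial 2 Y' (\<tau> u)"
    by (rule partial_compose_plane[OF smooth_on_differentiable[OF target.smooth_Y maps[OF assms]] t])
  finally show "partial i Y u = (partial i \<tau> u $ 1) *\<^sub>R partial 1 Y' (\<tau> u)
      + (partial i \<tau> u $ 2) *\<^sub>R partial 2 Y' (\<tau> u)" .
  have "partial i n u = partial i (\<lambda>u. n' (\<tau> u)) u"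
    by (rule partial_cong_open[OF open_W assms n_change])
  also have "\<dots> = (partial i \<tau> u $ 1) *\<^sub>R partial 1 n' (\<tau> u)
      + (partial i \<tau> u $ 2) *\<^sub>R partial 2 n' (\<tau> u)"
    by (rule partial_compose_plane[OF smooth_on_differentiable[OF target.smooth_n maps[OF assms]] t])
  finally show "partial i n u = (partial i \<tau> u $ 1) *\<^sub>R partial 1 n' (\<tau> u)
      + (partial i \<tau> u $ 2) *\<^sub>R partial 2 n' (\<tau> u)" .
qed

text \<open>Both sides of \<open>curvature_normal_cross\<close> are multiplied by the Jacobian determinant.\<close>

lemma metric_curvature_change:
  assumes "u \<in> W"
  shows "metric_curvature (induced_metric Y) u = metric_curvature (induced_metric Y') (\<tau> u)"
proof -
  let ?k = "metric_curvature (induced_metric Y') (\<tau> u)"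
  let ?d = "partial 1 \<tau> u $ 1 * partial 2 \<tau> u $ 2 - partial 1 \<tau> u $ 2 * partial 2 \<tau> u $ 1"
  have cross: "(a *\<^sub>R p + b *\<^sub>R q) \<times> (c *\<^sub>R p + d *\<^sub>R q) = (a * d - b * c) *\<^sub>R (p \<times> q)"
    for a b c d and p q :: "real^3"
    using cross_skew[of q p]
    by (simp add: cross_add_left cross_add_right cross_mult_left cross_mult_right algebra_simps)
  have "partial 1 n' (\<tau> u) \<times> partial 2 n' (\<tau> u) = ?k *\<^sub>R (partial 1 Y' (\<tau> u) \<times> partial 2 Y' (\<tau> u))"
    using target.curvature_normal_cross[OF maps[OF assms]] by blast
  then have "partial 1 n u \<times> partial 2 n u = ?k *\<^sub>R (partial 1 Y u \<times> partial 2 Y u)"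
    unfolding partial_change[OF assms] cross by simp
  then show ?thesis
    using source.curvature_normal_cross W_sub assms by blast
qed

lemma height_form_change:
  assumes "u \<in> W"
  shows "height_form Y n V i u = of_real (partial i \<tau> u $ 1) * height_form Y' n' V 1 (\<tau> u)
    + of_real (partial i \<tau> u $ 2) * height_form Y' n' V 2 (\<tau> u)"
  unfolding height_form_def partial_change[OF assms] n_change[OF assms]
  by (simp add: complex_eq_iff inner_add_left cross_add_right cross_mult_right algebra_simps)

lemma gauss_form_change:
  assumes "u \<in> W"
  shows "gauss_form n V i u = of_real (partial i \<tau> u $ 1) * gauss_form n' V 1 (\<tau> u)
    + of_real (partial i \<tau> u $ 2) * gauss_form n' V 2 (\<tau> u)"
  unfolding gauss_form_def partial_change[OF assms] n_change[OF assms] times_divide_eq_right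
      add_divide_distrib[symmetric]
  by (rule arg_cong[where f = "\<lambda>z. z / _"])
     (simp add: complex_eq_iff inner_add_left cross_add_right cross_mult_right algebra_simps)

text \<open>Numerator and denominator both transform as one-forms.\<close>

lemma form_quotient_change:
  assumes "minimal_patch D Y n V" "minimal_patch E Y' n' V" "u \<in> W"
  shows "form_quotient Y n V u = form_quotient Y' n' V (\<tau> u)"
proof -
  interpret s: minimal_patch D Y n V by fact
  interpret t: minimal_patch E Y' n' V by fact
  have "height_form Y n V 1 u = form_quotient Y' n' V (\<tau> u) * gauss_form n V 1 u"
    unfolding height_form_change[OF assms(3)] gauss_form_change[OF assms(3)] t.height_form_eq[OF
        maps[OF assms(3)]]
    by (simp add: algebra_simps)
  then show ?thesis
    using s.gauss_form_nonzero[of u] W_sub assms(3) by (auto simp: form_quotient_def[of Y])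
qed

end

lemma metric_laplacian_cong:
  assumes "open D" "u \<in> D" "\<And>v. v \<in> D \<Longrightarrow> f v = h v"
  shows "metric_laplacian m f u = metric_laplacian m h u"
proof -
  have "partial j f v = partial j h v" if "v \<in> D" for v j
    by (rule partial_cong_open[OF assms(1) that assms(3)])
  then have "partial i (\<lambda>v. sqrt (det (m v)) * (\<Sum>j\<in>UNIV. matrix_inv (m v) $ i $ j * partial j f v)) u
     = partial i (\<lambda>v. sqrt (det (m v)) * (\<Sum>j\<in>UNIV. matrix_inv (m v) $ i $ j * partial j h v)) u" for i
    by (intro partial_cong_open[OF assms(1,2)]) simp
  then show ?thesis unfolding metric_laplacian_def by simp
qed

section \<open>Minimal surfaces with a direction\<close>

lemma surface_patch_chart:
  assumes "oriented_surface M A" "immersion A X" "unit_normal A X N" "(D, x) \<in> A"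
  shows "surface_patch D (X \<circ> x) (N \<circ> x)"
  using assms chart_open(1)[OF assms(1,4)]
  unfolding immersion_def unit_normal_def smooth_map_def by unfold_locales auto

lemma patch_change_charts:
  assumes "oriented_surface M A" "immersion A X" "unit_normal A X N" "(D, x) \<in> A" "(E, y) \<in> A"
  shows "patch_change D (X \<circ> x) (N \<circ> x) E (X \<circ> y) (N \<circ> y) {u \<in> D. x u \<in> y ` E} (inv_into E y \<circ> x)"
proof (intro patch_change.intro patch_change_axioms.intro)
  show "surface_patch D (X \<circ> x) (N \<circ> x)" "surface_patch E (X \<circ> y) (N \<circ> y)"
    by (rule surface_patch_chart[OF assms(1-3)]; fact)+
qed (use chart_transition[OF assms(1,4,5)] in auto)

text \<open>\<^const>\<open>gauss_curvature\<close> uses an arbitrarily chosen chart around the point; by invariance any other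
  chart gives the same value.\<close>

lemma gauss_curvature_chart:
  assumes "oriented_surface M A" "immersion A X" "unit_normal A X N" "(D, x) \<in> A" "u \<in> D"
  shows "gauss_curvature A X (x u) = metric_curvature (induced_metric (X \<circ> x)) u"
proof -
  obtain E y where Ey: "param_at A (x u) = (E, y)" by fastforce
  note p = param_at_covers[OF assms(1) chart_in_topspace[OF assms(1,4,5)] Ey]
  interpret patch_change D "X \<circ> x" "N \<circ> x" E "X \<circ> y" "N \<circ> y" "{u \<in> D. x u \<in> y ` E}" "inv_into E y \<circ> x"
    by (rule patch_change_charts[OF assms(1-4) p(1)])
  have "x u \<in> y ` E" using p(2,3) by (metis imageI)
  then show ?thesis
    using metric_curvature_change[of u] assms(5) by (simp add: gauss_curvature_def Ey)
qed

locale directed_minimal_surface =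
  fixes M :: "'a topology" and A :: "'a parametrization set" and X N :: "'a \<Rightarrow> real^3"
      and V :: "real^3"
  assumes admissible: "CR2_admissible M A X N V"
begin

lemma surface_oriented: "oriented_surface M A" and surface_connected: "connected_space M"
  and surface_immersion: "immersion A X" and surface_normal: "unit_normal A X N"
  using admissible unfolding CR2_admissible_def minimal_surface_def by auto

lemma minimal_patch_chart:
  assumes "(D, x) \<in> A"
  shows "minimal_patch D (X \<circ> x) (N \<circ> x) V"
proof -
  interpret surface_patch D "X \<circ> x" "N \<circ> x"
    by (rule surface_patch_chart[OF surface_oriented surface_immersion surface_normal assms])
  show ?thesis
  proof
    fix u assume u: "u \<in> D"
    have p: "x u \<in> topspace M" by (rule chart_in_topspace[OF surface_oriented assms u])
    show "mean_curvature (X \<circ> x) (N \<circ> x) u = 0"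
      using admissible assms u unfolding CR2_admissible_def minimal_surface_def by auto
    show "metric_curvature (induced_metric (X \<circ> x)) u < 0"
      using admissible p gauss_curvature_chart[OF surface_oriented surface_immersion surface_normal
          assms u]
      unfolding CR2_admissible_def by auto
    show "-1 < (N \<circ> x) u \<bullet> V \<and> (N \<circ> x) u \<bullet> V < 1"
      using admissible p unfolding CR2_admissible_def angle_function_def by auto
  qed (use admissible in \<open>simp add: CR2_admissible_def\<close>)
qed

lemma CR2_chart:
  assumes "(D, x) \<in> A" "u \<in> D"
  shows "CR2 A X N V (x u) = ln (norm (form_quotient (X \<circ> x) (N \<circ> x) V u))"
proof -
  interpret minimal_patch D "X \<circ> x" "N \<circ> x" V by (rule minimal_patch_chart[OF assms(1)])
  show ?thesis
    using quotient_norm[OF assms(2)] gauss_curvature_chart[OF surface_oriented surface_immersion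
        surface_normal assms]
    by (simp add: CR2_def angle_function_def)
qed

lemma smooth_CR2: "smooth_map A (CR2 A X N V)"
  unfolding smooth_map_def
proof (clarify)
  fix D x assume x: "(D, x) \<in> A"
  interpret minimal_patch D "X \<circ> x" "N \<circ> x" V by (rule minimal_patch_chart[OF x])
  have pos: "(Re (Q u))\<^sup>2 + (Im (Q u))\<^sup>2 > 0" if "u \<in> D" for u
    using quotient_nonzero[OF that] by (simp add: cmod_power2[symmetric])
  have eq: "(CR2 A X N V \<circ> x) u = 1/2 * ln ((Re (Q u))\<^sup>2 + (Im (Q u))\<^sup>2)" if "u \<in> D" for u
    unfolding comp_apply CR2_chart[OF x that] cmod_def using pos[OF that] by (simp add: ln_sqrt)
  have "smooth_on D (\<lambda>u. 1/2 * ln ((Re (Q u))\<^sup>2 + (Im (Q u))\<^sup>2))"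
    by (intro smooth_on_ln smooth_intros open_D smooth_quotient pos)
  then show "smooth_on D (CR2 A X N V \<circ> x)"
    by (simp add: smooth_on_cong[where f = "CR2 A X N V \<circ> x", OF open_D eq])
qed

lemma laplace_CR2:
  assumes "p \<in> topspace M"
  shows "laplace_beltrami A X (CR2 A X N V) p = 0"
proof -
  obtain D x where Dx: "param_at A p = (D, x)" by fastforce
  note p = param_at_covers[OF surface_oriented assms Dx]
  interpret minimal_patch D "X \<circ> x" "N \<circ> x" V by (rule minimal_patch_chart[OF p(1)])
  have "metric_laplacian g (CR2 A X N V \<circ> x) (inv_into D x p)
      = metric_laplacian g (\<lambda>v. ln (norm (Q v))) (inv_into D x p)"
    by (rule metric_laplacian_cong[OF open_D p(2)]) (simp add: CR2_chart[OF p(1)])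
  also have "\<dots> = 0"
    by (rule ln_norm_harmonic[OF p(2) smooth_quotient quotient_nonzero quotient_holomorphic])
  finally show ?thesis by (simp add: laplace_beltrami_def Dx)
qed

lemma CR2_harmonic: "harmonic M A X (CR2 A X N V)"
  unfolding harmonic_def using smooth_CR2 laplace_CR2 by blast

end

lemma constant_on_ball_if_partials_vanish:
  fixes f :: "real^2 \<Rightarrow> 'b::real_normed_vector"
  assumes "\<And>u. u \<in> ball c r \<Longrightarrow> f differentiable (at u)"
    and "\<And>u i. u \<in> ball c r \<Longrightarrow> partial i f u = 0" "u \<in> ball c r" "v \<in> ball c r"
  shows "f u = f v"
proof -
  have "(f has_derivative (\<lambda>h. 0)) (at w within ball c r)" if "w \<in> ball c r" for w
    using has_derivative_partial[OF assms(1)[OF that]] assms(2)[OF that]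
    by (simp add: has_derivative_at_withinI)
  from has_derivative_zero_constant[OF convex_ball this] show ?thesis
    using assms(3,4) by metis
qed

context directed_minimal_surface
begin

lemma form_quotient_overlap:
  assumes "(D, x) \<in> A" "(E, y) \<in> A" "u \<in> D" "v \<in> E" "x u = y v"
  shows "form_quotient (X \<circ> x) (N \<circ> x) V u = form_quotient (X \<circ> y) (N \<circ> y) V v"
proof -
  interpret patch_change D "X \<circ> x" "N \<circ> x" E "X \<circ> y" "N \<circ> y" "{u \<in> D. x u \<in> y ` E}" "inv_into E y \<circ> x"
    by (rule patch_change_charts[OF surface_oriented surface_immersion surface_normal assms(1,2)])
  have "inv_into E y (y v) = v"
    using chart_open(2)[OF surface_oriented assms(2)] assms(4) by (rule inv_into_f_f)
  then show ?thesis
    using form_quotient_change[OF minimal_patch_chart minimal_patch_chart, OF assms(1,2), of u]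
        assms(3-5) by simp
qed

text \<open>A function of constant modulus that is holomorphic for \<open>J\<close> is locally constant, and the
  quotients computed in different charts agree on overlaps.\<close>

lemma form_quotient_constant:
  assumes "CR2 A X N V constant_on topspace M" "topspace M \<noteq> {}"
  obtains k where "k \<noteq> 0" "\<And>D x u. (D, x) \<in> A \<Longrightarrow> u \<in> D \<Longrightarrow> form_quotient (X \<circ> x) (N \<circ> x) V u = k"
proof -
  obtain c where c: "\<And>p. p \<in> topspace M \<Longrightarrow> CR2 A X N V p = c"
    using assms(1) unfolding constant_on_def by blast
  obtain p0 where p0: "p0 \<in> topspace M" using assms(2) by blast
  obtain D0 x0 u0 where 0: "(D0, x0) \<in> A" "u0 \<in> D0" "x0 u0 = p0"
    by (rule chart_covers[OF surface_oriented p0])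
  define k where "k = form_quotient (X \<circ> x0) (N \<circ> x0) V u0"
  define R where "R p \<longleftrightarrow> (\<forall>(D,x)\<in>A. \<forall>u\<in>D. x u = p \<longrightarrow> form_quotient (X \<circ> x) (N \<circ> x) V u = k)" for p
  have "R p0"
    unfolding R_def k_def using form_quotient_overlap[OF _ 0(1) _ 0(2)] 0(3) by auto
  have "R p" if "p \<in> topspace M" for p
  proof (rule connected_space_propagate[where R = R, OF surface_connected _ p0 \<open>R p0\<close> that])
    fix p assume p: "p \<in> topspace M"
    obtain D x u where x: "(D, x) \<in> A" "u \<in> D" "x u = p"
      by (rule chart_covers[OF surface_oriented p])
    interpret minimal_patch D "X \<circ> x" "N \<circ> x" V by (rule minimal_patch_chart[OF x(1)])
    have normQ: "norm (Q v) = exp c" if "v \<in> D" for v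
      using c[OF chart_in_topspace[OF surface_oriented x(1) that]] CR2_chart[OF x(1) that]
          quotient_nonzero[OF that]
      by (metis exp_ln zero_less_norm_iff)
    obtain r where r: "r > 0" "ball u r \<subseteq> D"
      using open_D x(2) by (meson openE)
    have in_D: "v \<in> D" if "v \<in> ball u r" for v using r(2) that by blast
    have const: "Q v = Q w" if "v \<in> ball u r" "w \<in> ball u r" for v w
      by (rule constant_on_ball_if_partials_vanish[OF smooth_on_differentiable[OF smooth_quotient
          in_D]
            quotient_partials_vanish[OF in_D normQ] that])
    have "R q'" if qs: "q \<in> x ` ball u r" "q' \<in> x ` ball u r" "R q" for q q'
    proof -
      obtain w w' where w: "w \<in> ball u r" "q = x w" "w' \<in> ball u r" "q' = x w'"
        using qs by blast
      have "Q w' = k"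
        using const[OF w(1,3)] qs(3) x(1) w(2) in_D[OF w(1)] unfolding R_def by auto
      then show ?thesis
        unfolding R_def using form_quotient_overlap[OF _ x(1) _ in_D[OF w(3)]] w(4) by auto
    qed
    moreover have "openin M (x ` ball u r)"
      by (rule chart_open(5)[OF surface_oriented x(1) open_ball r(2)])
    moreover have "p \<in> x ` ball u r" using x(3) r(1) by force
    ultimately show "\<exists>U. openin M U \<and> p \<in> U \<and> (\<forall>q\<in>U. \<forall>q'\<in>U. R q \<longrightarrow> R q')"
      by blast
  qed
  then have all: "form_quotient (X \<circ> x) (N \<circ> x) V u = k" if "(D, x) \<in> A" "u \<in> D" for D x u
    using chart_in_topspace[OF surface_oriented that] that unfolding R_def by fastforce
  have "k \<noteq> 0"
    unfolding k_def by (rule minimal_patch.quotient_nonzero[OF minimal_patch_chart[OF 0(1)] 0(2)])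
  with all show thesis by (rule_tac that)
qed

end

section \<open>The Weierstrass map\<close>

definition weierstrass_integrand :: "(complex \<Rightarrow> complex) \<Rightarrow> (complex \<Rightarrow> complex) \<Rightarrow> 3 \<Rightarrow> complex \<Rightarrow>
    complex" where
  "weierstrass_integrand G \<Psi> j z =
     (if j = 1 then 1/2 * (1 - (G z)\<^sup>2) * \<Psi> z else
         if j = 2 then \<i>/2 * (1 + (G z)\<^sup>2) * \<Psi> z else G z * \<Psi> z)"

lemma weierstrass_integrand_components:
  "weierstrass_integrand G \<Psi> 1 z = 1/2 * (1 - (G z)\<^sup>2) * \<Psi> z"
  "weierstrass_integrand G \<Psi> 2 z = \<i>/2 * (1 + (G z)\<^sup>2) * \<Psi> z"
  "weierstrass_integrand G \<Psi> 3 z = G z * \<Psi> z"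
  by (simp_all add: weierstrass_integrand_def)

lemma weierstrass_surface_primitive:
  assumes "\<And>z. (P has_field_derivative weierstrass_integrand G \<Psi> j z) (at z)"
  shows "weierstrass_surface G \<Psi> b z $ j = Re (P z - P b)"
proof -
  have "(weierstrass_integrand G \<Psi> j has_contour_integral (P z - P b)) (linepath b z)"
    using contour_integral_primitive[of UNIV P "weierstrass_integrand G \<Psi> j" "linepath b z"] assms
      by simp
  then have "contour_integral (linepath b z) (weierstrass_integrand G \<Psi> j) = P z - P b"
    by (rule contour_integral_unique)
  moreover have "weierstrass_surface G \<Psi> b z $ j
      = Re (contour_integral (linepath b z) (weierstrass_integrand G \<Psi> j))"
  proof -
    consider "j = 1" | "j = 2" | "j = 3" using exhaust_3 by blast
    then show ?thesis
      by cases (simp_all add: weierstrass_surface_def vector_3 weierstrass_integrand_def[abs_def])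
  qed
  ultimately show ?thesis by simp
qed

lemma weierstrass_integrand_holomorphic:
  "G holomorphic_on UNIV \<Longrightarrow> \<Psi> holomorphic_on UNIV \<Longrightarrow> weierstrass_integrand G \<Psi> j holomorphic_on UNIV"
  unfolding weierstrass_integrand_def[abs_def]
    by (cases "j = 1"; cases "j = 2") (auto intro!: holomorphic_intros)

lemma weierstrass_primitive_exists:
  assumes "G holomorphic_on UNIV" "\<Psi> holomorphic_on UNIV"
  obtains P where "\<And>j z. (P j has_field_derivative weierstrass_integrand G \<Psi> j z) (at z)"
    "\<And>b z. weierstrass_surface G \<Psi> b z = (\<chi> j. Re (P j z - P j b))"
proof -
  have "\<exists>p. \<forall>z. (p has_field_derivative weierstrass_integrand G \<Psi> j z) (at z)" for j
    using holomorphic_convex_primitive'[OF convex_UNIV open_UNIV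
        weierstrass_integrand_holomorphic[OF assms]]
    by (metis UNIV_I)
  then obtain P where P: "\<And>j z. (P j has_field_derivative weierstrass_integrand G \<Psi> j z) (at z)"
    by metis
  with weierstrass_surface_primitive[OF P] show thesis
    by (intro that[of P]) (simp_all add: vec_eq_iff)
qed

lemma has_derivative_vec_componentwise:
  fixes f :: "'b::real_normed_vector \<Rightarrow> real^'n"
  assumes "\<And>j. ((\<lambda>u. f u $ j) has_derivative (\<lambda>h. f' h $ j)) (at u)"
  shows "(f has_derivative f') (at u)"
proof -
  have "((\<lambda>u. \<Sum>j\<in>UNIV. (f u $ j) *\<^sub>R axis j 1) has_derivative (\<lambda>h. \<Sum>j\<in>UNIV. (f' h $ j) *\<^sub>R (axis j 1
      :: real^'n))) (at u)"
    by (intro has_derivative_sum bounded_linear.has_derivative[OF bounded_linear_scaleR_left] assms)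
  moreover have "(\<Sum>j\<in>UNIV. (w $ j) *\<^sub>R axis j 1) = w" for w :: "real^'n"
    by (simp add: vec_eq_iff axis_def if_distrib cong: if_cong)
  ultimately show ?thesis by simp
qed

lemma weierstrass_surface_has_derivative:
  assumes "G holomorphic_on UNIV" "\<Psi> holomorphic_on UNIV"
  shows "(weierstrass_surface G \<Psi> b has_derivative (\<lambda>h. \<chi> j. Re (weierstrass_integrand G \<Psi> j z *
      h))) (at z)"
proof -
  obtain P where P: "\<And>j z. (P j has_field_derivative weierstrass_integrand G \<Psi> j z) (at z)"
    "\<And>b z. weierstrass_surface G \<Psi> b z = (\<chi> j. Re (P j z - P j b))"
    using weierstrass_primitive_exists[OF assms] by blast
  have "((\<lambda>z. P j z - P j b) has_derivative (\<lambda>h. weierstrass_integrand G \<Psi> j z * h)) (at z)" for j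
    using has_derivative_diff[OF P(1)[unfolded has_field_derivative_def] has_derivative_const] by simp
  from bounded_linear.has_derivative[OF bounded_linear_Re this] show ?thesis
    unfolding P(2) by (intro has_derivative_vec_componentwise) (simp only: vec_lambda_beta)
qed

section \<open>Recovering the surface\<close>

definition frame_motion :: "real^3 \<Rightarrow> real^3 \<Rightarrow> real^3 \<Rightarrow> real^3 \<Rightarrow> real^3 \<Rightarrow> real^3" where
  "frame_motion t e1 e2 V q = t + q$1 *\<^sub>R e1 + q$2 *\<^sub>R e2 + q$3 *\<^sub>R V"

lemma (in positive_frame) frame_motion_isometry: "euclidean_isometry (frame_motion t e1 e2 V)"
  unfolding euclidean_isometry_def
proof (intro allI)
  fix p q :: "real^3"
  have o: "e1 \<bullet> V = 0" "e2 \<bullet> V = 0"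
    unfolding cross[symmetric] by (simp_all add: dot_cross_self)
  have "frame_motion t e1 e2 V p - frame_motion t e1 e2 V q
      = (p - q)$1 *\<^sub>R e1 + (p - q)$2 *\<^sub>R e2 + (p - q)$3 *\<^sub>R V"
    by (simp add: frame_motion_def algebra_simps)
  moreover have "(a *\<^sub>R e1 + b *\<^sub>R e2 + c *\<^sub>R V) \<bullet> (a *\<^sub>R e1 + b *\<^sub>R e2 + c *\<^sub>R V)
      = a * a + b * b + c * c" for a b c
    by (simp add: inner_add_left inner_add_right unit_e1 unit_e2 unit_V orth o inner_commute[of e2 e1]
        inner_commute[of V e1] inner_commute[of V e2])
  ultimately show "dist (frame_motion t e1 e2 V p) (frame_motion t e1 e2 V q) = dist p q"
    unfolding dist_norm norm_eq_sqrt_inner inner_vec_def[of "p - q"] sum_3 by simp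
qed

lemma bounded_linear_complex_vector: "bounded_linear (\<lambda>z. vector [Re z, Im z] :: real^2)"
proof -
  have "bounded_linear (\<lambda>z. Re z *\<^sub>R axis 1 1 + Im z *\<^sub>R axis 2 1 :: real^2)"
    by (intro bounded_linear_add bounded_linear_compose[OF bounded_linear_scaleR_left]
        bounded_linear_Re bounded_linear_Im)
  moreover have "(\<lambda>z. Re z *\<^sub>R axis 1 1 + Im z *\<^sub>R axis 2 1 :: real^2) = (\<lambda>z. vector [Re z, Im z])"
    by (simp add: fun_eq_iff vec_eq_iff forall_2 axis_def vector_2)
  ultimately show ?thesis by simp
qed

context framed_minimal_patch
begin

text \<open>Since the curvature does not vanish, a logarithm of the stereographic projection of the Gauss
  map is a local coordinate.\<close>

lemma logarithmic_coordinate: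
  assumes u0: "u0 \<in> D" and \<alpha>: "\<alpha> \<noteq> 0"
  obtains r \<zeta> h where "r > 0" "ball u0 r \<subseteq> D" "smooth_on (ball u0 r) \<zeta>"
    "open (\<zeta> ` ball u0 r)" "smooth_on (\<zeta> ` ball u0 r) h" "\<And>w. w \<in> ball u0 r \<Longrightarrow> h (\<zeta> w) = w"
    "\<And>w. w \<in> ball u0 r \<Longrightarrow> exp (\<alpha> * \<zeta> w) = G w"
    "\<And>w i. w \<in> ball u0 r \<Longrightarrow> \<alpha> * partial i \<zeta> w = gauss_form n V i w"
proof -
  let ?v = "\<lambda>z. vector [Re z, Im z] :: real^2"
  define B where "B = D \<inter> (\<lambda>u. G u / G u0) -` (- \<real>\<^sub>\<le>\<^sub>0)"
  \<comment> \<open>a branch of \<open>ln G / \<alpha>\<close> whose cut avoids the values near \<open>u0\<close>\<close>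
  define \<zeta> where "\<zeta> u = (Ln (G u0) + Ln (G u / G u0)) / \<alpha>" for u
  have G0: "G u0 \<noteq> 0" by (rule stereographic_nonzero[OF u0])
  have q: "smooth_on D (\<lambda>u. G u / G u0)"
    by (intro smooth_on_divide_complex open_D smooth_stereographic smooth_on_const G0)
  have "open B"
    unfolding B_def
    by (rule continuous_open_preimage[OF smooth_on_continuous[OF q] open_D])
       (simp add: closed_nonpos_Reals_complex open_Compl)
  have "B \<subseteq> D" "u0 \<in> B" using u0 G0 by (auto simp: B_def)
  have smooth: "smooth_on B \<zeta>"
    unfolding \<zeta>_def
    by (intro smooth_on_divide_complex smooth_on_add smooth_on_const \<open>open B\<close> \<alpha>
        smooth_on_holomorphic_compose[OF \<open>open B\<close>, of "- \<real>\<^sub>\<le>\<^sub>0" Ln] smooth_on_subset[OF q \<open>B \<subseteq> D\<close>])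
       (auto simp: B_def closed_nonpos_Reals_complex open_Compl intro: holomorphic_intros)
  have exp: "exp (\<alpha> * \<zeta> u) = G u" if "u \<in> B" for u
    using \<alpha> G0 stereographic_nonzero[of u] that by (simp add: \<zeta>_def exp_add B_def)
  have d: "\<alpha> * partial i \<zeta> u = gauss_form n V i u" if "u \<in> B" for u i
  proof -
    have u: "u \<in> D" using that \<open>B \<subseteq> D\<close> by blast
    have "((\<lambda>z. exp (\<alpha> * z)) has_field_derivative \<alpha> * exp (\<alpha> * \<zeta> u)) (at (\<zeta> u))"
      by (auto intro!: derivative_eq_intros)
    from partial_field_compose[OF this smooth_on_differentiable[OF smooth that], of i]
    have "partial i (\<lambda>u. exp (\<alpha> * \<zeta> u)) u = \<alpha> * G u * partial i \<zeta> u"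
      by (simp add: exp[OF that])
    moreover have "partial i (\<lambda>u. exp (\<alpha> * \<zeta> u)) u = partial i G u"
      by (rule partial_cong_open[OF \<open>open B\<close> that exp])
    ultimately have "G u * (\<alpha> * partial i \<zeta> u) = G u * gauss_form n V i u"
      unfolding partial_stereographic[OF u] by (simp only: mult_ac)
    then show ?thesis using stereographic_nonzero[OF u] by simp
  qed
  let ?f = "\<lambda>u. ?v (\<zeta> u)"
  have smooth_f: "smooth_on B ?f"
    by (rule smooth_on_compose_linear[OF bounded_linear_complex_vector \<open>open B\<close> smooth])
  have fd: "\<zeta> differentiable (at u0)" by (rule smooth_on_differentiable[OF smooth \<open>u0 \<in> B\<close>])
  have inj: "inj (frechet_derivative ?f (at u0))"
    unfolding linear_injective_0[OF has_derivative_linear[OF smooth_on_has_derivative[OF smooth_f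
        \<open>u0 \<in> B\<close>]]]
  proof (intro allI impI)
    fix w :: "real^2" assume "frechet_derivative ?f (at u0) w = 0"
    then have "?v (w$1 *\<^sub>R partial 1 \<zeta> u0 + w$2 *\<^sub>R partial 2 \<zeta> u0) = 0"
      unfolding frechet_derivative_partial[OF smooth_on_differentiable[OF smooth_f \<open>u0 \<in> B\<close>]]
        partial_linear[OF bounded_linear_complex_vector fd]
      by (simp add: vec_eq_iff forall_2 vector_2)
    then have "w$1 *\<^sub>R partial 1 \<zeta> u0 + w$2 *\<^sub>R partial 2 \<zeta> u0 = 0"
      by (simp add: vec_eq_iff forall_2 vector_2 complex_eq_iff)
    then have "\<alpha> * (of_real (w$1) * partial 1 \<zeta> u0 + of_real (w$2) * partial 2 \<zeta> u0) = 0"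
      by (simp add: scaleR_conv_of_real)
    then have "of_real (w$1) * gauss_form n V 1 u0 + of_real (w$2) * gauss_form n V 2 u0 = 0"
      unfolding d[OF \<open>u0 \<in> B\<close>, symmetric] by (simp add: algebra_simps)
    then have "of_real (w$1) * (of_real (g u0 $ 1 $ 1) * gauss_form n V 1 u0)
       + of_real (w$2) * (of_real (g u0 $ 1 $ 1) * gauss_form n V 2 u0) = 0"
      by (metis (no_types, lifting) distrib_left mult.left_commute mult_zero_right)
    then have "(of_real (w$1) * of_real (g u0 $ 1 $ 1) + of_real (w$2) * (of_real (g u0 $ 1 $ 2)
        + \<i> * of_real (signed_area u0)))
        * gauss_form n V 1 u0 = 0"
      using gauss_form_complex_linear[OF u0] unfolding complex_linear_def by (simp add: algebra_simps)
    then have "complex_of_real (w$1) * of_real (g u0 $ 1 $ 1)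
        + of_real (w$2) * (of_real (g u0 $ 1 $ 2) + \<i> * of_real (signed_area u0)) = 0"
      using gauss_form_nonzero[OF u0] by simp
    then have "w$1 * g u0 $ 1 $ 1 + w$2 * g u0 $ 1 $ 2 = 0" "w$2 * signed_area u0 = 0"
      by (simp_all add: complex_eq_iff)
    then show "w = 0"
      using signed_area_nonzero[OF u0] metric_11_pos[OF u0] by (simp add: vec_eq_iff forall_2)
  qed
  obtain U V' k where U: "open U" "U \<subseteq> B" "u0 \<in> U" "open V'" "homeomorphism U V' ?f k" "smooth_on V'
      k"
    using plane_inverse_function[OF \<open>open B\<close> \<open>u0 \<in> B\<close> smooth_f inj] by blast
  obtain r where r: "r > 0" "ball u0 r \<subseteq> U" using U(1,3) by (meson openE)
  have "openin (top_of_set V') (?f ` ball u0 r)"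
    by (rule homeomorphism_imp_open_map[OF U(5)]) (use r in \<open>auto intro: open_subset\<close>)
  then have "open (?f ` ball u0 r)" using U(4) openin_open_trans by blast
  moreover have "\<zeta> ` ball u0 r = ?v -` (?f ` ball u0 r)"
    by (auto simp: vec_eq_iff forall_2 vector_2 complex_eq_iff image_iff)
  ultimately have op: "open (\<zeta> ` ball u0 r)"
    using open_vimage[OF _ linear_continuous_on[OF bounded_linear_complex_vector, of UNIV]] by simp
  have sub: "ball u0 r \<subseteq> B" using r U by blast
  show thesis
  proof
    show "r > 0" "ball u0 r \<subseteq> D" "open (\<zeta> ` ball u0 r)" using r sub \<open>B \<subseteq> D\<close> op by auto
    show "smooth_on (ball u0 r) \<zeta>" by (rule smooth_on_subset[OF smooth sub])
    show "smooth_on (\<zeta> ` ball u0 r) (\<lambda>z. k (?v z))"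
      by (rule smooth_on_compose[OF op U(4) _ smooth_on_linear[OF bounded_linear_complex_vector op]
          U(6)])
         (use r U(5) in \<open>auto simp: homeomorphism_def\<close>)
    show "k (?v (\<zeta> w)) = w" if "w \<in> ball u0 r" for w
      using homeomorphism_apply1[OF U(5)] r(2) that by blast
  qed (use exp d sub in blast)+
qed

end

lemma diffeo_to_plane_chart:
  assumes M: "oriented_surface M A" and Dx: "(D, x) \<in> A" and B: "open B" "B \<subseteq> D"
    and \<zeta>: "smooth_on B \<zeta>" "open (\<zeta> ` B)" and h: "smooth_on (\<zeta> ` B) h" "\<And>w. w \<in> B \<Longrightarrow> h (\<zeta> w) = w"
    and \<phi>: "\<And>w. w \<in> B \<Longrightarrow> \<phi> (x w) = \<zeta> w"
  shows "diffeo_to_plane A (x ` B) \<phi>"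
proof -
  have img: "\<phi> ` x ` B = \<zeta> ` B" using \<phi> by (simp add: image_image cong: image_cong)
  have inj: "inj_on \<phi> (x ` B)"
    by (rule inj_onI) (use \<phi> h(2) in \<open>metis imageE\<close>)
  have inv: "inv_into (x ` B) \<phi> z = x (h z)" if z: "z \<in> \<zeta> ` B" for z
  proof -
    obtain w where "w \<in> B" "z = \<zeta> w" using z by blast
    then show ?thesis using inv_into_f_f[OF inj, of "x w"] \<phi> h(2) by simp
  qed
  have hB: "h z \<in> B" if "z \<in> \<zeta> ` B" for z using that h(2) by auto
  have 1: "smooth_on {v \<in> E. y v \<in> x ` B} (\<phi> \<circ> y)" if Ey: "(E, y) \<in> A" for E y
  proof (rule smooth_on_local)
    fix v assume v: "v \<in> {v \<in> E. y v \<in> x ` B}"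
    let ?W = "{v \<in> E. y v \<in> x ` D}" and ?t = "inv_into D x \<circ> y"
    note t = chart_transition[OF M Ey Dx]
    define T where "T = ?W \<inter> ?t -` B"
    have T: "open T" unfolding T_def by (rule continuous_open_preimage[OF smooth_on_continuous[OF
        t(2)] t(1) B(1)])
    have "v \<in> ?W" using v B(2) by auto
    moreover have "?t v \<in> B"
    proof -
      obtain w where "w \<in> B" "y v = x w" using v by blast
      then show ?thesis using inv_into_f_f[OF chart_open(2)[OF M Dx]] B(2) by auto
    qed
    ultimately have "v \<in> T" by (simp add: T_def)
    have "(\<phi> \<circ> y) v' = \<zeta> (?t v')" if "v' \<in> T" for v'
      using that t(4)[of v'] \<phi>[of "?t v'"] by (auto simp: T_def)
    moreover have "smooth_on T (\<lambda>v. \<zeta> (?t v))"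
      by (rule smooth_on_compose[OF T B(1) _ smooth_on_subset[OF t(2)] \<zeta>(1)]) (auto simp: T_def)
    ultimately have "smooth_on T (\<phi> \<circ> y)"
      by (simp add: smooth_on_cong[OF T, of "\<phi> \<circ> y" "\<lambda>v. \<zeta> (?t v)"])
    with T \<open>v \<in> T\<close> show "\<exists>T. open T \<and> v \<in> T \<and> smooth_on T (\<phi> \<circ> y)" by blast
  qed
  have 2: "smooth_on {z \<in> \<phi> ` x ` B. inv_into (x ` B) \<phi> z \<in> y ` E} (inv_into E y \<circ> inv_into (x ` B)
      \<phi>)"
    if Ey: "(E, y) \<in> A" for E y
  proof (rule smooth_on_local)
    fix z assume z: "z \<in> {z \<in> \<phi> ` x ` B. inv_into (x ` B) \<phi> z \<in> y ` E}"
    let ?W = "{u \<in> D. x u \<in> y ` E}" and ?t = "inv_into E y \<circ> x"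
    note t = chart_transition[OF M Dx Ey]
    define T where "T = \<zeta> ` B \<inter> h -` ?W"
    have T: "open T" unfolding T_def by (rule continuous_open_preimage[OF smooth_on_continuous[OF
        h(1)] \<zeta>(2) t(1)])
    have "z \<in> T" using z inv hB B(2) unfolding img T_def by auto
    have "(inv_into E y \<circ> inv_into (x ` B) \<phi>) z' = ?t (h z')" if "z' \<in> T" for z'
      using that inv by (auto simp: T_def)
    moreover have "smooth_on T (\<lambda>z. ?t (h z))"
      by (rule smooth_on_compose[OF T t(1) _ smooth_on_subset[OF h(1)] t(2)]) (auto simp: T_def)
    ultimately have "smooth_on T (inv_into E y \<circ> inv_into (x ` B) \<phi>)"
      by (simp add: smooth_on_cong[OF T, of "inv_into E y \<circ> inv_into (x ` B) \<phi>" "\<lambda>z. ?t (h z)"])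
    with T \<open>z \<in> T\<close> show "\<exists>T. open T \<and> z \<in> T \<and> smooth_on T (inv_into E y \<circ> inv_into (x ` B) \<phi>)"
      by blast
  qed
  show ?thesis
    unfolding diffeo_to_plane_def using inj \<zeta>(2) 1 2 by (auto simp: img)
qed

text \<open>With the coordinate \<open>\<zeta> = ln G / \<alpha>\<close>, the differentials of \<open>X\<close> and of \<open>F \<circ> \<zeta>\<close> agree, so that a
  match at one point of \<open>U\<close>, for some branch of the logarithm, propagates to all of \<open>U\<close>. Including
  the Gauss map in \<open>R\<close> is what fixes the branch, and stating the result as propagation from an
  arbitrary point of \<open>U\<close> allows the same rigid motion to be used on the whole surface.\<close>

lemma (in directed_minimal_surface) representation_near_point:
  fixes t e1 e2 :: "real^3" and \<alpha> k :: complex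
  assumes frame: "positive_frame e1 e2 V" and \<alpha>: "\<alpha> \<noteq> 0" "\<alpha>\<^sup>2 * k = 1"
    and quotient: "\<And>D x u. (D, x) \<in> A \<Longrightarrow> u \<in> D \<Longrightarrow> form_quotient (X \<circ> x) (N \<circ> x) V u = k"
    and p: "p \<in> topspace M"
  defines "F \<equiv> \<lambda>z. frame_motion t e1 e2 V
      (weierstrass_surface (\<lambda>z. exp (\<alpha> * z)) (\<lambda>z. 1 / \<alpha> * exp (- \<alpha> * z)) 0 z)"
  defines "R \<equiv> \<lambda>q z. X q = F z \<and> exp (\<alpha> * z) = stereographic e1 e2 (N q)"
  shows "\<exists>U. openin M U \<and> p \<in> U \<and>
    (\<forall>q\<in>U. \<forall>z. R q z \<longrightarrow> (\<exists>\<phi>. diffeo_to_plane A U \<phi> \<and> (\<forall>q'\<in>U. R q' (\<phi> q'))))"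
proof -
  let ?g = "\<lambda>z. exp (\<alpha> * z)" and ?\<Psi> = "\<lambda>z. 1 / \<alpha> * exp (- \<alpha> * z)"
  obtain D x u0 where x: "(D, x) \<in> A" "u0 \<in> D" "x u0 = p"
    by (rule chart_covers[OF surface_oriented p])
  interpret minimal_patch D "X \<circ> x" "N \<circ> x" V by (rule minimal_patch_chart[OF x(1)])
  interpret positive_frame e1 e2 V by (rule frame)
  interpret framed_minimal_patch D "X \<circ> x" "N \<circ> x" V e1 e2 ..
  obtain r \<zeta> h where r: "r > 0" "ball u0 r \<subseteq> D" and \<zeta>: "smooth_on (ball u0 r) \<zeta>"
    "open (\<zeta> ` ball u0 r)" and h: "smooth_on (\<zeta> ` ball u0 r) h" "\<And>w. w \<in> ball u0 r \<Longrightarrow> h (\<zeta> w) = w"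
    and exp: "\<And>w. w \<in> ball u0 r \<Longrightarrow> exp (\<alpha> * \<zeta> w) = G w"
    and d\<zeta>: "\<And>w i. w \<in> ball u0 r \<Longrightarrow> \<alpha> * partial i \<zeta> w = gauss_form (N \<circ> x) V i w"
    using logarithmic_coordinate[OF x(2) \<alpha>(1)] by blast
  let ?B = "ball u0 r"
  have "\<exists>\<phi>. diffeo_to_plane A (x ` ?B) \<phi> \<and> (\<forall>q'\<in>x ` ?B. R q' (\<phi> q'))" if q: "q \<in> x ` ?B" "R q z"
      for q z
  proof -
    obtain w where w: "w \<in> ?B" "q = x w" using q(1) by blast
    \<comment> \<open>two logarithms of the Gauss map differ by a period\<close>
    have "exp (\<alpha> * z) = exp (\<alpha> * \<zeta> w)" using q(2) exp[OF w(1)] w(2) by (simp add: R_def)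
    then obtain m :: int where m: "\<alpha> * z = \<alpha> * \<zeta> w + of_int (2 * m) * (of_real pi * \<i>)"
      by (auto simp: exp_eq)
    define c where "c = z - \<zeta> w"
    have "\<alpha> * c = of_int (2 * m) * (of_real pi * \<i>)" using m by (simp add: c_def algebra_simps)
    then have "exp (\<alpha> * c) = 1" by (auto simp: exp_eq_1 intro!: exI[of _ m])
    then have exp': "exp (\<alpha> * (\<zeta> v + c)) = G v" if "v \<in> ?B" for v
      using exp[OF that] by (simp add: distrib_left exp_add)
    let ?\<zeta> = "\<lambda>v. \<zeta> v + c"
    have sm: "smooth_on ?B ?\<zeta>" by (intro smooth_on_add open_ball \<zeta>(1) smooth_on_const)
    have pd: "partial i ?\<zeta> v = partial i \<zeta> v" if "v \<in> ?B" for i v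
      using partial_add[OF smooth_on_differentiable[OF \<zeta>(1) that] differentiable_const]
        by (simp add: partial_const)
    have F': "(F has_derivative (\<lambda>s. Re (weierstrass_integrand ?g ?\<Psi> 1 z * s) *\<^sub>R e1
        + Re (weierstrass_integrand ?g ?\<Psi> 2 z * s) *\<^sub>R e2
            + Re (weierstrass_integrand ?g ?\<Psi> 3 z * s) *\<^sub>R V)) (at z)" for z
    proof -
      have "(weierstrass_surface ?g ?\<Psi> 0 has_derivative (\<lambda>h. \<chi> j. Re (weierstrass_integrand ?g ?\<Psi> j
          z * h))) (at z)"
        by (rule weierstrass_surface_has_derivative) (auto intro!: holomorphic_intros)
      then have "((\<lambda>z. weierstrass_surface ?g ?\<Psi> 0 z $ j) has_derivative (\<lambda>h. Re
          (weierstrass_integrand ?g ?\<Psi> j z * h))) (at z)" for j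
        using bounded_linear.has_derivative[OF bounded_linear_vec_nth] by fastforce
      then have "((\<lambda>z. t + weierstrass_surface ?g ?\<Psi> 0 z $ 1 *\<^sub>R e1
          + weierstrass_surface ?g ?\<Psi> 0 z $ 2 *\<^sub>R e2
          + weierstrass_surface ?g ?\<Psi> 0 z $ 3 *\<^sub>R V) has_derivative (\<lambda>s. 0
              + Re (weierstrass_integrand ?g ?\<Psi> 1 z * s) *\<^sub>R e1
        + Re (weierstrass_integrand ?g ?\<Psi> 2 z * s) *\<^sub>R e2
            + Re (weierstrass_integrand ?g ?\<Psi> 3 z * s) *\<^sub>R V)) (at z)"
        by (intro has_derivative_add has_derivative_const bounded_linear.has_derivative[OF
            bounded_linear_scaleR_left])
      then show ?thesis by (simp add: F_def frame_motion_def)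
    qed
    have same: "partial i (\<lambda>v. X (x v) - F (?\<zeta> v)) v = 0" if v: "v \<in> ?B" for i v
    proof -
      have vD: "v \<in> D" using v r(2) by blast
      have \<theta>: "\<alpha> * partial i ?\<zeta> v = gauss_form (N \<circ> x) V i v" using d\<zeta>[OF v] pd[OF v] by simp
      have "k * gauss_form (N \<circ> x) V i v = height_form (X \<circ> x) (N \<circ> x) V i v"
        using height_form_eq[OF vD] quotient[OF x(1) vD] by simp
      moreover have "1 / \<alpha> * partial i ?\<zeta> v = k * gauss_form (N \<circ> x) V i v"
        unfolding \<theta>[symmetric] using \<alpha> by (simp add: field_simps power2_eq_square)
      ultimately have \<eta>: "1 / \<alpha> * partial i ?\<zeta> v = height_form (X \<circ> x) (N \<circ> x) V i v" by simp
      have G0: "G v \<noteq> 0" by (rule stereographic_nonzero[OF vD])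
      have \<Psi>: "?\<Psi> (?\<zeta> v) = 1 / \<alpha> * inverse (G v)"
        using exp'[OF v] by (simp add: exp_minus)
      have "weierstrass_integrand ?g ?\<Psi> 1 (?\<zeta> v) * partial i ?\<zeta> v
          = 1/2 * ((1 - (G v)\<^sup>2) * inverse (G v)) * (1 / \<alpha> * partial i ?\<zeta> v)"
        unfolding weierstrass_integrand_components \<Psi> exp'[OF v] by (simp only: mult_ac)
      also have "(1 - (G v)\<^sup>2) * inverse (G v) = inverse (G v) - G v"
        using G0 by (simp add: field_simps power2_eq_square)
      finally have w1: "weierstrass_integrand ?g ?\<Psi> 1 (?\<zeta> v) * partial i ?\<zeta> v
          = 1/2 * (inverse (G v) - G v) * height_form (X \<circ> x) (N \<circ> x) V i v" unfolding \<eta> .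
      have "weierstrass_integrand ?g ?\<Psi> 2 (?\<zeta> v) * partial i ?\<zeta> v
          = \<i>/2 * ((1 + (G v)\<^sup>2) * inverse (G v)) * (1 / \<alpha> * partial i ?\<zeta> v)"
        unfolding weierstrass_integrand_components \<Psi> exp'[OF v] by (simp only: mult_ac)
      also have "(1 + (G v)\<^sup>2) * inverse (G v) = inverse (G v) + G v"
        using G0 by (simp add: field_simps power2_eq_square)
      finally have w2: "weierstrass_integrand ?g ?\<Psi> 2 (?\<zeta> v) * partial i ?\<zeta> v
          = \<i>/2 * (inverse (G v) + G v) * height_form (X \<circ> x) (N \<circ> x) V i v" unfolding \<eta> .
      have "weierstrass_integrand ?g ?\<Psi> 3 (?\<zeta> v) * partial i ?\<zeta> v
          = (G v * inverse (G v)) * (1 / \<alpha> * partial i ?\<zeta> v)"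
        unfolding weierstrass_integrand_components \<Psi> exp'[OF v] by (simp only: mult_ac)
      then have w3: "weierstrass_integrand ?g ?\<Psi> 3 (?\<zeta> v) * partial i ?\<zeta> v
          = height_form (X \<circ> x) (N \<circ> x) V i v"
        unfolding \<eta> using G0 by simp
      have zd: "?\<zeta> differentiable (at v)" by (rule smooth_on_differentiable[OF sm v])
      have "partial i (\<lambda>v. F (?\<zeta> v)) v = partial i (X \<circ> x) v"
        unfolding partial_compose[OF F' zd] w1 w2 w3 weierstrass_representation[OF vD]
          by (rule expand[symmetric])
      moreover have "(\<lambda>v. F (?\<zeta> v)) differentiable (at v)"
        using diff_chain_at[OF smooth_on_has_derivative[OF sm v] F']
          unfolding differentiable_def o_def by blast
      ultimately show ?thesis
        using partial_diff[OF smooth_on_differentiable[OF smooth_Y vD], of "\<lambda>v. F (?\<zeta> v)" i]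
          by (simp add: o_def)
    qed
    have diff: "(\<lambda>v. X (x v) - F (?\<zeta> v)) differentiable (at v)" if v: "v \<in> ?B" for v
    proof -
      have "(\<lambda>v. F (?\<zeta> v)) differentiable (at v)"
        using diff_chain_at[OF smooth_on_has_derivative[OF sm v] F']
          unfolding differentiable_def o_def by blast
      then show ?thesis
        using smooth_on_differentiable[OF smooth_Y, of v] r(2) v unfolding o_def
          by (intro differentiable_diff) auto
    qed
    have "X (x v) - F (?\<zeta> v) = X (x w) - F (?\<zeta> w)" if "v \<in> ?B" for v
      by (rule constant_on_ball_if_partials_vanish[OF diff same that w(1)])
    moreover have "X (x w) = F (?\<zeta> w)" using q(2) w(2) by (simp add: R_def c_def)
    ultimately have XF: "X (x v) = F (?\<zeta> v)" if "v \<in> ?B" for v using that by simp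
    define \<phi> where "\<phi> p = ?\<zeta> (inv_into D x p)" for p
    have \<phi>: "\<phi> (x v) = ?\<zeta> v" if "v \<in> ?B" for v
      using inv_into_f_f[OF chart_open(2)[OF surface_oriented x(1)], of v] r(2) that
        by (auto simp: \<phi>_def)
    have img: "?\<zeta> ` ?B = (\<lambda>z. z - c) -` (\<zeta> ` ?B)"
      by (auto simp: image_iff) (metis diff_add_cancel mem_ball)
    have op: "open (?\<zeta> ` ?B)"
      unfolding img by (rule open_vimage[OF \<zeta>(2)]) (intro continuous_intros)
    have "diffeo_to_plane A (x ` ?B) \<phi>"
    proof (rule diffeo_to_plane_chart[OF surface_oriented x(1) open_ball r(2) sm op, where h
        = "\<lambda>z. h (z - c)"])
      show "smooth_on (?\<zeta> ` ?B) (\<lambda>z. h (z - c))"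
        by (rule smooth_on_compose[OF op \<zeta>(2) _ _ h(1)]) (auto intro!: smooth_on_diff
            smooth_on_ident smooth_on_const op)
    qed (use h(2) \<phi> in auto)
    moreover have "\<forall>q'\<in>x ` ?B. R q' (\<phi> q')"
      using XF exp' \<phi> by (auto simp: R_def)
    ultimately show ?thesis by blast
  qed
  moreover have "openin M (x ` ?B)"
    by (rule chart_open(5)[OF surface_oriented x(1) open_ball r(2)])
  moreover have "p \<in> x ` ?B" using x(3) r(1) by force
  ultimately show ?thesis by blast
qed

text \<open>If \<open>k\<close> is the constant value of \<open>G\<^sup>2 \<Psi> / G'\<close>, then in a coordinate with \<open>G = e\<^bsup>\<alpha>\<zeta>\<^esup>\<close> the second
  datum is \<open>\<Psi> = k \<alpha> e\<^bsup>-\<alpha>\<zeta>\<^esup>\<close>, and \<open>k \<alpha> = 1 / \<alpha>\<close> for \<open>\<alpha>\<^sup>2 = 1 / k\<close>. The rigid motion is fixed by one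
  base point and propagates along the connected surface.\<close>

theorem (in directed_minimal_surface) constant_CR2_representation:
  assumes "CR2 A X N V constant_on topspace M"
  obtains \<alpha> where "\<alpha> \<noteq> 0"
    "part_of_up_to_isometry M A X (weierstrass_surface (\<lambda>z. exp (\<alpha> * z)) (\<lambda>z. 1 / \<alpha> * exp (- \<alpha> * z))
        0)"
proof (cases "topspace M = {}")
  case True
  have "part_of_up_to_isometry M A X Y" for Y
    unfolding part_of_up_to_isometry_def using True
    by (auto simp: euclidean_isometry_def intro!: exI[of _ "\<lambda>p. p"])
  then show ?thesis using that[of 1] by simp
next
  case False
  then obtain p0 where p0: "p0 \<in> topspace M" by blast
  obtain k where k: "k \<noteq> 0" "\<And>D x u. (D, x) \<in> A \<Longrightarrow> u \<in> D \<Longrightarrow> form_quotient (X \<circ> x) (N \<circ> x) V u = k"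
    by (rule form_quotient_constant[OF assms False]) blast
  have "norm V = 1" using admissible by (simp add: CR2_admissible_def)
  then obtain e1 e2 where frame: "positive_frame e1 e2 V" by (rule positive_frame_exists)
  define \<alpha> where "\<alpha> = csqrt (1 / k)"
  have \<alpha>: "\<alpha> \<noteq> 0" "\<alpha>\<^sup>2 * k = 1" using k(1) by (auto simp: \<alpha>_def)
  let ?W = "weierstrass_surface (\<lambda>z. exp (\<alpha> * z)) (\<lambda>z. 1 / \<alpha> * exp (- \<alpha> * z)) 0"
  define z0 where "z0 = Ln (stereographic e1 e2 (N p0)) / \<alpha>"
  define t where "t = X p0 - frame_motion 0 e1 e2 V (?W z0)"
  let ?F = "\<lambda>z. frame_motion t e1 e2 V (?W z)"
  let ?R = "\<lambda>q z. X q = ?F z \<and> exp (\<alpha> * z) = stereographic e1 e2 (N q)"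
  have near: "\<exists>U. openin M U \<and> p \<in> U \<and>
    (\<forall>q\<in>U. \<forall>z. ?R q z \<longrightarrow> (\<exists>\<phi>. diffeo_to_plane A U \<phi> \<and> (\<forall>q'\<in>U. ?R q' (\<phi> q'))))"
    if "p \<in> topspace M" for p
    by (rule representation_near_point[OF frame \<alpha> k(2) that])
  obtain D x u where x: "(D, x) \<in> A" "u \<in> D" "x u = p0"
    by (rule chart_covers[OF surface_oriented p0])
  interpret minimal_patch D "X \<circ> x" "N \<circ> x" V by (rule minimal_patch_chart[OF x(1)])
  interpret positive_frame e1 e2 V by (rule frame)
  interpret framed_minimal_patch D "X \<circ> x" "N \<circ> x" V e1 e2 ..
  have "?R p0 z0"
    using stereographic_nonzero[OF x(2)] \<alpha>(1) x(3) by (simp add: t_def z0_def frame_motion_def)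
  then have "\<exists>z. ?R p0 z" by blast
  have all: "\<exists>z. ?R p z" if "p \<in> topspace M" for p
    by (rule connected_space_propagate[where R
        = "\<lambda>q. \<exists>z. ?R q z", OF surface_connected _ p0 \<open>\<exists>z. ?R p0 z\<close> that])
       (use near in meson)
  have "part_of_up_to_isometry M A X ?W"
    unfolding part_of_up_to_isometry_def
  proof (intro exI[of _ "frame_motion t e1 e2 V"] conjI ballI)
    show "euclidean_isometry (frame_motion t e1 e2 V)" by (rule frame_motion_isometry)
    fix p assume p: "p \<in> topspace M"
    from near[OF p] all[OF p] show "\<exists>U \<phi>. openin M U \<and> p \<in> U \<and> diffeo_to_plane A U \<phi> \<and>
        (\<forall>q\<in>U. X q = frame_motion t e1 e2 V (?W (\<phi> q)))" by meson
  qed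
  with \<alpha>(1) show ?thesis by (rule that)
qed

section \<open>Isometries of space\<close>

lemma euclidean_isometry_affine:
  assumes "euclidean_isometry S"
  obtains f where "orthogonal_transformation f" "\<And>p. S p = S 0 + f p"
proof -
  have "orthogonal_transformation (\<lambda>p. S p - S 0)"
    using assms unfolding orthogonal_transformation_isometry euclidean_isometry_def
      by (simp add: dist_norm)
  then show thesis by (rule that) simp
qed

lemma euclidean_isometry_inverse:
  assumes "euclidean_isometry S"
  obtains T where "euclidean_isometry T" "\<And>p. T (S p) = p" "\<And>p. S (T p) = p"
proof -
  obtain f where f: "orthogonal_transformation f" "\<And>p. S p = S 0 + f p"
    using euclidean_isometry_affine[OF assms] by blast
  have "bij f" by (rule orthogonal_transformation_bij[OF f(1)])
  have ST: "S (inv f (p - S 0)) = p" for p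
    using f(2)[of "inv f (p - S 0)"] \<open>bij f\<close> by (simp add: bij_is_surj surj_f_inv_f)
  show thesis
  proof
    show "euclidean_isometry (\<lambda>p. inv f (p - S 0))"
      using assms ST unfolding euclidean_isometry_def by metis
    show "inv f (S p - S 0) = p" for p
      using f(2)[of p] \<open>bij f\<close> by (simp add: bij_is_inj)
  qed (rule ST)
qed

lemma euclidean_isometry_compose:
  "euclidean_isometry S \<Longrightarrow> euclidean_isometry T \<Longrightarrow> euclidean_isometry (\<lambda>p. S (T p))"
  by (simp add: euclidean_isometry_def)

context surface_patch
begin

lemma partial_isometry:
  assumes f: "orthogonal_transformation f" and u: "u \<in> D"
  shows "partial i (\<lambda>u. c + f (Y u)) u = f (partial i Y u)" "partial i (\<lambda>u. f (n u)) u
      = f (partial i n u)"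
proof -
  have bl: "bounded_linear f"
    using orthogonal_transformation_linear[OF f] by (rule linear_conv_bounded_linear[THEN iffD1])
  have Y: "Y differentiable (at u)" by (rule smooth_on_differentiable[OF smooth_Y u])
  have fY: "(\<lambda>u. f (Y u)) differentiable (at u)"
    by (rule smooth_on_differentiable[OF smooth_on_compose_linear[OF bl open_D smooth_Y] u])
  show "partial i (\<lambda>u. c + f (Y u)) u = f (partial i Y u)"
    unfolding partial_add[OF differentiable_const fY] partial_linear[OF bl Y] partial_const by simp
  show "partial i (\<lambda>u. f (n u)) u = f (partial i n u)"
    by (rule partial_linear[OF bl normal_differentiable[OF u]])
qed

lemma isometry_patch:
  assumes f: "orthogonal_transformation f"
  shows "surface_patch D (\<lambda>u. c + f (Y u)) (\<lambda>u. f (n u))"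
proof
  have bl: "bounded_linear f"
    using orthogonal_transformation_linear[OF f] by (rule linear_conv_bounded_linear[THEN iffD1])
  show "open D" by (rule open_D)
  show s: "smooth_on D (\<lambda>u. c + f (Y u))" "smooth_on D (\<lambda>u. f (n u))"
    by (intro smooth_on_add smooth_on_const open_D smooth_on_compose_linear[OF bl] smooth_Y smooth_n)+
  fix u assume u: "u \<in> D"
  show "norm (f (n u)) = 1" using orthogonal_transformation_norm[OF f] unit[OF u] by simp
  show "f (n u) \<bullet> partial i (\<lambda>u. c + f (Y u)) u = 0" for i
    unfolding partial_isometry[OF f u] using f normal[OF u]
      by (simp add: orthogonal_transformation_def)
  have "((\<lambda>u. c + f (Y u)) has_derivative (\<lambda>h. 0 + f (frechet_derivative Y (at u) h))) (at u)"
    by (intro has_derivative_add has_derivative_const bounded_linear.has_derivative[OF bl]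
        smooth_on_has_derivative[OF smooth_Y u])
  then have "frechet_derivative (\<lambda>u. c + f (Y u)) (at u) = (\<lambda>h. f (frechet_derivative Y (at u) h))"
    using frechet_derivative_at by force
  then show "inj (frechet_derivative (\<lambda>u. c + f (Y u)) (at u))"
    using inj_compose[OF orthogonal_transformation_inj[OF f] immersed[OF u]] by (simp add: o_def)
qed

text \<open>Both conditions are equations between cross products, which an orthogonal map preserves up to
  a common sign.\<close>

lemma curvature_isometry:
  assumes f: "orthogonal_transformation f" and u: "u \<in> D"
  shows "metric_curvature (induced_metric (\<lambda>u. c + f (Y u))) u = metric_curvature g u"
    and "mean_curvature Y n u = 0 \<Longrightarrow> mean_curvature (\<lambda>u. c + f (Y u)) (\<lambda>u. f (n u)) u = 0"
proof -
  interpret moved: surface_patch D "\<lambda>u. c + f (Y u)" "\<lambda>u. f (n u)" by (rule isometry_patch[OF f])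
  note lin = orthogonal_transformation_linear[OF f]
  have "partial 1 n u \<times> partial 2 n u = metric_curvature g u *\<^sub>R (partial 1 Y u \<times> partial 2 Y u)"
    using curvature_normal_cross[OF u] by blast
  then have "f (partial 1 n u) \<times> f (partial 2 n u)
      = metric_curvature g u *\<^sub>R (f (partial 1 Y u) \<times> f (partial 2 Y u))"
    unfolding cross_orthogonal_transformation[OF f] by (simp add: linear_cmul[OF lin])
  then show "metric_curvature (induced_metric (\<lambda>u. c + f (Y u))) u = metric_curvature g u"
    unfolding moved.curvature_normal_cross[OF u] partial_isometry[OF f u] .
  assume "mean_curvature Y n u = 0"
  then have "partial 1 n u \<times> partial 2 Y u + partial 1 Y u \<times> partial 2 n u = 0"
    unfolding mean_curvature_zero_iff[OF u] .
  from arg_cong[OF this, of f]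
  have "f (partial 1 n u) \<times> f (partial 2 Y u) + f (partial 1 Y u) \<times> f (partial 2 n u) = 0"
    unfolding cross_orthogonal_transformation[OF f] scaleR_add_right[symmetric]
    by (simp add: linear_add[OF lin] linear_0[OF lin])
  then show "mean_curvature (\<lambda>u. c + f (Y u)) (\<lambda>u. f (n u)) u = 0"
    unfolding moved.mean_curvature_zero_iff[OF u] partial_isometry[OF f u] .
qed

end

lemma immersion_unit_normalI:
  assumes "\<And>D x. (D, x) \<in> A \<Longrightarrow> surface_patch D (X \<circ> x) (N \<circ> x)"
  shows "immersion A X" "unit_normal A X N"
  using assms unfolding immersion_def unit_normal_def smooth_map_def surface_patch_def by auto

lemma immersion_isometry:
  assumes "oriented_surface M A" "immersion A X" "orthogonal_transformation f"
  shows "immersion A (\<lambda>p. c + f (X p))"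
  unfolding immersion_def smooth_map_def
proof (intro conjI ballI; clarify)
  fix D x assume x: "(D, x) \<in> A"
  have bl: "bounded_linear f"
    using orthogonal_transformation_linear[OF assms(3)]
      by (rule linear_conv_bounded_linear[THEN iffD1])
  have D: "open D" by (rule chart_open(1)[OF assms(1) x])
  have s: "smooth_on D (X \<circ> x)" and i: "u \<in> D \<Longrightarrow> inj (frechet_derivative (X \<circ> x) (at u))" for u
    using assms(2) x unfolding immersion_def smooth_map_def by auto
  show "smooth_on D ((\<lambda>p. c + f (X p)) \<circ> x)"
    using smooth_on_add[OF D smooth_on_const smooth_on_compose_linear[OF bl D s]] by (simp add: o_def)
  fix u assume u: "u \<in> D"
  have "((\<lambda>u. c + f ((X \<circ> x) u)) has_derivative (\<lambda>h. 0
      + f (frechet_derivative (X \<circ> x) (at u) h))) (at u)"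
    by (intro has_derivative_add has_derivative_const bounded_linear.has_derivative[OF bl]
        smooth_on_has_derivative[OF s u])
  then have "frechet_derivative ((\<lambda>p. c + f (X p)) \<circ> x) (at u)
      = (\<lambda>h. f (frechet_derivative (X \<circ> x) (at u) h))"
    using frechet_derivative_at by (force simp: o_def)
  then show "inj (frechet_derivative ((\<lambda>p. c + f (X p)) \<circ> x) (at u))"
    using inj_compose[OF orthogonal_transformation_inj[OF assms(3)] i[OF u]] by (simp add: o_def)
qed

lemma const_CR2_surface_isometry:
  assumes "const_CR2_surface M A X N" "euclidean_isometry S"
  shows "\<exists>N'. const_CR2_surface M A (\<lambda>p. S (X p)) N'"
proof -
  obtain V where V: "CR2_admissible M A X N V" "CR2 A X N V constant_on topspace M"
    using assms(1) unfolding const_CR2_surface_def by blast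
  interpret directed_minimal_surface M A X N V by unfold_locales (rule V(1))
  obtain f where f: "orthogonal_transformation f" "\<And>p. S p = S 0 + f p"
    using euclidean_isometry_affine[OF assms(2)] by blast
  let ?X = "\<lambda>p. S 0 + f (X p)" and ?N = "\<lambda>p. f (N p)"
  have patch: "surface_patch D (?X \<circ> x) (?N \<circ> x)" if "(D, x) \<in> A" for D x
    using surface_patch.isometry_patch[OF surface_patch_chart[OF surface_oriented surface_immersion
        surface_normal that] f(1), of "S 0"]
    by (simp add: o_def)
  have imm: "immersion A ?X" "unit_normal A ?X ?N"
    by (rule immersion_unit_normalI, erule patch)+
  have K: "gauss_curvature A ?X p = gauss_curvature A X p" if pM: "p \<in> topspace M" for p
  proof -
    obtain D x u where x: "(D, x) \<in> A" "u \<in> D" "x u = p"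
      by (rule chart_covers[OF surface_oriented pM])
    interpret surface_patch D "X \<circ> x" "N \<circ> x"
      by (rule surface_patch_chart[OF surface_oriented surface_immersion surface_normal x(1)])
    show ?thesis
      using gauss_curvature_chart[OF surface_oriented imm x(1,2)] curvature_isometry(1)[OF f(1)
          x(2), of "S 0"]
        gauss_curvature_chart[OF surface_oriented surface_immersion surface_normal x(1,2)]
      by (simp add: x(3) o_def)
  qed
  have angle: "angle_function ?N (f V) p = angle_function N V p" for p
    using f(1) by (simp add: angle_function_def orthogonal_transformation_def)
  have "mean_curvature (?X \<circ> x) (?N \<circ> x) u = 0" if "(D, x) \<in> A" "u \<in> D" for D x u
    using surface_patch.curvature_isometry(2)[OF surface_patch_chart[OF surface_oriented
        surface_immersion surface_normal that(1)] f(1) that(2), of "S 0"]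
      V(1) that unfolding CR2_admissible_def minimal_surface_def by (auto simp: o_def)
  then have "minimal_surface M A ?X ?N"
    using surface_oriented surface_connected imm by (auto simp: minimal_surface_def)
  then have "CR2_admissible M A ?X ?N (f V)"
    using V(1) K orthogonal_transformation_norm[OF f(1)] by (simp add: CR2_admissible_def angle)
  moreover have "CR2 A ?X ?N (f V) constant_on topspace M"
    using V(2) K by (simp add: constant_on_def CR2_def angle)
  ultimately show ?thesis
    unfolding const_CR2_surface_def f(2)[of "X _"] by blast
qed

section \<open>Surfaces with an explicit normal field\<close>

text \<open>For a linear map of a plane, the two left-hand sides are \<open>v \<times> w\<close> times the trace and times the
  determinant.\<close>

lemma tracefree_shape:
  fixes L :: "real^3 \<Rightarrow> real^3"
  assumes "linear L" "L T1 = a *\<^sub>R T1 + b *\<^sub>R T2" "L T2 = c *\<^sub>R T1 - a *\<^sub>R T2"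
    "v = x *\<^sub>R T1 + y *\<^sub>R T2" "w = x' *\<^sub>R T1 + y' *\<^sub>R T2"
  shows "L v \<times> w + v \<times> L w = 0" "L v \<times> L w = (- a\<^sup>2 - b * c) *\<^sub>R (v \<times> w)"
proof -
  have cross: "(p *\<^sub>R T1 + q *\<^sub>R T2) \<times> (r *\<^sub>R T1 + s *\<^sub>R T2) = (p * s - q * r) *\<^sub>R (T1 \<times> T2)"
      for p q r s
    using cross_skew[of T2 T1]
    by (simp add: cross_add_left cross_add_right cross_mult_left cross_mult_right algebra_simps)
  have L: "L (x *\<^sub>R T1 + y *\<^sub>R T2) = (x * a + y * c) *\<^sub>R T1 + (x * b - y * a) *\<^sub>R T2" for x y
    by (simp add: linear_add[OF assms(1)] linear_cmul[OF assms(1)] assms(2,3) algebra_simps)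
  show "L v \<times> w + v \<times> L w = 0" "L v \<times> L w = (- a\<^sup>2 - b * c) *\<^sub>R (v \<times> w)"
    unfolding assms(4,5) L cross by (simp_all add: algebra_simps power2_eq_square flip:
        scaleR_add_left)
qed

text \<open>A surface \<open>C\<close>, contained in the zero set of \<open>P\<close>, together with a smooth extension \<open>\<nu>\<close> of its
  unit normal to all of space. The derivative of \<open>\<nu>\<close>, restricted to the tangent planes, is the
  negative shape operator; it is given by its matrix in some basis of the tangent plane.\<close>

locale explicit_surface =
  fixes C :: "(real^3) set" and \<nu> :: "real^3 \<Rightarrow> real^3" and V :: "real^3"
    and P c K :: "real^3 \<Rightarrow> real" and a :: real
  assumes unit_V: "norm V = 1"
    and smooth_\<nu>: "smooth_on UNIV \<nu>"
    and gradient: "\<And>p. p \<in> C \<Longrightarrow> (P has_derivative (\<lambda>h. c p * (\<nu> p \<bullet> h))) (at p)"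
    and gradient_nonzero: "\<And>p. p \<in> C \<Longrightarrow> c p \<noteq> 0"
    and zero: "\<And>p. p \<in> C \<Longrightarrow> P p = 0"
    and unit: "\<And>p. p \<in> C \<Longrightarrow> norm (\<nu> p) = 1"
    and shape: "\<And>p. p \<in> C \<Longrightarrow> \<exists>T1 T2 \<alpha> \<beta> \<gamma>. \<nu> p \<bullet> T1 = 0 \<and> \<nu> p \<bullet> T2 = 0 \<and> T1 \<times> T2 \<noteq> 0 \<and>
        frechet_derivative \<nu> (at p) T1 = \<alpha> *\<^sub>R T1 + \<beta> *\<^sub>R T2 \<and>
        frechet_derivative \<nu> (at p) T2 = \<gamma> *\<^sub>R T1 - \<alpha> *\<^sub>R T2 \<and> K p = - \<alpha>\<^sup>2 - \<beta> * \<gamma>"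
    and negative: "\<And>p. p \<in> C \<Longrightarrow> K p < 0"
    and angle: "\<And>p. p \<in> C \<Longrightarrow> -1 < \<nu> p \<bullet> V \<and> \<nu> p \<bullet> V < 1"
    and CR2_value: "\<And>p. p \<in> C \<Longrightarrow> (- K p) powr (-1/2) * (1 - (\<nu> p \<bullet> V)\<^sup>2) = a"
begin

lemma patch:
  assumes "open D" "smooth_on D F" "\<And>u. u \<in> D \<Longrightarrow> F u \<in> C" "\<And>u. u \<in> D \<Longrightarrow>
      inj (frechet_derivative F (at u))"
  shows "surface_patch D F (\<lambda>u. \<nu> (F u))"
    and "u \<in> D \<Longrightarrow> mean_curvature F (\<lambda>u. \<nu> (F u)) u = 0"
    and "u \<in> D \<Longrightarrow> metric_curvature (induced_metric F) u = K (F u)"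
proof -
  show "surface_patch D F (\<lambda>u. \<nu> (F u))"
  proof
    show "smooth_on D (\<lambda>u. \<nu> (F u))"
      by (rule smooth_on_compose[OF assms(1) open_UNIV _ assms(2) smooth_\<nu>]) simp
    fix u i assume u: "u \<in> D"
    have "partial i (\<lambda>u. P (F u)) u = c (F u) * (\<nu> (F u) \<bullet> partial i F u)"
      by (rule partial_compose[OF gradient[OF assms(3)[OF u]] smooth_on_differentiable[OF assms(2)
          u]])
    moreover have "partial i (\<lambda>u. P (F u)) u = partial i (\<lambda>u. 0) u"
      by (rule partial_cong_open[OF assms(1) u]) (simp add: zero assms(3))
    ultimately show "\<nu> (F u) \<bullet> partial i F u = 0"
      using gradient_nonzero[OF assms(3)[OF u]] by (simp add: partial_const)
  qed (use assms unit in auto)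
  then interpret surface_patch D F "\<lambda>u. \<nu> (F u)" .
  assume u: "u \<in> D"
  let ?L = "frechet_derivative \<nu> (at (F u))"
  have L: "(\<nu> has_derivative ?L) (at (F u))"
    by (rule smooth_on_has_derivative[OF smooth_\<nu>]) simp
  have p\<nu>: "partial i (\<lambda>u. \<nu> (F u)) u = ?L (partial i F u)" for i
    by (rule partial_compose[OF L smooth_on_differentiable[OF assms(2) u]])
  obtain T1 T2 \<alpha> \<beta> \<gamma> where T: "\<nu> (F u) \<bullet> T1 = 0" "\<nu> (F u) \<bullet> T2 = 0" "T1 \<times> T2 \<noteq> 0"
    "?L T1 = \<alpha> *\<^sub>R T1 + \<beta> *\<^sub>R T2" "?L T2 = \<gamma> *\<^sub>R T1 - \<alpha> *\<^sub>R T2" "K (F u) = - \<alpha>\<^sup>2 - \<beta> * \<gamma>"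
    using shape[OF assms(3)[OF u]] by blast
  note exp = tangent_vector_expand[OF explicit_surface.unit[OF explicit_surface_axioms assms(3)[OF
      u]] T(1-3) normal[OF u]]
  obtain x y where 1: "partial 1 F u = x *\<^sub>R T1 + y *\<^sub>R T2" using exp by blast
  obtain x' y' where 2: "partial 2 F u = x' *\<^sub>R T1 + y' *\<^sub>R T2" using exp by blast
  note tf = tracefree_shape[OF has_derivative_linear[OF L] T(4,5) 1 2]
  show "mean_curvature F (\<lambda>u. \<nu> (F u)) u = 0"
    unfolding mean_curvature_zero_iff[OF u] p\<nu> by (rule tf(1))
  show "metric_curvature (induced_metric F) u = K (F u)"
    unfolding curvature_normal_cross[OF u] p\<nu> T(6) by (rule tf(2))
qed

text \<open>An immersion with image in \<open>C\<close> has the normal \<open>\<nu> \<circ> X\<close> and the curvature of \<open>C\<close>. In this way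
  embedded surfaces and parametrizations of their universal covers are treated at once.\<close>

lemma const_CR2_of_immersion_into:
  assumes M: "oriented_surface M A" "connected_space M"
      and X: "immersion A X" "\<And>p. p \<in> topspace M \<Longrightarrow> X p \<in> C"
  shows "const_CR2_surface M A X (\<lambda>p. \<nu> (X p))"
proof -
  have Xx: "(X \<circ> x) u \<in> C" if "(D, x) \<in> A" "u \<in> D" for D x u
    using X(2) chart_in_topspace[OF M(1) that] by simp
  have s: "smooth_on D (X \<circ> x)" "\<And>u. u \<in> D \<Longrightarrow> inj (frechet_derivative (X \<circ> x) (at u))"
      if "(D, x) \<in> A" for D x
    using X(1) that unfolding immersion_def smooth_map_def by auto
  have p: "surface_patch D (X \<circ> x) (\<lambda>u. \<nu> ((X \<circ> x) u))"
    "\<And>u. u \<in> D \<Longrightarrow> mean_curvature (X \<circ> x) (\<lambda>u. \<nu> ((X \<circ> x) u)) u = 0"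
    "\<And>u. u \<in> D \<Longrightarrow> metric_curvature (induced_metric (X \<circ> x)) u = K ((X \<circ> x) u)" if "(D, x) \<in> A" for D x
    using patch[OF chart_open(1)[OF M(1) that] s(1)[OF that] Xx[OF that] s(2)[OF that]] by blast+
  have patch: "surface_patch D (X \<circ> x) ((\<lambda>p. \<nu> (X p)) \<circ> x)" if "(D, x) \<in> A" for D x
    using p(1)[OF that] by (simp add: o_def)
  have imm: "immersion A X" "unit_normal A X (\<lambda>p. \<nu> (X p))"
    by (rule immersion_unit_normalI, erule patch)+
  have min: "minimal_surface M A X (\<lambda>p. \<nu> (X p))"
    using M imm p(2) by (auto simp: minimal_surface_def o_def)
  have K: "gauss_curvature A X p = K (X p)" if pM: "p \<in> topspace M" for p
  proof -
    obtain D x u where x: "(D, x) \<in> A" "u \<in> D" "x u = p" by (rule chart_covers[OF M(1) pM])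
    show ?thesis
      using gauss_curvature_chart[OF M(1) imm x(1,2)] p(3)[OF x(1,2)] x(3) by simp
  qed
  have "CR2_admissible M A X (\<lambda>p. \<nu> (X p)) V"
    using min K X(2) negative angle unit_V by (simp add: CR2_admissible_def angle_function_def)
  moreover have "CR2 A X (\<lambda>p. \<nu> (X p)) V p = ln a" if "p \<in> topspace M" for p
    using K[OF that] CR2_value[OF X(2)[OF that]] by (simp add: CR2_def angle_function_def)
  ultimately show ?thesis
    unfolding const_CR2_surface_def constant_on_def by blast
qed

lemma const_CR2_of_immersion_into_copy:
  assumes M: "oriented_surface M A" "connected_space M" and X: "immersion A X"
    and S: "euclidean_isometry S" "\<And>p. p \<in> topspace M \<Longrightarrow> X p \<in> S ` C"
  shows "\<exists>N. const_CR2_surface M A X N"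
proof -
  obtain T where T: "euclidean_isometry T" "\<And>p. T (S p) = p" "\<And>p. S (T p) = p"
    using euclidean_isometry_inverse[OF S(1)] by blast
  obtain f where f: "orthogonal_transformation f" "\<And>p. T p = T 0 + f p"
    using euclidean_isometry_affine[OF T(1)] by blast
  have "immersion A (\<lambda>p. T (X p))"
    using immersion_isometry[OF M(1) X f(1), of "T 0"] unfolding f(2)[symmetric] .
  moreover have "T (X p) \<in> C" if "p \<in> topspace M" for p
    using S(2)[OF that] T(2) by auto
  ultimately have "const_CR2_surface M A (\<lambda>p. T (X p)) (\<lambda>p. \<nu> (T (X p)))"
    by (rule const_CR2_of_immersion_into[OF M])
  from const_CR2_surface_isometry[OF this S(1)] show ?thesis by (simp add: T(3))
qed

end

section \<open>Atlases from covering maps\<close>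

lemma second_countable_euclidean: "second_countable (euclidean :: 'a::second_countable_topology
    topology)"
proof -
  obtain B :: "'a set set" where B: "countable B" "topological_basis B"
    using ex_countable_basis by blast
  have "\<forall>V\<in>B. openin euclidean V" using topological_basis_open[OF B(2)] by simp
  moreover have "\<forall>U x. openin euclidean U \<and> x \<in> U \<longrightarrow> (\<exists>V\<in>B. x \<in> V \<and> V \<subseteq> U)"
    using topological_basisE[OF B(2)] by (metis open_openin)
  ultimately show ?thesis unfolding second_countable_def using B(1) by blast
qed

text \<open>If the fibres of an open map \<open>p\<close> differ by translations under which \<open>p\<close> is invariant, then the
  local inverses of \<open>p\<close> form an atlas whose transition maps are locally translations.\<close>

lemma oriented_surface_of_periodic_map:
  fixes p :: "real^2 \<Rightarrow> 'b::{metric_space, second_countable_topology}"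
  assumes cont: "continuous_on UNIV p" and op: "\<And>U. open U \<Longrightarrow> openin (top_of_set C) (p ` U)"
    and period: "\<And>u v w. p u = p v \<Longrightarrow> p (w + (v - u)) = p w"
    and dom: "\<And>D. D \<in> \<D> \<Longrightarrow> open D \<and> inj_on p D" "C = (\<Union>D\<in>\<D>. p ` D)"
  shows "oriented_surface (top_of_set C) ((\<lambda>D. (D, p)) ` \<D>)"
  unfolding oriented_surface_def
proof (intro conjI ballI; clarify?)
  show "Hausdorff_space (top_of_set C)" by (simp add: Hausdorff_space_subtopology)
  show "second_countable (top_of_set C)" by (rule second_countable_subtopology[OF
      second_countable_euclidean])
  show "topspace (top_of_set C) = (\<Union>(D, x)\<in>(\<lambda>D. (D, p)) ` \<D>. x ` D)" using dom(2) by auto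
next
  fix D assume D: "D \<in> \<D>"
  have "open D" "inj_on p D" "p ` D \<subseteq> C" using dom D by auto
  have sub: "subtopology (top_of_set C) (p ` D) = top_of_set (p ` D)"
    using \<open>p ` D \<subseteq> C\<close> by (simp add: subtopology_subtopology inf.absorb2)
  have "homeomorphic_map (top_of_set D) (top_of_set (p ` D)) p"
  proof (rule bijective_open_imp_homeomorphic_map)
    show "continuous_map (top_of_set D) (top_of_set (p ` D)) p"
      using cont by (auto intro: continuous_on_subset)
    show "open_map (top_of_set D) (top_of_set (p ` D)) p"
      unfolding open_map_def
    proof (intro allI impI)
      fix U assume U: "openin (top_of_set D) U"
      then have "openin (top_of_set C) (p ` U)"
        using op \<open>open D\<close> openin_open_trans by blast
      moreover have "p ` U \<subseteq> p ` D" using openin_imp_subset[OF U] by blast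
      ultimately show "openin (top_of_set (p ` D)) (p ` U)"
        using \<open>p ` D \<subseteq> C\<close> openin_subset_trans by blast
    qed
  qed (use \<open>inj_on p D\<close> in auto)
  then show "open D \<and> openin (top_of_set C) (p ` D)
      \<and> homeomorphic_map (top_of_set D) (subtopology (top_of_set C) (p ` D)) p"
    unfolding sub using \<open>open D\<close> op by blast
next
  fix D E assume D: "D \<in> \<D>" and E: "E \<in> \<D>"
  let ?W = "{u \<in> D. p u \<in> p ` E}" and ?t = "inv_into E p \<circ> p"
  have E': "open E" "inj_on p E" and "open D" using dom D E by auto
  have loc: "\<exists>T b. open T \<and> u \<in> T \<and> (\<forall>v\<in>T. ?t v = v + b)" if u: "u \<in> ?W" for u
  proof -
    define b where "b = ?t u - u"
    define T where "T = (\<lambda>v. v + b) -` E"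
    have "?t u \<in> E" "p (?t u) = p u" using u by (auto simp: inv_into_into f_inv_into_f)
    have "open T" unfolding T_def by (intro open_vimage E' continuous_intros)
    moreover have "u \<in> T" using \<open>?t u \<in> E\<close> by (simp add: T_def b_def)
    moreover have "?t v = v + b" if "v \<in> T" for v
    proof -
      have "p (v + b) = p v" unfolding b_def by (rule period) (simp add: \<open>p (?t u) = p u\<close>[simplified])
      then have "?t v = inv_into E p (p (v + b))" by simp
      also have "\<dots> = v + b" using E'(2) that by (intro inv_into_f_f) (auto simp: T_def)
      finally show ?thesis .
    qed
    ultimately show ?thesis by blast
  qed
  have "smooth_on ?W ?t"
  proof (rule smooth_on_local)
    fix u assume "u \<in> ?W"
    then obtain T b where T: "open T" "u \<in> T" "\<forall>v\<in>T. ?t v = v + b" using loc by blast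
    have "smooth_on T (\<lambda>v. v + b)" by (intro smooth_on_add smooth_on_ident smooth_on_const T(1))
    then have "smooth_on T ?t"
      using smooth_on_cong[OF T(1), of ?t "\<lambda>v. v + b"] T(3) by blast
    with T show "\<exists>T. open T \<and> u \<in> T \<and> smooth_on T ?t" by blast
  qed
  moreover have "det (matrix (frechet_derivative ?t (at u))) > 0" if u: "u \<in> ?W" for u
  proof -
    obtain T b where T: "open T" "u \<in> T" "\<forall>v\<in>T. ?t v = v + b" using loc[OF u] by blast
    have "((\<lambda>v. v + b) has_derivative (\<lambda>h. h)) (at u)"
      by (auto intro!: derivative_eq_intros)
    then have "(?t has_derivative (\<lambda>h. h)) (at u)"
      by (rule has_derivative_transform_within_open[OF _ T(1,2)]) (use T(3) in simp)
    then have "frechet_derivative ?t (at u) = id"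
      using frechet_derivative_at by (force simp: id_def)
    then show ?thesis by (simp add: matrix_id)
  qed
  ultimately show "let W = {u \<in> D. p u \<in> p ` E}; \<tau> = inv_into E p \<circ> p
     in smooth_on W \<tau> \<and> (\<forall>u\<in>W. 0 < det (matrix (frechet_derivative \<tau> (at u))))"
    unfolding Let_def by blast
qed

abbreviation plane_complex :: "real^2 \<Rightarrow> complex" where
  "plane_complex \<equiv> \<lambda>u. Complex (u$1) (u$2)"

lemma bounded_linear_plane_complex: "bounded_linear plane_complex"
proof -
  have "bounded_linear (\<lambda>u::real^2. (u$1) *\<^sub>R 1 + (u$2) *\<^sub>R \<i>)"
    by (intro bounded_linear_add bounded_linear_compose[OF bounded_linear_scaleR_left
        bounded_linear_vec_nth])
  moreover have "(\<lambda>u::real^2. (u$1) *\<^sub>R 1 + (u$2) *\<^sub>R \<i>) = plane_complex"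
    by (simp add: fun_eq_iff complex_eq_iff)
  ultimately show ?thesis by simp
qed

lemma plane_complex_vector: "plane_complex (vector [Re z, Im z]) = z"
  by (simp add: complex_eq_iff vector_2)

lemma plane_complex_inj: "plane_complex u = plane_complex v \<longleftrightarrow> u = v"
  by (simp add: vec_eq_iff forall_2)

lemma open_plane_complex_image: "open U \<Longrightarrow> open (plane_complex ` U)"
proof -
  assume "open U"
  have "plane_complex ` U = (\<lambda>z. vector [Re z, Im z]) -` U"
  proof (intro set_eqI iffI)
    fix z assume "z \<in> plane_complex ` U"
    then obtain u where "u \<in> U" "z = plane_complex u" by blast
    moreover have "vector [u$1, u$2] = u" by (simp add: vec_eq_iff forall_2 vector_2)
    ultimately show "z \<in> (\<lambda>z. vector [Re z, Im z]) -` U" by simp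
  next
    fix z assume "z \<in> (\<lambda>z. vector [Re z, Im z]) -` U"
    then have "plane_complex (vector [Re z, Im z]) \<in> plane_complex ` U" by blast
    then show "z \<in> plane_complex ` U" unfolding plane_complex_vector .
  qed
  then show ?thesis
    using open_vimage[OF \<open>open U\<close> linear_continuous_on[OF bounded_linear_complex_vector]] by simp
qed

lemma oriented_surface_plane: "oriented_surface euclidean plane_atlas"
proof -
  have "oriented_surface (top_of_set (UNIV :: complex set)) ((\<lambda>D. (D, plane_complex)) ` {UNIV})"
  proof (rule oriented_surface_of_periodic_map)
    show "continuous_on UNIV plane_complex"
      by (rule linear_continuous_on[OF bounded_linear_plane_complex])
    show "plane_complex (w + (v - u)) = plane_complex w" if "plane_complex u = plane_complex v"
        for u v w
      using that unfolding plane_complex_inj by simp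
    show "UNIV = (\<Union>D\<in>{UNIV}. plane_complex ` D)"
      using surjI[of plane_complex, OF plane_complex_vector] by simp
  qed (auto simp: open_plane_complex_image inj_on_def vec_eq_iff forall_2)
  then show ?thesis by (simp add: plane_atlas_def)
qed

section \<open>Associate families\<close>

text \<open>The inverse stereographic projection of \<open>G\<close>.\<close>

definition weierstrass_normal :: "(complex \<Rightarrow> complex) \<Rightarrow> complex \<Rightarrow> real^3" where
  "weierstrass_normal G z = (1 / (1 + (norm (G z))\<^sup>2)) *\<^sub>R vector [2 * Re (G z), 2 * Im (G z), (norm
      (G z))\<^sup>2 - 1]"

locale weierstrass_data =
  fixes G \<Psi> :: "complex \<Rightarrow> complex"
  assumes holomorphic_G: "G holomorphic_on UNIV" and holomorphic_\<Psi>: "\<Psi> holomorphic_on UNIV"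
    and nonzero: "\<And>z. \<Psi> z \<noteq> 0"
begin

abbreviation "\<omega> \<equiv> weierstrass_integrand G \<Psi>"

abbreviation (input) "dir i \<equiv> (if i = (1::2) then 1 else \<i>)"

lemma partial_plane_complex: "partial i plane_complex u = dir i"
  by (subst partial_eqI[OF bounded_linear_imp_has_derivative[OF bounded_linear_plane_complex]])
     (use exhaust_2[of i] in \<open>auto simp: axis_def complex_eq_iff\<close>)

lemma partial_plane_holomorphic:
  assumes "(h has_field_derivative h') (at (plane_complex u))"
  shows "partial i (\<lambda>u. h (plane_complex u)) u = h' * dir i"
  unfolding partial_field_compose[OF assms bounded_linear_imp_differentiable[OF
      bounded_linear_plane_complex]]
    partial_plane_complex ..

lemma partial_weierstrass:
  "partial i (\<lambda>u. weierstrass_surface G \<Psi> b (plane_complex u)) u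
      = (\<chi> j. Re (\<omega> j (plane_complex u) * dir i))"
  unfolding partial_compose[OF weierstrass_surface_has_derivative[OF holomorphic_G holomorphic_\<Psi>]
      bounded_linear_imp_differentiable[OF bounded_linear_plane_complex]] partial_plane_complex ..

lemma smooth_on_plane_holomorphic: "h holomorphic_on UNIV \<Longrightarrow> smooth_on UNIV (\<lambda>u. h (plane_complex u))"
  by (rule smooth_on_holomorphic_compose[OF open_UNIV open_UNIV _ smooth_on_linear[OF
      bounded_linear_plane_complex]]) auto

lemma smooth_weierstrass: "smooth_on UNIV (\<lambda>u. weierstrass_surface G \<Psi> b (plane_complex u))"
proof -
  obtain P where P: "\<And>j z. (P j has_field_derivative \<omega> j z) (at z)"
    "\<And>b z. weierstrass_surface G \<Psi> b z = (\<chi> j. Re (P j z - P j b))"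
    using weierstrass_primitive_exists[OF holomorphic_G holomorphic_\<Psi>] by blast
  have "P j holomorphic_on UNIV" for j
    using P(1) by (auto simp: holomorphic_on_open)
  then have "smooth_on UNIV (\<lambda>u. Re (P j (plane_complex u) - P j b))" for j
    by (intro smooth_intros open_UNIV smooth_on_plane_holomorphic)
  then show ?thesis by (intro smooth_on_vec_lambda) (simp_all only: P(2) vec_lambda_beta open_UNIV)
qed

lemma isotropic: "(\<omega> 1 z)\<^sup>2 + (\<omega> 2 z)\<^sup>2 + (\<omega> 3 z)\<^sup>2 = 0"
proof -
  have "(1/2 * (1 - g\<^sup>2) * p)\<^sup>2 + (\<i>/2 * (1 + g\<^sup>2) * p)\<^sup>2 + (g * p)\<^sup>2 = 0" for g p :: complex
  proof -
    have "(\<i>/2 * (1 + g\<^sup>2) * p)\<^sup>2 = - (1/2 * (1 + g\<^sup>2) * p)\<^sup>2"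
      by (simp add: power_mult_distrib power_divide)
    then show ?thesis by (simp add: power2_eq_square field_simps)
  qed
  then show ?thesis unfolding weierstrass_integrand_components .
qed

definition conformal_factor :: "complex \<Rightarrow> real" where
  "conformal_factor z = (norm (\<omega> 1 z))\<^sup>2 / 2 + (norm (\<omega> 2 z))\<^sup>2 / 2 + (norm (\<omega> 3 z))\<^sup>2 / 2"

lemma conformal_factor_pos: "conformal_factor z > 0"
proof (rule ccontr)
  assume "\<not> ?thesis"
  then have "(norm (\<omega> 1 z))\<^sup>2 + (norm (\<omega> 2 z))\<^sup>2 + (norm (\<omega> 3 z))\<^sup>2 \<le> 0"
    by (simp add: conformal_factor_def)
  then have "(norm (\<omega> 1 z))\<^sup>2 = 0" "(norm (\<omega> 3 z))\<^sup>2 = 0"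
    using zero_le_power2[of "norm (\<omega> 1 z)"] zero_le_power2[of "norm (\<omega> 2 z)"] zero_le_power2[of
        "norm (\<omega> 3 z)"] by linarith+
  then show False using nonzero[of z] by (simp add: weierstrass_integrand_components)
qed

lemma induced_metric_weierstrass:
  "induced_metric (\<lambda>u. weierstrass_surface G \<Psi> b (plane_complex u)) u
    = (\<chi> i j. if i = j then conformal_factor (plane_complex u) else 0)"
proof -
  let ?z = "plane_complex u"
  let ?w = "\<lambda>j. \<omega> j ?z"
  have re: "(Re (?w 1))\<^sup>2 + (Re (?w 2))\<^sup>2 + (Re (?w 3))\<^sup>2
      = (Im (?w 1))\<^sup>2 + (Im (?w 2))\<^sup>2 + (Im (?w 3))\<^sup>2"
    using arg_cong[OF isotropic[of ?z], of Re] by (simp add: power2_eq_square)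
  have im: "Re (?w 1) * Im (?w 1) + Re (?w 2) * Im (?w 2) + Re (?w 3) * Im (?w 3) = 0"
    using arg_cong[OF isotropic[of ?z], of Im]
    by (simp add: power2_eq_square mult.commute[of "Im (?w 1)" "Re (?w 1)"]
        mult.commute[of "Im (?w 2)" "Re (?w 2)"] mult.commute[of "Im (?w 3)" "Re (?w 3)"])
  have cf: "conformal_factor ?z = (Re (?w 1))\<^sup>2 + (Re (?w 2))\<^sup>2 + (Re (?w 3))\<^sup>2"
    using re unfolding conformal_factor_def cmod_power2 by (simp add: field_simps)
  have 11: "(\<chi> j. Re (?w j)) \<bullet> (\<chi> j. Re (?w j)) = conformal_factor ?z"
    and 12: "(\<chi> j. Re (?w j)) \<bullet> (\<chi> j. Re (?w j * \<i>)) = 0"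
    and 22: "(\<chi> j. Re (?w j * \<i>)) \<bullet> (\<chi> j. Re (?w j * \<i>)) = conformal_factor ?z"
    using re im unfolding cf by (simp_all add: inner_vec_def sum_3 power2_eq_square)
  show ?thesis
    unfolding induced_metric_def partial_weierstrass vec_eq_iff forall_2
    using 11 12 22 inner_commute[of "\<chi> j. Re (?w j)" "\<chi> j. Re (?w j * \<i>)"]
    by (simp only: vec_lambda_beta if_True if_False one_neq_zero simp_thms num1_eq1 mult_1_right
        refl) simp
qed

lemma cross_partials_nonzero:
  "partial 1 (\<lambda>u. weierstrass_surface G \<Psi> b (plane_complex u)) u \<times>
   partial 2 (\<lambda>u. weierstrass_surface G \<Psi> b (plane_complex u)) u \<noteq> 0"
proof -
  let ?Y = "\<lambda>u. weierstrass_surface G \<Psi> b (plane_complex u)"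
  have "(partial 1 ?Y u \<times> partial 2 ?Y u) \<bullet> (partial 1 ?Y u \<times> partial 2 ?Y u)
      = (conformal_factor (plane_complex u))\<^sup>2"
    using induced_metric_weierstrass[of b u]
    by (simp add: dot_cross_cross induced_metric_def vec_eq_iff forall_2 power2_eq_square)
  then show ?thesis using conformal_factor_pos[of "plane_complex u"] by force
qed

lemma normal_unit: "norm (weierstrass_normal G z) = 1"
proof -
  have *: "(2 * x)\<^sup>2 + (2 * y)\<^sup>2 + ((x\<^sup>2 + y\<^sup>2) - 1)\<^sup>2 = (1 + (x\<^sup>2 + y\<^sup>2))\<^sup>2" for x y :: real
    by (simp add: power2_eq_square algebra_simps)
  have "(norm (vector [a, b, c] :: real^3))\<^sup>2 = a\<^sup>2 + b\<^sup>2 + c\<^sup>2" for a b c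
    unfolding power2_norm_eq_inner inner_vec_def sum_3 vector_3 by (simp add: power2_eq_square)
  from this[of "2 * Re (G z)" "2 * Im (G z)" "(norm (G z))\<^sup>2 - 1"]
  have "(norm (vector [2 * Re (G z), 2 * Im (G z), (norm (G z))\<^sup>2 - 1] :: real^3))\<^sup>2
      = (1 + (norm (G z))\<^sup>2)\<^sup>2"
    using *[of "Re (G z)" "Im (G z)"] unfolding cmod_power2 by simp
  then have "norm (vector [2 * Re (G z), 2 * Im (G z), (norm (G z))\<^sup>2 - 1] :: real^3)
      = 1 + (norm (G z))\<^sup>2"
    by (rule power2_eq_imp_eq) auto
  then show ?thesis using zero_le_power2[of "norm (G z)"]
    by (simp add: weierstrass_normal_def add_nonneg_eq_0_iff)
qed

text \<open>The real and the imaginary part of this equation are orthogonality to the two partial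
  derivatives.\<close>

lemma normal_orthogonal: "(\<Sum>j\<in>UNIV. of_real (weierstrass_normal G z $ j) * \<omega> j z) = 0"
proof -
  have "of_real (2 * x) * (1/2 * (1 - (Complex x y)\<^sup>2) * p) + of_real (2 * y) * (\<i>/2 * (1
      + (Complex x y)\<^sup>2) * p)
     + of_real ((x\<^sup>2 + y\<^sup>2) - 1) * (Complex x y * p) = 0" for x y p
    by (simp add: complex_eq_iff power2_eq_square) algebra
  from this[of "Re (G z)" "Im (G z)" "\<Psi> z"]
  have "of_real (2 * Re (G z)) * \<omega> 1 z + of_real (2 * Im (G z)) * \<omega> 2 z + of_real ((norm (G z))\<^sup>2
      - 1) * \<omega> 3 z = 0"
    by (simp add: weierstrass_integrand_components cmod_power2)
  then have "of_real (1 / (1 + (norm (G z))\<^sup>2)) * (of_real (2 * Re (G z)) * \<omega> 1 z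
      + of_real (2 * Im (G z)) * \<omega> 2 z
      + of_real ((norm (G z))\<^sup>2 - 1) * \<omega> 3 z) = 0" by simp
  then show ?thesis
    by (simp add: sum_3 weierstrass_normal_def vector_3 distrib_left mult.assoc)
qed

lemma weierstrass_patch:
  "surface_patch UNIV (\<lambda>u. weierstrass_surface G \<Psi> b (plane_complex u)) (\<lambda>u. weierstrass_normal G
      (plane_complex u))"
proof
  let ?Y = "\<lambda>u. weierstrass_surface G \<Psi> b (plane_complex u)"
  show "smooth_on UNIV ?Y" by (rule smooth_weierstrass)
  have g: "smooth_on UNIV (\<lambda>u. G (plane_complex u))"
    by (rule smooth_on_plane_holomorphic[OF holomorphic_G])
  have n: "smooth_on UNIV (\<lambda>u. (norm (G (plane_complex u)))\<^sup>2)"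
    unfolding cmod_power2 by (intro smooth_intros open_UNIV g)
  have "smooth_on UNIV (\<lambda>u. vector [2 * Re (G (plane_complex u)), 2 * Im (G (plane_complex u)),
      (norm (G (plane_complex u)))\<^sup>2 - 1] $ i)"
    for i :: 3
  proof -
    consider "i = 1" | "i = 2" | "i = 3" using exhaust_3 by blast
    then show ?thesis by cases (simp_all only: vector_3, (intro smooth_intros open_UNIV g n)+)
  qed
  then have "smooth_on UNIV (\<lambda>u. vector [2 * Re (G (plane_complex u)), 2 * Im (G (plane_complex u)),
      (norm (G (plane_complex u)))\<^sup>2 - 1] :: real^3)"
    by (rule smooth_on_vec_lambda[OF open_UNIV])
  moreover have "1 + (norm (G z))\<^sup>2 \<noteq> 0" for z
    using zero_le_power2[of "norm (G z)"] by linarith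
  ultimately show "smooth_on UNIV (\<lambda>u. weierstrass_normal G (plane_complex u))"
    unfolding weierstrass_normal_def
    by (intro smooth_on_scaleR smooth_on_divide_real smooth_on_add smooth_on_const open_UNIV n)
  fix u :: "real^2"
  show "inj (frechet_derivative ?Y (at u))"
    unfolding inj_plane_iff_cross[OF has_derivative_linear[OF smooth_on_has_derivative[OF
        smooth_weierstrass UNIV_I]]]
      partial_def[symmetric] by (rule cross_partials_nonzero)
  show "weierstrass_normal G (plane_complex u) \<bullet> partial i ?Y u = 0" for i
  proof -
    have "weierstrass_normal G (plane_complex u) \<bullet> partial i ?Y u
       = Re ((\<Sum>j\<in>UNIV. of_real (weierstrass_normal G (plane_complex u) $ j) * \<omega> j (plane_complex u))
           * dir i)"
      unfolding partial_weierstrass inner_vec_def by (simp add: sum_distrib_right mult.assoc)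
    then show ?thesis unfolding normal_orthogonal by simp
  qed
qed (use normal_unit in auto)

text \<open>In conformal coordinates the mean curvature is a multiple of the normal part of the coordinate
  Laplacian, and the coordinates of the Weierstrass map are harmonic.\<close>

lemma weierstrass_minimal:
  "mean_curvature (\<lambda>u. weierstrass_surface G \<Psi> b (plane_complex u)) (\<lambda>u. weierstrass_normal G
      (plane_complex u)) u = 0"
proof -
  let ?Y = "\<lambda>u. weierstrass_surface G \<Psi> b (plane_complex u)"
  interpret surface_patch UNIV ?Y "\<lambda>u. weierstrass_normal G (plane_complex u)"
    by (rule weierstrass_patch)
  have "partial i (partial i ?Y) u $ k = Re (deriv (\<omega> k) (plane_complex u) * dir i * dir i)" for i k
  proof -
    have hd: "(\<omega> k has_field_derivative deriv (\<omega> k) (plane_complex u)) (at (plane_complex u))"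
      by (rule holomorphic_derivI[OF weierstrass_integrand_holomorphic[OF holomorphic_G
          holomorphic_\<Psi>] open_UNIV UNIV_I])
    have dd: "(\<lambda>u. \<omega> k (plane_complex u)) differentiable (at u)"
      by (rule smooth_on_differentiable[OF smooth_on_plane_holomorphic[OF
          weierstrass_integrand_holomorphic[OF holomorphic_G holomorphic_\<Psi>]] UNIV_I])
    have "partial i (partial i ?Y) u $ k = partial i (\<lambda>u. partial i ?Y u $ k) u"
      by (rule partial_nth[symmetric, OF partial_differentiable[OF UNIV_I]])
    also have "\<dots> = partial i (\<lambda>u. Re (\<omega> k (plane_complex u) * dir i)) u"
      unfolding partial_weierstrass by simp
    also have "\<dots> = Re (partial i (\<lambda>u. \<omega> k (plane_complex u)) u * dir i)"
      by (rule partial_linear[OF bounded_linear_compose[OF bounded_linear_Re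
          bounded_linear_mult_left] dd])
    finally show ?thesis unfolding partial_plane_holomorphic[OF hd] .
  qed
  then have "partial 1 (partial 1 ?Y) u + partial 2 (partial 2 ?Y) u = 0"
    by (simp add: vec_eq_iff)
  then have "partial 2 (partial 2 ?Y) u = - partial 1 (partial 1 ?Y) u"
    by (simp add: add_eq_0_iff)
  moreover have "det (g u) \<noteq> 0" using det_metric_pos[of u] by simp
  ultimately show ?thesis
    unfolding mean_curvature_def sum_2
    by (simp add: matrix_inv_2) (simp add: induced_metric_weierstrass)
qed

end

text \<open>Multiplying \<open>\<Psi>\<close> by a unit complex number changes neither the normal nor the metric, so it
  changes neither the curvature nor the angle function.\<close>

lemma associate_const_CR2:
  assumes "weierstrass_data G \<Psi>" "const_CR2_surface euclidean plane_atlas (weierstrass_surface G \<Psi>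
      b0) N0" "norm e = 1"
  shows "const_CR2_surface euclidean plane_atlas (weierstrass_surface G (\<lambda>z. e * \<Psi> z) b)
      (weierstrass_normal G)"
proof -
  interpret d: weierstrass_data G \<Psi> by fact
  interpret d': weierstrass_data G "\<lambda>z. e * \<Psi> z"
    by unfold_locales (use d.holomorphic_G d.holomorphic_\<Psi> d.nonzero assms(3) in
        \<open>auto intro!: holomorphic_intros\<close>)
  let ?Y = "weierstrass_surface G \<Psi> b0" and ?Y' = "weierstrass_surface G (\<lambda>z. e * \<Psi> z) b"
      and ?n = "weierstrass_normal G"
  obtain V where V: "CR2_admissible euclidean plane_atlas ?Y N0 V" "CR2 plane_atlas ?Y N0 V
      constant_on UNIV"
    using assms(2) unfolding const_CR2_surface_def by auto
  interpret directed_minimal_surface euclidean plane_atlas ?Y N0 V by unfold_locales (rule V(1))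
  have chart: "(UNIV, plane_complex) \<in> plane_atlas" by (simp add: plane_atlas_def)
  have patch': "surface_patch D (?Y' \<circ> x) (?n \<circ> x)" if "(D, x) \<in> plane_atlas" for D x
    using that d'.weierstrass_patch by (auto simp: plane_atlas_def o_def)
  have imm': "immersion plane_atlas ?Y'" "unit_normal plane_atlas ?Y' ?n"
    by (rule immersion_unit_normalI, erule patch')+
  have "weierstrass_integrand G (\<lambda>z. e * \<Psi> z) j z = e * d.\<omega> j z" for j z
    by (simp add: weierstrass_integrand_def)
  then have "d'.conformal_factor = d.conformal_factor"
    by (simp add: fun_eq_iff d.conformal_factor_def d'.conformal_factor_def norm_mult assms(3))
  then have metric: "induced_metric (?Y' \<circ> plane_complex) = induced_metric (?Y \<circ> plane_complex)"
    by (simp add: fun_eq_iff o_def d.induced_metric_weierstrass d'.induced_metric_weierstrass)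
  have K: "gauss_curvature plane_atlas ?Y' z = gauss_curvature plane_atlas ?Y z" for z
  proof -
    define u :: "real^2" where "u = vector [Re z, Im z]"
    have z: "plane_complex u = z" unfolding u_def by (rule plane_complex_vector)
    show ?thesis
      using gauss_curvature_chart[OF oriented_surface_plane imm' chart UNIV_I, of u]
        gauss_curvature_chart[OF oriented_surface_plane surface_immersion surface_normal chart
            UNIV_I, of u]
      unfolding metric z by simp
  qed
  have N: "(angle_function ?n V z)\<^sup>2 = (angle_function N0 V z)\<^sup>2" for z
  proof -
    define u :: "real^2" where "u = vector [Re z, Im z]"
    have z: "plane_complex u = z" unfolding u_def by (rule plane_complex_vector)
    let ?F = "?Y \<circ> plane_complex"
    interpret s: surface_patch UNIV ?F "N0 \<circ> plane_complex"
      by (rule surface_patch_chart[OF oriented_surface_plane surface_immersion surface_normal chart])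
    interpret t: surface_patch UNIV ?F "?n \<circ> plane_complex"
      using d.weierstrass_patch[of b0] by (simp add: o_def)
    have "(s.signed_area u)\<^sup>2 = (t.signed_area u)\<^sup>2"
      by (simp add: s.signed_area_square t.signed_area_square)
    moreover have "s.signed_area u *\<^sub>R N0 z = t.signed_area u *\<^sub>R ?n z"
      using s.normal_cross[of u] t.normal_cross[of u] by (simp add: z)
    from arg_cong[OF this, of "\<lambda>w. (w \<bullet> V)\<^sup>2"]
    have "(s.signed_area u)\<^sup>2 * (N0 z \<bullet> V)\<^sup>2 = (t.signed_area u)\<^sup>2 * (?n z \<bullet> V)\<^sup>2"
      by (simp add: power_mult_distrib)
    ultimately show ?thesis
      using t.signed_area_nonzero[of u] by (simp add: angle_function_def)
  qed
  have "-1 < angle_function ?n V z \<and> angle_function ?n V z < 1" for z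
  proof -
    have "(angle_function ?n V z)\<^sup>2 < 1"
      unfolding N using V(1) by (simp add: CR2_admissible_def abs_square_less_1 abs_less_iff
          minus_less_iff)
    then show ?thesis by (simp add: abs_square_less_1 abs_less_iff minus_less_iff)
  qed
  moreover have "mean_curvature (?Y' \<circ> plane_complex) (?n \<circ> plane_complex) u = 0" for u
    using d'.weierstrass_minimal by (simp add: o_def)
  then have "minimal_surface euclidean plane_atlas ?Y' ?n"
    unfolding minimal_surface_def using oriented_surface_plane surface_connected imm'
    by (auto simp: plane_atlas_def)
  ultimately have "CR2_admissible euclidean plane_atlas ?Y' ?n V"
    using V(1) K by (simp add: CR2_admissible_def)
  moreover have "CR2 plane_atlas ?Y' ?n V constant_on UNIV"
    using V(2) by (simp add: constant_on_def CR2_def K N)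
  ultimately show ?thesis
    unfolding const_CR2_surface_def by auto
qed

section \<open>Catenoids and helicoids\<close>

lemma vector_3_eq: "vector [x, y, z] = x *\<^sub>R axis 1 1 + y *\<^sub>R axis 2 1 + z *\<^sub>R (axis 3 1 :: real^3)"
  by (simp add: vec_eq_iff forall_3 axis_def vector_3)

lemma has_vector_derivative_vector_3:
  assumes "(f1 has_real_derivative d1) (at t)" "(f2 has_real_derivative d2) (at t)" "(f3
      has_real_derivative d3) (at t)"
  shows "((\<lambda>t. vector [f1 t, f2 t, f3 t] :: real^3) has_vector_derivative vector [d1, d2, d3]) (at t)"
proof -
  have sc: "((\<lambda>t. f t *\<^sub>R v) has_vector_derivative d *\<^sub>R v) (at t)"
    if "(f has_real_derivative d) (at t)" for f d and v :: "real^3"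
    using has_vector_derivative_scaleR[OF that has_vector_derivative_const] by simp
  then show ?thesis
    unfolding vector_3_eq by (intro has_vector_derivative_add sc assms)
qed

lemma continuous_on_vector_3:
  "continuous_on S f1 \<Longrightarrow> continuous_on S f2 \<Longrightarrow> continuous_on S f3 \<Longrightarrow>
      continuous_on S (\<lambda>t. vector [f1 t, f2 t, f3 t] :: real^3)"
  unfolding vector_3_eq by (intro continuous_intros)

lemma smooth_on_vector_3:
  "open S \<Longrightarrow> smooth_on S f1 \<Longrightarrow> smooth_on S f2 \<Longrightarrow> smooth_on S f3 \<Longrightarrow>
      smooth_on S (\<lambda>t. vector [f1 t, f2 t, f3 t] :: real^3)"
  unfolding vector_3_eq by (intro smooth_intros)

text \<open>Derivatives of the explicit normal fields are computed along coordinate curves of the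
  surfaces, on which the normals have simple expressions.\<close>

lemma frechet_derivative_along_curve:
  fixes \<nu> :: "real^3 \<Rightarrow> real^3"
  assumes "smooth_on UNIV \<nu>" "(\<gamma> has_vector_derivative v) (at t)" "((\<lambda>t. \<nu> (\<gamma> t))
      has_vector_derivative w) (at t)"
  shows "frechet_derivative \<nu> (at (\<gamma> t)) v = w"
proof -
  have d: "(\<nu> has_derivative frechet_derivative \<nu> (at (\<gamma> t))) (at (\<gamma> t))"
    by (rule smooth_on_has_derivative[OF assms(1) UNIV_I])
  have "((\<lambda>t. \<nu> (\<gamma> t)) has_derivative (\<lambda>h. frechet_derivative \<nu> (at (\<gamma> t)) (h *\<^sub>R v))) (at t)"
    using diff_chain_at[OF assms(2)[unfolded has_vector_derivative_def] d] by (simp add: o_def)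
  then have "((\<lambda>t. \<nu> (\<gamma> t)) has_vector_derivative frechet_derivative \<nu> (at (\<gamma> t)) v) (at t)"
    unfolding has_vector_derivative_def by (simp add: linear_cmul[OF has_derivative_linear[OF d]])
  then show ?thesis using assms(3) by (rule vector_derivative_unique_at)
qed

lemma has_derivative_nth_compose:
  fixes p :: "real^3"
  assumes "(\<phi> has_real_derivative d) (at (p$i))"
  shows "((\<lambda>p. \<phi> (p$i)) has_derivative (\<lambda>h. h$i * d)) (at p)"
  using DERIV_compose_FDERIV[OF assms bounded_linear_imp_has_derivative[OF bounded_linear_vec_nth]] .

lemma has_derivative_nth: "((\<lambda>p. p$i) has_derivative (\<lambda>h. h$i)) (at p)" for p :: "real^3"
  by (rule bounded_linear_imp_has_derivative[OF bounded_linear_vec_nth])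

lemma smooth_on_cosh: "open S \<Longrightarrow> smooth_on S f \<Longrightarrow> smooth_on S (\<lambda>u. cosh (f u :: real))"
  unfolding cosh_def by (intro smooth_intros smooth_on_exp_real)

lemma smooth_on_sinh: "open S \<Longrightarrow> smooth_on S f \<Longrightarrow> smooth_on S (\<lambda>u. sinh (f u :: real))"
  unfolding sinh_def by (intro smooth_intros smooth_on_exp_real)

lemma neg_inverse_powr: "x > 0 \<Longrightarrow> (1 / x\<^sup>2) powr (-1/2) = x" for x :: real
proof -
  assume "x > 0"
  have "(1 / x\<^sup>2) powr (-1/2) = inverse ((1 / x\<^sup>2) powr (1/2))"
    using powr_minus[of "1 / x\<^sup>2" "1/2"] by simp
  also have "(1 / x\<^sup>2) powr (1/2) = 1 / x"
    using \<open>x > 0\<close> by (simp add: powr_half_sqrt real_sqrt_divide)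
  finally show ?thesis using \<open>x > 0\<close> by simp
qed

subsection \<open>The catenoid\<close>

definition catenoid :: "real \<Rightarrow> (real^3) set" where
  "catenoid a = {p. (p$1)\<^sup>2 + (p$2)\<^sup>2 = (a * cosh (p$3 / a))\<^sup>2}"

definition catenoid_param :: "real \<Rightarrow> complex \<Rightarrow> real^3" where
  "catenoid_param a z = vector [a * cosh (Re z) * cos (Im z), a * cosh (Re z) * sin (Im z), a * Re z]"

text \<open>On the catenoid this is the unit normal; off the surface only smoothness matters. It is the
  gradient of \<open>x\<^sup>2 + y\<^sup>2 - a\<^sup>2 cosh\<^sup>2 (z / a)\<close>, divided by \<open>2 a cosh\<^sup>2 (z / a)\<close>.\<close>

definition catenoid_normal :: "real \<Rightarrow> real^3 \<Rightarrow> real^3" where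
  "catenoid_normal a p = vector [p$1 / (a * (cosh (p$3 / a))\<^sup>2), p$2 / (a * (cosh (p$3 / a))\<^sup>2),
      - sinh (p$3 / a) / cosh (p$3 / a)]"

lemma catenoid_param_surj:
  assumes "a > 0" "p \<in> catenoid a"
  obtains x y where "p = catenoid_param a (Complex x y)"
proof -
  let ?r = "a * cosh (p$3 / a)"
  have r: "?r > 0" using assms(1) by simp
  have "(p$1 / ?r)\<^sup>2 + (p$2 / ?r)\<^sup>2 = 1"
    using assms r by (simp add: catenoid_def power_divide add_divide_distrib[symmetric])
  then obtain y where "p$1 / ?r = cos y" "p$2 / ?r = sin y" by (rule sincos_total_2pi)
  moreover have "u = r * c" if "u / r = c" "r > 0" for u r c :: real
    using that by (simp add: field_simps)
  ultimately have "p$1 = ?r * cos y" "p$2 = ?r * sin y" using r by blast+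
  then have "p = catenoid_param a (Complex (p$3 / a) y)"
    using assms(1) by (simp add: catenoid_param_def vec_eq_iff forall_3 vector_3)
  then show thesis by (rule that)
qed

lemma catenoid_normal_param:
  "a > 0 \<Longrightarrow> catenoid_normal a (catenoid_param a z)
      = vector [cos (Im z) / cosh (Re z), sin (Im z) / cosh (Re z), - sinh (Re z) / cosh (Re z)]"
  by (simp add: catenoid_normal_def catenoid_param_def vector_3 power2_eq_square)

lemma smooth_catenoid_normal: "a > 0 \<Longrightarrow> smooth_on UNIV (catenoid_normal a)"
  unfolding catenoid_normal_def[abs_def]
  by (intro smooth_on_vector_3 smooth_on_divide_real smooth_on_minus smooth_on_mult smooth_on_power
      smooth_on_const
      smooth_on_nth smooth_on_ident smooth_on_cosh smooth_on_sinh open_UNIV) auto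

text \<open>The principal curvatures are \<open>\<plusminus> 1 / (a cosh\<^sup>2)\<close> and \<open>1 - \<nu>\<^sub>3\<^sup>2 = 1 / cosh\<^sup>2\<close>, so that the
  hyperbolic cosines cancel in the Chern-Ricci function.\<close>

lemma catenoid_explicit:
  assumes "a > 0"
  shows "explicit_surface (catenoid a) (catenoid_normal a) (axis 3 1)
    (\<lambda>p. (p$1)\<^sup>2 + (p$2)\<^sup>2 - (a * cosh (p$3 / a))\<^sup>2) (\<lambda>p. 2 * a * (cosh (p$3 / a))\<^sup>2)
    (\<lambda>p. - 1 / (a * (cosh (p$3 / a))\<^sup>2)\<^sup>2) a"
proof
  show "norm (axis 3 1 :: real^3) = 1" by simp
  show "smooth_on UNIV (catenoid_normal a)" by (rule smooth_catenoid_normal[OF assms])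
  fix p assume p: "p \<in> catenoid a"
  then obtain x y where xy: "p = catenoid_param a (Complex x y)" using catenoid_param_surj[OF assms]
    by blast
  have p3: "p$3 / a = x" using assms by (simp add: xy catenoid_param_def vector_3)
  have n: "catenoid_normal a p = vector [cos y / cosh x, sin y / cosh x, - sinh x / cosh x]"
    using catenoid_normal_param[OF assms, of "Complex x y"] by (simp add: xy)
  have ch: "(cosh x)\<^sup>2 = 1 + (sinh x)\<^sup>2" by (simp add: cosh_square_eq)
  have c0: "cosh x > 0" by simp
  have nV: "1 - (catenoid_normal a p \<bullet> axis 3 1)\<^sup>2 = 1 / (cosh x)\<^sup>2"
    unfolding n by (simp add: inner_axis vector_3 power_divide sinh_square_eq diff_divide_distrib)
  show "2 * a * (cosh (p$3 / a))\<^sup>2 \<noteq> 0" "- 1 / (a * (cosh (p$3 / a))\<^sup>2)\<^sup>2 < 0" using assms by simp_all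
  show "(p$1)\<^sup>2 + (p$2)\<^sup>2 - (a * cosh (p$3 / a))\<^sup>2 = 0" using p by (simp add: catenoid_def)
  show "norm (catenoid_normal a p) = 1"
  proof -
    have s: "(cos y)\<^sup>2 + (sin y)\<^sup>2 + (sinh x)\<^sup>2 = (cosh x)\<^sup>2" using ch by simp
    have "(cos y / cosh x)\<^sup>2 + (sin y / cosh x)\<^sup>2 + (- sinh x / cosh x)\<^sup>2 = 1"
      unfolding power_divide power2_minus add_divide_distrib[symmetric] s using c0 by simp
    then show ?thesis by (simp add: n norm_eq_1 inner_vec_def sum_3 vector_3 power2_eq_square)
  qed
  have lt: "1 / (cosh x)\<^sup>2 > 0" by simp
  then have "(catenoid_normal a p \<bullet> axis 3 1)\<^sup>2 < 1" using nV by linarith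
  then show "- 1 < catenoid_normal a p \<bullet> axis 3 1 \<and> catenoid_normal a p \<bullet> axis 3 1 < 1"
    by (simp add: abs_square_less_1 abs_less_iff minus_less_iff)
  show "(- (- 1 / (a * (cosh (p$3 / a))\<^sup>2)\<^sup>2)) powr (- 1 / 2) * (1
      - (catenoid_normal a p \<bullet> axis 3 1)\<^sup>2) = a"
  proof -
    have "(1 / (a * (cosh x)\<^sup>2)\<^sup>2) powr (-1/2) = a * (cosh x)\<^sup>2"
      by (rule neg_inverse_powr) (use assms c0 in simp)
    then show ?thesis unfolding nV p3 by simp
  qed
  have "((\<lambda>t. t\<^sup>2) has_real_derivative 2 * s) (at s)" for s :: real
    by (auto intro!: derivative_eq_intros)
  moreover have "((\<lambda>t. (a * cosh (t / a))\<^sup>2) has_real_derivative 2 * (a * cosh (s / a)) * sinh (s /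
      a)) (at s)" for s
    using assms by (auto intro!: derivative_eq_intros)
  ultimately have "((\<lambda>p. (p$1)\<^sup>2 + (p$2)\<^sup>2 - (a * cosh (p$3 / a))\<^sup>2) has_derivative
      (\<lambda>h. h$1 * (2 * p$1) + h$2 * (2 * p$2)
          - h$3 * (2 * (a * cosh (p$3 / a)) * sinh (p$3 / a)))) (at p)"
    by (intro has_derivative_add has_derivative_diff has_derivative_nth_compose[of "\<lambda>t. t\<^sup>2"]
        has_derivative_nth_compose[of "\<lambda>t. (a * cosh (t / a))\<^sup>2"])
  moreover have "(\<lambda>h. h$1 * (2 * p$1) + h$2 * (2 * p$2)
      - h$3 * (2 * (a * cosh (p$3 / a)) * sinh (p$3 / a)))
      = (\<lambda>h. 2 * a * (cosh (p$3 / a))\<^sup>2 * (catenoid_normal a p \<bullet> h))"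
  proof
    fix h :: "real^3"
    have "h$1 * (2 * u) + h$2 * (2 * v) - h$3 * (2 * (a * C) * S)
        = 2 * a * C\<^sup>2 * (u / (a * C\<^sup>2) * h$1 + v / (a * C\<^sup>2) * h$2 + - S / C * h$3)" if "C > 0"
            for u v C S
      using that assms by (simp add: field_simps power2_eq_square)
    then show "h$1 * (2 * p$1) + h$2 * (2 * p$2) - h$3 * (2 * (a * cosh (p$3 / a)) * sinh (p$3 / a))
      = 2 * a * (cosh (p$3 / a))\<^sup>2 * (catenoid_normal a p \<bullet> h)"
      by (simp only: catenoid_normal_def inner_vec_def sum_3 vector_3 inner_real_def cosh_real_pos)
  qed
  ultimately show "((\<lambda>p. (p$1)\<^sup>2 + (p$2)\<^sup>2 - (a * cosh (p$3 / a))\<^sup>2) has_derivative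
      (\<lambda>h. 2 * a * (cosh (p$3 / a))\<^sup>2 * (catenoid_normal a p \<bullet> h))) (at p)" by simp
  \<comment> \<open>the meridian and the parallel are the principal directions\<close>
  let ?T1 = "vector [a * sinh x * cos y, a * sinh x * sin y, a] :: real^3"
  let ?T2 = "vector [- a * cosh x * sin y, a * cosh x * cos y, 0] :: real^3"
  let ?k = "1 / (a * (cosh x)\<^sup>2)"
  have D1: "frechet_derivative (catenoid_normal a) (at p) ?T1 = (- ?k) *\<^sub>R ?T1"
  proof -
    have 1: "((\<lambda>s. catenoid_param a (Complex s y)) has_vector_derivative ?T1) (at x)"
      unfolding catenoid_param_def complex.sel
      by (rule has_vector_derivative_vector_3) (auto intro!: derivative_eq_intros)
    have 2: "((\<lambda>s. catenoid_normal a (catenoid_param a (Complex s y))) has_vector_derivative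
        vector [- cos y * sinh x / (cosh x)\<^sup>2, - sin y * sinh x / (cosh x)\<^sup>2,
            - 1 / (cosh x)\<^sup>2]) (at x)"
      unfolding catenoid_normal_param[OF assms] complex.sel
      by (rule has_vector_derivative_vector_3)
         (auto intro!: derivative_eq_intros simp: power2_eq_square[symmetric] ch)
    show ?thesis
      using frechet_derivative_along_curve[OF smooth_catenoid_normal[OF assms] 1 2] assms
      by (simp add: xy vec_eq_iff forall_3 vector_3)
  qed
  have D2: "frechet_derivative (catenoid_normal a) (at p) ?T2 = ?k *\<^sub>R ?T2"
  proof -
    have 1: "((\<lambda>s. catenoid_param a (Complex x s)) has_vector_derivative ?T2) (at y)"
      unfolding catenoid_param_def complex.sel
      by (rule has_vector_derivative_vector_3) (auto intro!: derivative_eq_intros)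
    have 2: "((\<lambda>s. catenoid_normal a (catenoid_param a (Complex x s))) has_vector_derivative
        vector [- sin y / cosh x, cos y / cosh x, 0]) (at y)"
      unfolding catenoid_normal_param[OF assms] complex.sel
      by (rule has_vector_derivative_vector_3) (auto intro!: derivative_eq_intros)
    show ?thesis
      using frechet_derivative_along_curve[OF smooth_catenoid_normal[OF assms] 1 2] assms
      by (simp add: xy vec_eq_iff forall_3 vector_3 power2_eq_square)
  qed
  have o1: "catenoid_normal a p \<bullet> ?T1 = 0"
  proof -
    have "c / C * (a * S * c) + s / C * (a * S * s) + (- S / C) * a = a * S / C * (c\<^sup>2 + s\<^sup>2 - 1)"
        for c s C S
      by (simp add: power2_eq_square algebra_simps)
    then show ?thesis unfolding n inner_vec_def sum_3 vector_3 inner_real_def by simp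
  qed
  have o2: "catenoid_normal a p \<bullet> ?T2 = 0"
    by (simp add: n inner_vec_def sum_3 vector_3)
  have nz: "?T1 \<times> ?T2 \<noteq> 0"
  proof
    assume "?T1 \<times> ?T2 = 0"
    then have "(?T1 \<times> ?T2) $ 1 = 0" "(?T1 \<times> ?T2) $ 2 = 0" by simp_all
    then have "cos y = 0" "sin y = 0" using assms by (simp_all add: cross3_def vector_3)
    then show False using sin_cos_squared_add[of y] by simp
  qed
  show "\<exists>T1 T2 \<alpha> \<beta> \<gamma>. catenoid_normal a p \<bullet> T1 = 0 \<and> catenoid_normal a p \<bullet> T2 = 0 \<and> T1 \<times> T2 \<noteq> 0 \<and>
      frechet_derivative (catenoid_normal a) (at p) T1 = \<alpha> *\<^sub>R T1 + \<beta> *\<^sub>R T2 \<and>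
      frechet_derivative (catenoid_normal a) (at p) T2 = \<gamma> *\<^sub>R T1 - \<alpha> *\<^sub>R T2 \<and>
      - 1 / (a * (cosh (p$3 / a))\<^sup>2)\<^sup>2 = - \<alpha>\<^sup>2 - \<beta> * \<gamma>"
    by (rule exI[of _ ?T1], rule exI[of _ ?T2], rule exI[of _ "- ?k"], rule exI[of _ 0], rule exI[of
        _ 0])
       (use o1 o2 nz D1 D2 in \<open>simp add: p3 power_divide\<close>)
qed

text \<open>In polar coordinates \<open>w = e\<^sup>z\<close> the catenoid is a copy of the punctured plane, so that its
  parametrization is a covering because the exponential function is.\<close>

lemma catenoid_param_covering:
  assumes "a > 0"
  defines "h \<equiv> \<lambda>w. vector [a * cosh (ln (norm w)) * (Re w / norm w), a * cosh (ln (norm w)) * (Im w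
      / norm w), a * ln (norm w)] :: real^3"
  shows "catenoid_param a z = h (exp z)"
    and "\<exists>k. homeomorphism (- {0}) (catenoid a) h k"
proof -
  show "catenoid_param a z = h (exp z)"
    by (simp add: catenoid_param_def h_def Re_exp Im_exp mult.assoc)
  define k where "k p = of_real (exp (p$3 / a) / (a * cosh (p$3 / a))) * Complex (p$1) (p$2)"
      for p :: "real^3"
  have "homeomorphism (- {0}) (catenoid a) h k"
  proof (rule homeomorphismI)
    show "continuous_on (- {0}) h"
      unfolding h_def by (intro continuous_on_vector_3 continuous_intros) auto
    show "continuous_on (catenoid a) k"
      unfolding k_def Complex_eq using assms(1) by (intro continuous_intros) auto
    show "h ` (- {0}) \<subseteq> catenoid a"
    proof (rule image_subsetI)
      fix w :: complex assume "w \<in> - {0}"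
      then have "(Re w / norm w)\<^sup>2 + (Im w / norm w)\<^sup>2 = 1"
        unfolding power_divide add_divide_distrib[symmetric] cmod_power2[symmetric] by simp
      then have "(r * (Re w / norm w))\<^sup>2 + (r * (Im w / norm w))\<^sup>2 = r\<^sup>2" for r
        unfolding power_mult_distrib distrib_left[symmetric] by simp
      then show "h w \<in> catenoid a" using assms(1) by (simp add: h_def catenoid_def vector_3)
    qed
    have nk: "norm (k p) = exp (p$3 / a)" if "p \<in> catenoid a" for p
    proof -
      have "norm (Complex (p$1) (p$2)) = a * cosh (p$3 / a)"
        using that assms(1) by (simp add: catenoid_def complex_norm)
      then show ?thesis using assms(1) by (simp add: k_def norm_mult norm_divide)
    qed
    show "k ` catenoid a \<subseteq> - {0}"
      using nk by (metis ComplI exp_not_eq_zero image_subsetI norm_zero singletonD)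
    show "k (h w) = w" if "w \<in> - {0}" for w
      using that assms(1) by (simp add: k_def h_def vector_3 complex_eq_iff)
    show "h (k p) = p" if "p \<in> catenoid a" for p
      using assms(1) unfolding h_def nk[OF that] by (simp add: k_def vec_eq_iff forall_3 vector_3)
  qed
  then show "\<exists>k. homeomorphism (- {0}) (catenoid a) h k" by blast
qed

lemma covering_space_compose_homeomorphism:
  assumes "covering_space c p S" "homeomorphism S T f g"
  shows "covering_space c (\<lambda>x. f (p x)) T"
proof
  have pc: "p ` c = S" "continuous_on c p" using assms(1) by (auto simp: covering_space_def)
  have f: "f ` S = T" "continuous_on S f" "\<And>x. x \<in> S \<Longrightarrow> g (f x) = x" "\<And>y. y \<in> T \<Longrightarrow>
      g y \<in> S" "\<And>y. y \<in> T \<Longrightarrow> f (g y) = y"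
    using assms(2) by (auto simp: homeomorphism_def)
  show "continuous_on c (\<lambda>x. f (p x))" using pc f by (auto intro: continuous_on_compose2)
  show "(\<lambda>x. f (p x)) ` c = T" using pc f by (metis image_image)
  fix y assume y: "y \<in> T"
  then obtain U v where U: "g y \<in> U" "openin (top_of_set S) U" "\<Union>v = c \<inter> p -` U"
    "\<And>u. u \<in> v \<Longrightarrow> openin (top_of_set c) u" "pairwise disjnt v" "\<And>u. u \<in> v \<Longrightarrow> \<exists>q. homeomorphism u U p q"
    using assms(1) f(4) unfolding covering_space_def by metis
  have "U \<subseteq> S" using U(2) openin_imp_subset by blast
  show "\<exists>T'. y \<in> T' \<and> openin (top_of_set T) T' \<and> (\<exists>v. \<Union>v = c \<inter> (\<lambda>x. f (p x)) -` T' \<and>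
      (\<forall>u\<in>v. openin (top_of_set c) u) \<and> pairwise disjnt v
          \<and> (\<forall>u\<in>v. \<exists>q. homeomorphism u T' (\<lambda>x. f (p x)) q))"
  proof (intro exI[of _ "f ` U"] conjI exI[of _ v] ballI)
    show "y \<in> f ` U" using U(1) f(5)[OF y] by force
    show "openin (top_of_set T) (f ` U)" by (rule homeomorphism_imp_open_map[OF assms(2) U(2)])
    have "p x \<in> U" if x: "x \<in> c" "f (p x) \<in> f ` U" for x
    proof -
      obtain s where s: "s \<in> U" "f (p x) = f s" using x(2) by blast
      have "p x \<in> S" "s \<in> S" using pc(1) x(1) s(1) \<open>U \<subseteq> S\<close> by auto
      then have "g (f (p x)) = p x" "g (f s) = s" using f(3) by blast+
      then have "p x = s" unfolding s(2) by (rule trans[OF sym])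
      then show ?thesis using s(1) by (simp only:)
    qed
    then show "\<Union>v = c \<inter> (\<lambda>x. f (p x)) -` f ` U" unfolding U(3) by auto
    fix u assume u: "u \<in> v"
    show "openin (top_of_set c) u" by (rule U(4)[OF u])
    obtain q where q: "homeomorphism u U p q" using U(6)[OF u] by blast
    have "homeomorphism U (f ` U) f g"
      by (rule homeomorphism_of_subsets[OF assms(2) \<open>U \<subseteq> S\<close> _ refl, of "f ` U"]) (use f(1) \<open>U \<subseteq> S\<close>
          in blast)
    from homeomorphism_compose[OF q this] show "\<exists>q. homeomorphism u (f ` U) (\<lambda>x. f (p x)) q"
      by (auto simp: o_def)
  qed (rule U(5))
qed

subsection \<open>The helicoid\<close>

definition helicoid :: "real \<Rightarrow> (real^3) set" where
  "helicoid a = {vector [s * cos t, s * sin t, a * t] |s t. True}"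

definition helicoid_param :: "real \<Rightarrow> complex \<Rightarrow> real^3" where
  "helicoid_param a z = vector [a * sinh (Re z) * cos (Im z), a * sinh (Re z) * sin (Im z), a * Im z]"

text \<open>The signed distance from the axis, measured along the ruling and in units of \<open>a\<close>. It is
  \<open>sinh x\<close> at the point with parameter \<open>x + \<i> y\<close>.\<close>

definition helicoid_height :: "real \<Rightarrow> real^3 \<Rightarrow> real" where
  "helicoid_height a p = (p$1 * cos (p$3 / a) + p$2 * sin (p$3 / a)) / a"

text \<open>The normalized gradient of \<open>x sin (z / a) - y cos (z / a)\<close>.\<close>

definition helicoid_normal :: "real \<Rightarrow> real^3 \<Rightarrow> real^3" where
  "helicoid_normal a p = (1 / sqrt (1 + (helicoid_height a p)\<^sup>2)) *\<^sub>R
     vector [sin (p$3 / a), - cos (p$3 / a), helicoid_height a p]"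

lemma helicoid_param_surj:
  assumes "a > 0" "p \<in> helicoid a"
  obtains x y where "p = helicoid_param a (Complex x y)"
proof -
  obtain s t where "p = vector [s * cos t, s * sin t, a * t]"
    using assms(2) by (auto simp: helicoid_def)
  then have "p = helicoid_param a (Complex (arsinh (s / a)) t)"
    using assms(1) by (simp add: helicoid_param_def)
  then show thesis by (rule that)
qed

lemma helicoid_height_param:
  assumes "a > 0"
  shows "helicoid_height a (helicoid_param a z) = sinh (Re z)"
proof -
  have "a * sinh (Re z) * cos (Im z) * cos (Im z) + a * sinh (Re z) * sin (Im z) * sin (Im z)
      = a * sinh (Re z) * ((cos (Im z))\<^sup>2 + (sin (Im z))\<^sup>2)"
    by (simp only: power2_eq_square distrib_left mult.assoc)
  moreover have p3: "helicoid_param a z $ 3 / a = Im z" using assms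
    by (simp add: helicoid_param_def vector_3)
  ultimately show ?thesis
    using assms unfolding helicoid_height_def p3 unfolding helicoid_param_def vector_3 by simp
qed

lemma sqrt_one_plus_sinh: "sqrt (1 + (sinh x)\<^sup>2) = cosh x" for x :: real
  using cosh_square_eq[of x] by (metis add.commute cosh_real_nonneg real_sqrt_unique)

lemma helicoid_normal_param:
  assumes "a > 0"
  shows "helicoid_normal a (helicoid_param a z)
      = vector [sin (Im z) / cosh (Re z), - cos (Im z) / cosh (Re z), sinh (Re z) / cosh (Re z)]"
  unfolding helicoid_normal_def helicoid_height_param[OF assms] sqrt_one_plus_sinh
  using assms by (simp add: helicoid_param_def vector_3 vec_eq_iff forall_3)

lemma smooth_helicoid_normal: "a > 0 \<Longrightarrow> smooth_on UNIV (helicoid_normal a)"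
proof -
  assume "a > 0"
  have "smooth_on UNIV (helicoid_height a)"
    unfolding helicoid_height_def[abs_def] using \<open>a > 0\<close>
    by (intro smooth_on_divide_real smooth_on_add smooth_on_mult smooth_on_const
        smooth_on_nth smooth_on_ident smooth_on_cos smooth_on_sin open_UNIV) auto
  moreover have "1 + t\<^sup>2 > 0" for t :: real
    using zero_le_power2[of t] by linarith
  ultimately show ?thesis
    unfolding helicoid_normal_def[abs_def] using \<open>a > 0\<close>
    by (intro smooth_on_vector_3 smooth_on_divide_real smooth_on_scaleR smooth_on_sqrt smooth_on_add
        smooth_on_power
        smooth_on_minus smooth_on_const smooth_on_nth smooth_on_ident smooth_on_cos smooth_on_sin
            open_UNIV)
       (auto simp: add_nonneg_eq_0_iff)
qed

lemma helicoid_explicit: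
  assumes "a > 0"
  shows "explicit_surface (helicoid a) (helicoid_normal a) (axis 3 1)
    (\<lambda>p. p$1 * sin (p$3 / a) - p$2 * cos (p$3 / a)) (\<lambda>p. sqrt (1 + (helicoid_height a p)\<^sup>2))
    (\<lambda>p. - 1 / (a * (1 + (helicoid_height a p)\<^sup>2))\<^sup>2) a"
proof
  show "norm (axis 3 1 :: real^3) = 1" by simp
  show "smooth_on UNIV (helicoid_normal a)" by (rule smooth_helicoid_normal[OF assms])
  fix p assume "p \<in> helicoid a"
  then obtain x y where xy: "p = helicoid_param a (Complex x y)" using helicoid_param_surj[OF assms]
    by blast
  have hh: "helicoid_height a p = sinh x"
    using helicoid_height_param[OF assms, of "Complex x y"] by (simp add: xy)
  have n: "helicoid_normal a p = vector [sin y / cosh x, - cos y / cosh x, sinh x / cosh x]"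
    using helicoid_normal_param[OF assms, of "Complex x y"] by (simp add: xy)
  have ch: "1 + (sinh x)\<^sup>2 = (cosh x)\<^sup>2" by (simp add: cosh_square_eq)
  have c0: "cosh x > 0" by simp
  have nV: "1 - (helicoid_normal a p \<bullet> axis 3 1)\<^sup>2 = 1 / (cosh x)\<^sup>2"
    unfolding n by (simp add: inner_axis vector_3 power_divide sinh_square_eq diff_divide_distrib)
  show "sqrt (1 + (helicoid_height a p)\<^sup>2) \<noteq> 0" unfolding hh ch by simp
  show "- 1 / (a * (1 + (helicoid_height a p)\<^sup>2))\<^sup>2 < 0" unfolding hh ch using assms by simp
  show "p$1 * sin (p$3 / a) - p$2 * cos (p$3 / a) = 0"
    using assms by (simp add: xy helicoid_param_def vector_3)
  show "norm (helicoid_normal a p) = 1"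
  proof -
    have s: "(sin y)\<^sup>2 + (cos y)\<^sup>2 + (sinh x)\<^sup>2 = (cosh x)\<^sup>2" using ch by simp
    have "(sin y / cosh x)\<^sup>2 + (- cos y / cosh x)\<^sup>2 + (sinh x / cosh x)\<^sup>2 = 1"
      unfolding power_divide power2_minus add_divide_distrib[symmetric] s using c0 by simp
    then show ?thesis by (simp add: n norm_eq_1 inner_vec_def sum_3 vector_3 power2_eq_square)
  qed
  have lt: "1 / (cosh x)\<^sup>2 > 0" by simp
  then have "(helicoid_normal a p \<bullet> axis 3 1)\<^sup>2 < 1" using nV by linarith
  then show "- 1 < helicoid_normal a p \<bullet> axis 3 1 \<and> helicoid_normal a p \<bullet> axis 3 1 < 1"
    by (simp add: abs_square_less_1 abs_less_iff minus_less_iff)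
  show "(- (- 1 / (a * (1 + (helicoid_height a p)\<^sup>2))\<^sup>2)) powr (- 1 / 2) * (1
      - (helicoid_normal a p \<bullet> axis 3 1)\<^sup>2) = a"
  proof -
    have "(1 / (a * (cosh x)\<^sup>2)\<^sup>2) powr (-1/2) = a * (cosh x)\<^sup>2"
      by (rule neg_inverse_powr) (use assms c0 in simp)
    then show ?thesis unfolding nV hh ch by simp
  qed
  have "((\<lambda>p. p$1 * sin (p$3 / a) - p$2 * cos (p$3 / a)) has_derivative
      (\<lambda>h. (p$1 * (h$3 * (cos (p$3 / a) / a)) + h$1 * sin (p$3 / a))
          - (p$2 * (h$3 * (- sin (p$3 / a) / a)) + h$2 * cos (p$3 / a)))) (at p)"
    using assms
    by (intro has_derivative_diff has_derivative_mult has_derivative_nth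
        has_derivative_nth_compose[of "\<lambda>t. sin (t / a)"]
        has_derivative_nth_compose[of "\<lambda>t. cos (t / a)"])
       (auto intro!: derivative_eq_intros)
  moreover have "sqrt (1 + (helicoid_height a p)\<^sup>2) * (helicoid_normal a p \<bullet> h)
      = (p$1 * (h$3 * (cos (p$3 / a) / a)) + h$1 * sin (p$3 / a))
          - (p$2 * (h$3 * (- sin (p$3 / a) / a)) + h$2 * cos (p$3 / a))" for h
  proof -
    have *: "r * ((1 / r) *\<^sub>R vector [x, y, z] \<bullet> h) = x * h$1 + y * h$2 + z * h$3" if "r > 0"
        for r x y z
      using that by (simp add: inner_vec_def[of "vector _"] sum_3 vector_3)
    have "sqrt (1 + (helicoid_height a p)\<^sup>2) > 0" unfolding hh ch by simp
    then have "sqrt (1 + (helicoid_height a p)\<^sup>2) * (helicoid_normal a p \<bullet> h)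
        = sin (p$3 / a) * h$1 - cos (p$3 / a) * h$2 + helicoid_height a p * h$3"
      unfolding helicoid_normal_def by (subst *) simp_all
    also have "\<dots> = (p$1 * (h$3 * (cos (p$3 / a) / a)) + h$1 * sin (p$3 / a))
        - (p$2 * (h$3 * (- sin (p$3 / a) / a)) + h$2 * cos (p$3 / a))"
      unfolding helicoid_height_def using assms by (simp add: field_simps)
    finally show ?thesis .
  qed
  ultimately show "((\<lambda>p. p$1 * sin (p$3 / a) - p$2 * cos (p$3 / a)) has_derivative
      (\<lambda>h. sqrt (1 + (helicoid_height a p)\<^sup>2) * (helicoid_normal a p \<bullet> h))) (at p)" by simp
  \<comment> \<open>the rulings and the helices are asymptotic directions\<close>
  let ?T1 = "vector [a * cosh x * cos y, a * cosh x * sin y, 0] :: real^3"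
  let ?T2 = "vector [- a * sinh x * sin y, a * sinh x * cos y, a] :: real^3"
  let ?k = "1 / (a * (cosh x)\<^sup>2)"
  have D1: "frechet_derivative (helicoid_normal a) (at p) ?T1 = ?k *\<^sub>R ?T2"
  proof -
    have 1: "((\<lambda>s. helicoid_param a (Complex s y)) has_vector_derivative ?T1) (at x)"
      unfolding helicoid_param_def complex.sel
      by (rule has_vector_derivative_vector_3) (auto intro!: derivative_eq_intros)
    have 2: "((\<lambda>s. helicoid_normal a (helicoid_param a (Complex s y))) has_vector_derivative
        vector [- sin y * sinh x / (cosh x)\<^sup>2, cos y * sinh x / (cosh x)\<^sup>2, 1 / (cosh x)\<^sup>2]) (at x)"
      unfolding helicoid_normal_param[OF assms] complex.sel
      by (rule has_vector_derivative_vector_3)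
         (auto intro!: derivative_eq_intros simp: power2_eq_square[symmetric] ch[symmetric])
    show ?thesis
      using frechet_derivative_along_curve[OF smooth_helicoid_normal[OF assms] 1 2] assms
      by (simp add: xy vec_eq_iff forall_3 vector_3)
  qed
  have D2: "frechet_derivative (helicoid_normal a) (at p) ?T2 = ?k *\<^sub>R ?T1"
  proof -
    have 1: "((\<lambda>s. helicoid_param a (Complex x s)) has_vector_derivative ?T2) (at y)"
      unfolding helicoid_param_def complex.sel
      by (rule has_vector_derivative_vector_3) (auto intro!: derivative_eq_intros)
    have 2: "((\<lambda>s. helicoid_normal a (helicoid_param a (Complex x s))) has_vector_derivative
        vector [cos y / cosh x, sin y / cosh x, 0]) (at y)"
      unfolding helicoid_normal_param[OF assms] complex.sel
      by (rule has_vector_derivative_vector_3) (auto intro!: derivative_eq_intros)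
    show ?thesis
      using frechet_derivative_along_curve[OF smooth_helicoid_normal[OF assms] 1 2] assms
      by (simp add: xy vec_eq_iff forall_3 vector_3 power2_eq_square)
  qed
  have o1: "helicoid_normal a p \<bullet> ?T1 = 0"
    by (simp add: n inner_vec_def sum_3 vector_3)
  have o2: "helicoid_normal a p \<bullet> ?T2 = 0"
  proof -
    have "s / C * (- a * S * s) + (- c / C) * (a * S * c) + S / C * a
        = a * S / C * (1 - (s\<^sup>2 + c\<^sup>2))" for c s C S
      by (simp add: power2_eq_square algebra_simps)
    then show ?thesis unfolding n inner_vec_def sum_3 vector_3 inner_real_def by simp
  qed
  have nz: "?T1 \<times> ?T2 \<noteq> 0"
  proof
    assume "?T1 \<times> ?T2 = 0"
    then have "(?T1 \<times> ?T2) $ 1 = 0" "(?T1 \<times> ?T2) $ 2 = 0" by simp_all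
    then have "cos y = 0" "sin y = 0" using assms by (simp_all add: cross3_def vector_3)
    then show False using sin_cos_squared_add[of y] by simp
  qed
  show "\<exists>T1 T2 \<alpha> \<beta> \<gamma>. helicoid_normal a p \<bullet> T1 = 0 \<and> helicoid_normal a p \<bullet> T2 = 0 \<and> T1 \<times> T2 \<noteq> 0 \<and>
      frechet_derivative (helicoid_normal a) (at p) T1 = \<alpha> *\<^sub>R T1 + \<beta> *\<^sub>R T2 \<and>
      frechet_derivative (helicoid_normal a) (at p) T2 = \<gamma> *\<^sub>R T1 - \<alpha> *\<^sub>R T2 \<and>
      - 1 / (a * (1 + (helicoid_height a p)\<^sup>2))\<^sup>2 = - \<alpha>\<^sup>2 - \<beta> * \<gamma>"
    by (rule exI[of _ ?T1], rule exI[of _ ?T2], rule exI[of _ 0], rule exI[of _ ?k], rule exI[of _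
        ?k])
       (use o1 o2 nz D1 D2 in \<open>unfold hh ch, simp add: power2_eq_square\<close>)
qed

lemma helicoid_param_homeomorphism:
  assumes "a > 0"
  shows "\<exists>k. homeomorphism UNIV (helicoid a) (helicoid_param a) k"
proof -
  define k where "k p = Complex (arsinh (helicoid_height a p)) (p$3 / a)" for p :: "real^3"
  have kh: "k (helicoid_param a z) = z" for z
    unfolding k_def helicoid_height_param[OF assms] using assms
    by (simp add: helicoid_param_def vector_3 complex_eq_iff arsinh_sinh_real)
  have "homeomorphism UNIV (helicoid a) (helicoid_param a) k"
  proof (rule homeomorphismI)
    show "continuous_on UNIV (helicoid_param a)"
      unfolding helicoid_param_def[abs_def] by (intro continuous_on_vector_3 continuous_intros)
    show "continuous_on (helicoid a) k"
    proof -
      have "continuous_on (helicoid a) (helicoid_height a)"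
        unfolding helicoid_height_def[abs_def] using assms by (intro continuous_intros) auto
      from continuous_on_compose2[OF continuous_on_arsinh[of UNIV] this] show ?thesis
        unfolding k_def Complex_eq using assms
        by (intro continuous_on_add continuous_on_mult continuous_on_of_real continuous_on_const
            continuous_on_divide continuous_on_component continuous_on_id) auto
    qed
    show "range (helicoid_param a) \<subseteq> helicoid a"
      by (force simp: helicoid_param_def helicoid_def)
    show "helicoid_param a (k p) = p" if "p \<in> helicoid a" for p
      by (rule helicoid_param_surj[OF assms that]) (simp add: kh)
  qed (use kh in auto)
  then show ?thesis by blast
qed

section \<open>Surfaces covered by a Weierstrass map\<close>

text \<open>The covering map gives the atlas and, being a Weierstrass map, universal cover data. For
  arbitrary universal cover data of \<open>C\<close>, the Weierstrass map is some immersion into \<open>C\<close>; hence it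
  has constant Chern-Ricci function, and so do its associates.\<close>

lemma explicit_surface_conclusions:
  assumes E: "explicit_surface C\<^sub>0 \<nu> V P c K a" and W: "weierstrass_data G \<Psi>"
    and T: "euclidean_isometry T" and q: "\<And>z. q z = T (weierstrass_surface G \<Psi> 0 z)"
    and cov: "covering_space UNIV q C\<^sub>0"
    and period: "\<And>z w z'. q z = q w \<Longrightarrow> q (z' + (w - z)) = q z'" and inj: "\<And>z. inj_on q (ball z pi)"
    and S: "euclidean_isometry S" "C = S ` C\<^sub>0"
  shows "embedded_const_CR2 C"
    and "\<exists>G \<Psi>. universal_cover_data G \<Psi> C"
    and "universal_cover_data G' \<Psi>' C \<Longrightarrow> euclidean_isometry S' \<Longrightarrow>
      plane_const_CR2 (\<lambda>\<zeta>. S' (weierstrass_surface G' (\<lambda>z. exp (\<i> * of_real \<theta>) * \<Psi>' z) b \<zeta>))"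
proof -
  interpret E: explicit_surface C\<^sub>0 \<nu> V P c K a by (rule E)
  interpret W: weierstrass_data G \<Psi> by (rule W)
  obtain R where R': "euclidean_isometry R" and R: "\<And>p. R (S p) = p" "\<And>p. S (R p) = p"
    by (rule euclidean_isometry_inverse[OF S(1)]) blast
  have cont: "continuous_on U S" if "euclidean_isometry S" for S U
    using that unfolding euclidean_isometry_def continuous_on_iff by auto
  have hom: "homeomorphism C\<^sub>0 C S R"
    by (rule homeomorphismI) (use R R' S cont in auto)
  have covC: "covering_space UNIV (\<lambda>z. S (q z)) C"
    by (rule covering_space_compose_homeomorphism[OF cov hom])
  then show "\<exists>G \<Psi>. universal_cover_data G \<Psi> C"
    unfolding universal_cover_data_def q
    using W.holomorphic_G W.holomorphic_\<Psi> W.nonzero euclidean_isometry_compose[OF S(1) T]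
    by (intro exI[of _ G] exI[of _ \<Psi>] conjI exI[of _ "\<lambda>p. S (T p)"] exI[of _ 0]) auto
  let ?p = "\<lambda>u. S (q (plane_complex u))"
  let ?\<D> = "range (\<lambda>z. plane_complex -` ball z pi)"
  let ?A = "(\<lambda>D. (D, ?p)) ` ?\<D>"
  have pc: "continuous_on UNIV plane_complex"
    by (rule linear_continuous_on[OF bounded_linear_plane_complex])
  have S_inj: "S x = S y \<longleftrightarrow> x = y" for x y using R(1) by metis
  have surj: "range plane_complex = UNIV" using surjI[of plane_complex, OF plane_complex_vector] .
  have open_cover: "openin (top_of_set C) (?p ` U)" if "open U" for U
  proof -
    have "openin (top_of_set C) ((\<lambda>z. S (q z)) ` (plane_complex ` U))"
      by (rule covering_space_open_map[OF covC]) (simp add: open_plane_complex_image[OF that])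
    then show ?thesis by (simp add: image_image)
  qed
  have im: "(\<Union>D\<in>?\<D>. ?p ` D) = C"
  proof -
    have "(\<Union>D\<in>?\<D>. ?p ` D) = ?p ` (\<Union>?\<D>)" by blast
    also have "\<Union>?\<D> = UNIV"
    proof -
      have "u \<in> plane_complex -` ball (plane_complex u) pi" for u by simp
      then show ?thesis by blast
    qed
    also have "range ?p = (\<lambda>z. S (q z)) ` range plane_complex" by (simp add: image_image)
    also have "\<dots> = C" unfolding surj by (rule covering_space_imp_surjective[OF covC])
    finally show ?thesis .
  qed
  have oriented: "oriented_surface (top_of_set C) ?A"
  proof (rule oriented_surface_of_periodic_map)
    show "continuous_on UNIV ?p"
      using continuous_on_compose2[OF covering_space_imp_continuous[OF covC] pc] by simp
    show "openin (top_of_set C) (?p ` U)" if "open U" for U by (rule open_cover[OF that])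
    show "?p (w + (v - u)) = ?p w" if "?p u = ?p v" for u v w
    proof -
      have "plane_complex (w + (v - u)) = plane_complex w + (plane_complex v - plane_complex u)"
        by (simp add: complex_eq_iff)
      then show ?thesis using period[of "plane_complex u" "plane_complex v" "plane_complex w"] that
        by (simp add: S_inj)
    qed
    show "open D \<and> inj_on ?p D" if mem: "D \<in> ?\<D>" for D
    proof -
      obtain z where D: "D = plane_complex -` ball z pi" using mem by blast
      have "open D" unfolding D by (rule open_vimage[OF open_ball pc])
      moreover have "inj_on ?p D"
        unfolding D
      proof (rule inj_onI)
        fix u v assume "u \<in> plane_complex -` ball z pi" "v \<in> plane_complex -` ball z pi" "?p u = ?p v"
        then have "plane_complex u = plane_complex v"
          unfolding S_inj by (intro inj_onD[OF inj[of z]]) auto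
        then show "u = v" unfolding plane_complex_inj .
      qed
      ultimately show ?thesis by blast
    qed
  qed (rule im[symmetric])
  obtain f where f: "orthogonal_transformation f" "\<And>p. S (T p) = S (T 0) + f p"
    using euclidean_isometry_affine[OF euclidean_isometry_compose[OF S(1) T]] by blast
  have patch: "surface_patch UNIV ?p (\<lambda>u. f (weierstrass_normal G (plane_complex u)))"
    using surface_patch.isometry_patch[OF W.weierstrass_patch f(1), of "S (T 0)" 0]
    unfolding q f(2)[symmetric] .
  have imm: "immersion ?A (\<lambda>p. p)"
    unfolding immersion_def smooth_map_def
    using surface_patch.smooth_Y[OF patch] surface_patch.immersed[OF patch]
    by (auto simp: o_def intro: smooth_on_subset)
  have conn: "connected_space (top_of_set C)"
  proof -
    have "connected C"
      using connected_continuous_image[OF covering_space_imp_continuous[OF covC] connected_UNIV]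
      unfolding covering_space_imp_surjective[OF covC] .
    then show ?thesis by (simp add: connected_space_subtopology connectedin_iff_connected)
  qed
  show "embedded_const_CR2 C"
    unfolding embedded_const_CR2_def
    using E.const_CR2_of_immersion_into_copy[OF oriented conn imm S(1)] S(2) by auto
  assume data: "universal_cover_data G' \<Psi>' C" and S': "euclidean_isometry S'"
  then obtain S1 b1 where S1: "euclidean_isometry S1"
      and cov1: "covering_space UNIV (\<lambda>\<zeta>. S1 (weierstrass_surface G' \<Psi>' b1 \<zeta>)) C"
    unfolding universal_cover_data_def by blast
  interpret W': weierstrass_data G' \<Psi>'
    by unfold_locales (use data in \<open>auto simp: universal_cover_data_def\<close>)
  let ?Y = "weierstrass_surface G' \<Psi>' b1"
  obtain f1 where f1: "orthogonal_transformation f1" "\<And>p. S1 p = S1 0 + f1 p"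
    using euclidean_isometry_affine[OF S1] by blast
  have "immersion plane_atlas ?Y"
    using surface_patch.smooth_Y[OF W'.weierstrass_patch] surface_patch.immersed[OF
        W'.weierstrass_patch]
    by (auto simp: immersion_def smooth_map_def plane_atlas_def o_def)
  then have imm1: "immersion plane_atlas (\<lambda>z. S1 (?Y z))"
    using immersion_isometry[OF oriented_surface_plane _ f1(1), of ?Y "S1 0"]
      unfolding f1(2)[symmetric] by blast
  have in_C: "S1 (?Y z) \<in> S ` C\<^sub>0" for z
    using covering_space_imp_surjective[OF cov1] S(2) by auto
  have conn1: "connected_space (euclidean :: complex topology)"
    using connectedin_iff_connected[of "UNIV :: complex set"] connected_UNIV
      by (simp add: connectedin_def)
  obtain N where N: "const_CR2_surface euclidean plane_atlas (\<lambda>z. S1 (?Y z)) N"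
    using E.const_CR2_of_immersion_into_copy[OF oriented_surface_plane conn1 imm1 S(1) in_C] by blast
  obtain R1 where R1: "euclidean_isometry R1" "\<And>p. R1 (S1 p) = p" "\<And>p. S1 (R1 p) = p"
    by (rule euclidean_isometry_inverse[OF S1]) blast
  obtain N1 where N1: "const_CR2_surface euclidean plane_atlas ?Y N1"
    using const_CR2_surface_isometry[OF N R1(1)] unfolding R1(2) by blast
  have "const_CR2_surface euclidean plane_atlas (weierstrass_surface G' (\<lambda>z. exp (\<i> * of_real \<theta>) *
      \<Psi>' z) b) (weierstrass_normal G')"
    by (rule associate_const_CR2[OF W'.weierstrass_data_axioms N1]) simp
  from const_CR2_surface_isometry[OF this S']
  show "plane_const_CR2 (\<lambda>\<zeta>. S' (weierstrass_surface G' (\<lambda>z. exp (\<i> * of_real \<theta>) * \<Psi>' z) b \<zeta>))"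
    unfolding plane_const_CR2_def .
qed

text \<open>Here \<open>G \<Psi> = a\<close>, so that the third coordinate is \<open>Re (a z)\<close>. Weierstrass maps send the base
  point to the origin, whence the translation.\<close>

lemma catenoid_weierstrass:
  assumes "a > 0"
  shows "weierstrass_data (\<lambda>z. - exp z) (\<lambda>z. - of_real a * exp (- z))"
    and "catenoid_param a z = vector [a, 0, 0] + weierstrass_surface (\<lambda>z. - exp z) (\<lambda>z.
        - of_real a * exp (- z)) 0 z"
proof -
  let ?G = "\<lambda>z. - exp z :: complex" and ?\<Psi> = "\<lambda>z. - complex_of_real a * exp (- z)"
  show "weierstrass_data ?G ?\<Psi>"
    by unfold_locales (use assms in \<open>auto intro!: holomorphic_intros\<close>)
  have 1: "((\<lambda>z. of_real a * (exp z + exp (- z)) / 2) has_field_derivative weierstrass_integrand ?G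
      ?\<Psi> 1 z) (at z)" for z
    unfolding weierstrass_integrand_components
    by (auto intro!: derivative_eq_intros simp: exp_minus power2_eq_square field_simps)
  have 2: "((\<lambda>z. - \<i> * of_real a * (exp z
      - exp (- z)) / 2) has_field_derivative weierstrass_integrand ?G ?\<Psi> 2 z) (at z)" for z
    unfolding weierstrass_integrand_components
    by (auto intro!: derivative_eq_intros simp: exp_minus power2_eq_square field_simps)
  have 3: "((\<lambda>z. of_real a * z) has_field_derivative weierstrass_integrand ?G ?\<Psi> 3 z) (at z)" for z
    unfolding weierstrass_integrand_components
    by (auto intro!: derivative_eq_intros simp: exp_minus power2_eq_square field_simps)
  show "catenoid_param a z = vector [a, 0, 0] + weierstrass_surface ?G ?\<Psi> 0 z"
    unfolding vec_eq_iff forall_3 vector_add_component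
      weierstrass_surface_primitive[OF 1] weierstrass_surface_primitive[OF 2]
          weierstrass_surface_primitive[OF 3]
    by (simp add: catenoid_param_def vector_3 Re_exp Im_exp cosh_def field_simps)
qed

text \<open>Here \<open>G \<Psi> = - \<i> a\<close>. Up to a rotation about the axis, the surface is the conjugate of the
  catenoid.\<close>

lemma helicoid_weierstrass:
  assumes "a > 0"
  shows "weierstrass_data (\<lambda>z. - \<i> * exp z) (\<lambda>z. of_real a * exp (- z))"
    and "helicoid_param a z = weierstrass_surface (\<lambda>z. - \<i> * exp z) (\<lambda>z. of_real a * exp (- z)) 0 z"
proof -
  let ?G = "\<lambda>z. - \<i> * exp z :: complex" and ?\<Psi> = "\<lambda>z. complex_of_real a * exp (- z)"
  show "weierstrass_data ?G ?\<Psi>"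
    by unfold_locales (use assms in \<open>auto intro!: holomorphic_intros\<close>)
  have 1: "((\<lambda>z. of_real a * (exp z - exp (- z)) / 2) has_field_derivative weierstrass_integrand ?G
      ?\<Psi> 1 z) (at z)" for z
    unfolding weierstrass_integrand_components
    by (auto intro!: derivative_eq_intros simp: exp_minus power2_eq_square field_simps)
  have 2: "((\<lambda>z. - \<i> * of_real a * (exp z
      + exp (- z)) / 2) has_field_derivative weierstrass_integrand ?G ?\<Psi> 2 z) (at z)" for z
    unfolding weierstrass_integrand_components
    by (auto intro!: derivative_eq_intros simp: exp_minus power2_eq_square field_simps)
  have 3: "((\<lambda>z. - \<i> * of_real a * z) has_field_derivative weierstrass_integrand ?G ?\<Psi> 3 z) (at z)"
      for z
    unfolding weierstrass_integrand_components
    by (auto intro!: derivative_eq_intros simp: exp_minus power2_eq_square field_simps)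
  show "helicoid_param a z = weierstrass_surface ?G ?\<Psi> 0 z"
    unfolding vec_eq_iff forall_3
      weierstrass_surface_primitive[OF 1] weierstrass_surface_primitive[OF 2]
          weierstrass_surface_primitive[OF 3]
    by (simp add: helicoid_param_def vector_3 Re_exp Im_exp sinh_def field_simps)
qed

lemma catenoid_or_helicoid_conclusions:
  assumes "is_catenoid C \<or> is_helicoid C"
  shows "embedded_const_CR2 C \<and> (\<exists>G \<Psi>. universal_cover_data G \<Psi> C) \<and>
        (\<forall>G \<Psi> \<theta> b S. universal_cover_data G \<Psi> C \<and> euclidean_isometry S \<longrightarrow>
           plane_const_CR2
             (\<lambda>\<zeta>. S (weierstrass_surface G (\<lambda>z. exp (\<i> * of_real \<theta>) * \<Psi> z) b \<zeta>)))"
  using assms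
proof
  assume "is_catenoid C"
  then obtain a S where a: "a > 0" and S: "euclidean_isometry S" "C = S ` catenoid a"
    unfolding is_catenoid_def catenoid_def by blast
  let ?h = "\<lambda>w. vector [a * cosh (ln (norm w)) * (Re w / norm w), a * cosh (ln (norm w)) * (Im w /
      norm w), a * ln (norm w)] :: real^3"
  obtain k where k: "homeomorphism (- {0}) (catenoid a) ?h k"
    using catenoid_param_covering(2)[OF a] by blast
  have he: "catenoid_param a z = ?h (exp z)" for z by (rule catenoid_param_covering(1)[OF a])
  have cov: "covering_space UNIV (catenoid_param a) (catenoid a)"
    using covering_space_compose_homeomorphism[OF covering_space_exp_punctured_plane k]
      unfolding he[symmetric] .
  have eq: "catenoid_param a z = catenoid_param a w \<longleftrightarrow> exp z = exp w" for z w
  proof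
    assume "catenoid_param a z = catenoid_param a w"
    then have "k (?h (exp z)) = k (?h (exp w))" by (simp only: he)
    moreover have "k (?h (exp u)) = exp u" for u :: complex
      by (rule homeomorphism_apply1[OF k]) simp
    ultimately show "exp z = exp w" by (simp only:)
  qed (simp only: he)
  have period: "catenoid_param a (z' + (w - z)) = catenoid_param a z'"
      if "catenoid_param a z = catenoid_param a w" for z w z'
    using that unfolding eq by (simp add: exp_add exp_diff)
  have inj: "inj_on (catenoid_param a) (ball z pi)" for z
    using inj_on_exp_pi[of z] unfolding inj_on_def eq .
  have T: "euclidean_isometry (\<lambda>p. vector [a, 0, 0] + p)" by (simp add: euclidean_isometry_def)
  note * = explicit_surface_conclusions[OF catenoid_explicit[OF a] catenoid_weierstrass(1)[OF a] T
      catenoid_weierstrass(2)[OF a] cov period inj S]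
  show ?thesis using * by blast
next
  assume "is_helicoid C"
  then obtain a S where a: "a > 0" and S: "euclidean_isometry S" "C = S ` helicoid a"
    unfolding is_helicoid_def helicoid_def by blast
  obtain k where k: "homeomorphism UNIV (helicoid a) (helicoid_param a) k"
    using helicoid_param_homeomorphism[OF a] by blast
  have eq: "helicoid_param a z = helicoid_param a w \<longleftrightarrow> z = w" for z w
    using homeomorphism_apply1[OF k UNIV_I] by metis
  have period: "helicoid_param a (z' + (w - z)) = helicoid_param a z'"
      if "helicoid_param a z = helicoid_param a w" for z w z'
    using that unfolding eq by simp
  have inj: "inj_on (helicoid_param a) (ball z pi)" for z
    unfolding inj_on_def eq by blast
  have T: "euclidean_isometry (\<lambda>p. p)" by (simp add: euclidean_isometry_def)
  note * = explicit_surface_conclusions[OF helicoid_explicit[OF a] helicoid_weierstrass(1)[OF a] T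
      helicoid_weierstrass(2)[OF a] homeomorphism_imp_covering_space[OF k] period inj S]
  show ?thesis using * by blast
qed

section \<open>Harmonicity and classification\<close>

theorem theorem1p3:
  fixes M :: "'a topology" and A :: "'a parametrization set"
    and X N :: "'a \<Rightarrow> real^3" and V :: "real^3"
  shows
    "(minimal_surface M A X N \<and>
      (\<forall>p\<in>topspace M. gauss_curvature A X p < 0) \<and>
      norm V = 1 \<and>
      (\<forall>p\<in>topspace M. -1 < angle_function N V p \<and> angle_function N V p < 1)
      \<longrightarrow>
        harmonic M A X (CR2 A X N V) \<and>
        (\<forall>p\<in>topspace M. laplace_beltrami A X
           (\<lambda>q. ln ((1 - (angle_function N V q)\<^sup>2) / (- gauss_curvature A X q) powr (1/2))) p = 0) \<and>
        (CR2 A X N V constant_on topspace M \<longrightarrow>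
          (\<exists>\<alpha> \<zeta>0. \<alpha> \<noteq> 0 \<and>
            (let g = (\<lambda>\<zeta>. exp (\<alpha> * (\<zeta> - \<zeta>0)));
                 \<Psi> = (\<lambda>\<zeta>. 1 / \<alpha> * exp (- \<alpha> * (\<zeta> - \<zeta>0)))
             in (\<forall>\<zeta>. \<Psi> \<zeta> = 1 / deriv g \<zeta>) \<and>
                part_of_up_to_isometry M A X (weierstrass_surface g \<Psi> \<zeta>0)))))
     \<and>
     (\<forall>C. is_catenoid C \<or> is_helicoid C \<longrightarrow>
        embedded_const_CR2 C \<and>
        (\<exists>G \<Psi>. universal_cover_data G \<Psi> C) \<and>
        (\<forall>G \<Psi> \<theta> b S. universal_cover_data G \<Psi> C \<and> euclidean_isometry S \<longrightarrow>
           plane_const_CR2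
             (\<lambda>\<zeta>. S (weierstrass_surface G (\<lambda>z. exp (\<i> * of_real \<theta>) * \<Psi> z) b \<zeta>))))"
proof (intro conjI impI allI)
  assume "minimal_surface M A X N \<and>
      (\<forall>p\<in>topspace M. gauss_curvature A X p < 0) \<and> norm V = 1 \<and>
      (\<forall>p\<in>topspace M. -1 < angle_function N V p \<and> angle_function N V p < 1)"
  then interpret directed_minimal_surface M A X N V
    by unfold_locales (simp add: CR2_admissible_def)
  show "harmonic M A X (CR2 A X N V)" by (rule CR2_harmonic)
  have "ln ((1 - (angle_function N V q)\<^sup>2) / (- gauss_curvature A X q) powr (1/2)) = CR2 A X N V q"
      for q
  proof -
    have "(- gauss_curvature A X q) powr (-1/2) = inverse ((- gauss_curvature A X q) powr (1/2))"
      using powr_minus[of "- gauss_curvature A X q" "1/2"] by simp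
    then show ?thesis by (simp only: CR2_def divide_inverse mult.commute)
  qed
  then show "\<forall>p\<in>topspace M. laplace_beltrami A X
      (\<lambda>q. ln ((1 - (angle_function N V q)\<^sup>2) / (- gauss_curvature A X q) powr (1/2))) p = 0"
    using laplace_CR2 by simp
  assume "CR2 A X N V constant_on topspace M"
  then obtain \<alpha> where \<alpha>: "\<alpha> \<noteq> 0"
    "part_of_up_to_isometry M A X (weierstrass_surface (\<lambda>z. exp (\<alpha> * z)) (\<lambda>z. 1 / \<alpha> * exp (- \<alpha> * z))
        0)"
    by (rule constant_CR2_representation)
  have "deriv (\<lambda>z. exp (\<alpha> * z)) z = \<alpha> * exp (\<alpha> * z)" for z
    by (rule DERIV_imp_deriv) (auto intro!: derivative_eq_intros)
  then have "1 / \<alpha> * exp (- \<alpha> * z) = 1 / deriv (\<lambda>z. exp (\<alpha> * z)) z" for z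
    by (simp add: exp_minus divide_inverse)
  with \<alpha> show "\<exists>\<alpha> \<zeta>0. \<alpha> \<noteq> 0 \<and>
            (let g = (\<lambda>\<zeta>. exp (\<alpha> * (\<zeta> - \<zeta>0)));
                 \<Psi> = (\<lambda>\<zeta>. 1 / \<alpha> * exp (- \<alpha> * (\<zeta> - \<zeta>0)))
             in (\<forall>\<zeta>. \<Psi> \<zeta> = 1 / deriv g \<zeta>) \<and>
                part_of_up_to_isometry M A X (weierstrass_surface g \<Psi> \<zeta>0))"
    unfolding Let_def by (intro exI[of _ \<alpha>] exI[of _ 0]) (simp only: diff_0_right simp_thms)
qed (use catenoid_or_helicoid_conclusions in blast)+

end
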